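(* For every fixed $\beta>0$ there are constants $C_\beta,c_\beta>0$, independent of $h$, such that for all $v_h,w_h\in W_h$ $$|a_h(v_h,w_h)|\le C_\beta\,|||v_h|||_h\,|||w_h|||_h,\qquad a_h(v_h,v_h)\ge c_\beta\,|||v_h|||_h^2.$$ (The coercivity constant $c_\beta$ may tend to zero as $\beta\downarrow0$.)
   Context: Surface. $\Gamma\subset\mathbb R^3$ is a connected, compact, orientable surface without boundary with unit normal $\mathbf n$, $P=I-\mathbf n\otimes\mathbf n$. $(\cdot,\cdot)_S$ is the $L^2(S)$ inner product. Integers $k\ge2$, $r\ge1$ are fixed, $s_k=\max\{k+1,4\}$, and $\Gamma$ is of class $C^{r+2}\cap C^{s_k,1}$. $d$ is the signed distance to $\Gamma$, $U_{\delta_0}(\Gamma)=\{|d|<\delta_0\}$ with $\delta_0$ small enough that the closest-point projection $p(x)=x-d(x)\mathbf n(x)$ onto $\Gamma$ is well defined there; $\mathbf n=\nabla d$ and $\mathcal W=D^2d$ are extended to $U_{\delta_0}(\Gamma)$. Meshes. $\gamma_h=\bigcup_{T\in\mathcal T_h}T\subset U_{\delta_0}(\Gamma)$ is a connected polyhedral surface with vertices on $\Gamma$, $\{\mathcal T_h\}_h$ is a shape-regular family of conforming affine triangulations, $h_T=\operatorname{diam}T$, $p:\gamma_h\to\Gamma$ is bijective, and $F_T:\widehat T\to T$ is the affine map from the reference triangle. $p_h^r:\gamma_h\to U_{\delta_0}(\Gamma)$ is globally continuous with $(p_h^r|_T)\circ F_T\in[\mathcal P_r(\widehat T)]^3$ for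 all $T$, and $p_h^1=\mathrm{id}$. Put $K=p_h^r(T)$, $F_K^r=(p_h^r|_T)\circ F_T$, $\Gamma_h=p_h^r(\gamma_h)$; $\mathcal K_h$ is the set of elements $K$, $\mathcal E_h$ the set of curved edges $E=p_h^r(e)$ ($e$ an edge of $\mathcal T_h$), $h_K=\operatorname{diam}K$, $h_E=\operatorname{diam}E$, $h=\max_Eh_E$. Standing mesh assumption: for all sufficiently small $h$, each $F_K^r$ is injective of rank two, with $c h_T^2|\xi|^2\le|DF_K^r(\widehat x)\xi|^2\le Ch_T^2|\xi|^2$, $\|D^mF_K^r\|_{L^\infty(\widehat T)}\le Ch_T^m$ ($2\le m\le r$), $ch_T|\widehat x-\widehat y|\le|F_K^r(\widehat x)-F_K^r(\widehat y)|\le Ch_T|\widehat x-\widehat y|$, constants independent of $T,h$; element orientations are consistent; $p:\Gamma_h\to\Gamma$ is a bijection. Discrete geometry. $\mathbf n_h$ is the elementwise oriented unit normal of $\Gamma_h$, $P_h=I-\mathbf n_h\otimes\mathbf n_h$; $\nabla_{\Gamma_h}v=P_h\nabla\widetilde v$ and $\Delta_{\Gamma_h}=\operatorname{div}_{\Gamma_h}\nabla_{\Gamma_h}$ are the elementwise tangential gradient and Laplace–Beltrami operator. A superscript $e$ denotes composition with $p$. $ds=\mu_h\,ds_h$, $ds_{p(E)}=\mu_{h,E}\,ds_E$ (measure quotients between $\Gamma$ and $\Gamma_h$, and between $p(E)$ and $E$), $B_h(x)=P^e(I-d\mathcal W)P_h:T_x\Gamma_h\to T_{p(x)}\Gamma$.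 Standing geometric assumption: $\|d\circ p_h^r\|_{W^{m,\infty}(T)}\le Ch_T^{r+1-m}$ ($m=0,1,2$), and for $h$ small $\|d\|_{L^\infty(\Gamma_h)}\le Ch^{r+1}$, $\|\mathbf n^e-\mathbf n_h\|_{L^\infty(\Gamma_h)}\le Ch^r$, $\|1-\mu_h\|_{L^\infty(\Gamma_h)}+\|1-\mu_{h,E}\|_{L^\infty(\mathcal E_h)}\le Ch^{r+1}$, $\|B_h\|_{L^\infty(\Gamma_h)}+\|B_h^{-1}\|_{L^\infty(\Gamma_h)}\le C$, $\|P^e-B_hB_h^T\|_{L^\infty(\Gamma_h)}+\|P_h-B_h^TB_h\|_{L^\infty(\Gamma_h)}\le Ch^{r+1}$, together with the elementwise/edgewise versions with $h$ replaced by $h_K$, $h_E$. $h$ is assumed sufficiently small throughout. Spaces and lifting. For $E=\partial K^+\cap\partial K^-$, $\boldsymbol\nu_E^\pm$ is the outward unit conormal to $E$ tangent to $K^\pm$; $J_E(v)=\boldsymbol\nu_E^+\cdot\nabla_{\Gamma_h}v^++\boldsymbol\nu_E^-\cdot\nabla_{\Gamma_h}v^-$, $J(v)|_E=J_E(v)$, $\{\!\{q\}\!\}=\frac12(q^++q^-)$. $W_h=\{v_h\in C^0(\Gamma_h):v_h\circ F_K^r\in\mathcal P_k(\widehat T)\ \forall K\}$, $Q_h=\{q_h\in L^2(\Gamma_h):q_h\circ F_K^r\in\mathcal P_{k-2}(\widehat T)\ \forall K\}$. $R_h:L^2(\mathcal E_h)\to Q_h$ is defined by $(R_h\phi,q_h)_{\Gamma_h}=\sum_{E\in\mathcal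 E_h}(\phi,\{\!\{q_h\}\!\})_E$ for all $q_h\in Q_h$, and $\widetilde\Delta_{\Gamma_h}v=\Delta_{\Gamma_h}v-R_hJ(v)$. $|||v|||_h^2=\|\Delta_{\Gamma_h}v\|_{L^2(\Gamma_h)}^2+\sum_{E\in\mathcal E_h}h_E^{-1}\|J_E(v)\|_{L^2(E)}^2$, and $$a_h(v,w)=(\widetilde\Delta_{\Gamma_h}v,\widetilde\Delta_{\Gamma_h}w)_{\Gamma_h}+\beta\sum_{E\in\mathcal E_h}h_E^{-1}(J_E(v),J_E(w))_E.$$ Constants may depend on $\Gamma,k,r$ and the constants in the standing assumptions. *)

theory Defs
  imports "HOL-Analysis.Analysis"
begin

text \<open>
  Derivatives are taken within the set on which a function lives, so that they make sense up to the
  boundary of closed triangles. All of these sets are open, or triangles of dimension two; for a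
  triangle in space the derivative is determined only in directions parallel to its plane, and
  is used only in such directions.
\<close>

definition dir_deriv ::
  "'a::real_normed_vector set \<Rightarrow> 'a \<Rightarrow> ('a \<Rightarrow> 'b::real_normed_vector) \<Rightarrow> 'a \<Rightarrow> 'b" where
  "dir_deriv S \<xi> f x = frechet_derivative f (at x within S) \<xi>"

primrec iter_deriv ::
  "'a::real_normed_vector set \<Rightarrow> 'a list \<Rightarrow> ('a \<Rightarrow> 'b::real_normed_vector) \<Rightarrow> 'a \<Rightarrow> 'b" where
  "iter_deriv S [] f = f"
| "iter_deriv S (\<xi> # \<xi>s) f = dir_deriv S \<xi> (iter_deriv S \<xi>s f)"

text \<open>
  \<open>deriv_bound S V m f b\<close> says that on \<open>S\<close> the multilinear form \<open>D\<^sup>m f\<close>, restricted to the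
  space of directions \<open>V\<close>, has operator norm at most \<open>b\<close>. It is applied to functions whose
  derivatives are continuous on \<open>S\<close>, where the supremum is the essential supremum.
\<close>

definition deriv_bound ::
  "'a::real_normed_vector set \<Rightarrow> 'a set \<Rightarrow> nat \<Rightarrow> ('a \<Rightarrow> 'b::real_normed_vector) \<Rightarrow> real \<Rightarrow> bool" where
  "deriv_bound S V m f b \<longleftrightarrow>
     (\<forall>\<xi>s x. length \<xi>s = m \<longrightarrow> set \<xi>s \<subseteq> V \<longrightarrow> x \<in> S \<longrightarrow>
        norm (iter_deriv S \<xi>s f x) \<le> b * prod_list (map norm \<xi>s))"

primrec Ck_on ::
  "nat \<Rightarrow> ('a::real_normed_vector \<Rightarrow> 'b::real_normed_vector) \<Rightarrow> 'a set \<Rightarrow> bool" where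
  "Ck_on 0 f U \<longleftrightarrow> continuous_on U f"
| "Ck_on (Suc m) f U \<longleftrightarrow> f differentiable_on U \<and> (\<forall>\<xi>. Ck_on m (dir_deriv U \<xi> f) U)"

definition Ck1_on ::
  "nat \<Rightarrow> ('a::real_normed_vector \<Rightarrow> 'b::real_normed_vector) \<Rightarrow> 'a set \<Rightarrow> bool" where
  "Ck1_on m f U \<longleftrightarrow> Ck_on m f U \<and>
     (\<forall>\<xi>s. length \<xi>s = m \<longrightarrow> (\<exists>L. L-lipschitz_on U (iter_deriv U \<xi>s f)))"

definition grad :: "('a::real_inner \<Rightarrow> real) \<Rightarrow> 'a \<Rightarrow> 'a" where
  "grad f x = (THE D. GDERIV f x :> D)"

definition proj :: "real^3 \<Rightarrow> real^3^3" where
  "proj \<nu> = mat 1 - (\<chi> i j. \<nu> $ i * \<nu> $ j)"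

text \<open>
  The regularity class \<open>\<R>\<close> is a predicate on local level-set functions; the Lipschitz
  condition in \<open>Ck1_on\<close> is local because the neighbourhood can be shrunk.
\<close>

definition hypersurface_of_class ::
  "((real^3 \<Rightarrow> real) \<Rightarrow> (real^3) set \<Rightarrow> bool) \<Rightarrow> (real^3) set \<Rightarrow> bool" where
  "hypersurface_of_class \<R> \<Gamma> \<longleftrightarrow>
     (\<forall>x\<in>\<Gamma>. \<exists>U \<phi>. open U \<and> x \<in> U \<and> \<R> \<phi> U \<and> (\<forall>y\<in>U. \<exists>D. GDERIV \<phi> y :> D \<and> D \<noteq> 0) \<and>
        \<Gamma> \<inter> U = {y \<in> U. \<phi> y = 0})"

definition tangent_vectors :: "(real^3) set \<Rightarrow> real^3 \<Rightarrow> (real^3) set" where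
  "tangent_vectors \<Gamma> x =
     {\<tau>. \<exists>\<gamma>. \<gamma> 0 = x \<and> (\<forall>t. \<gamma> t \<in> \<Gamma>) \<and> (\<gamma> has_vector_derivative \<tau>) (at 0)}"

definition oriented_by :: "(real^3) set \<Rightarrow> (real^3 \<Rightarrow> real^3) \<Rightarrow> bool" where
  "oriented_by \<Gamma> n \<longleftrightarrow> continuous_on \<Gamma> n \<and>
     (\<forall>x\<in>\<Gamma>. norm (n x) = 1 \<and> (\<forall>\<tau>\<in>tangent_vectors \<Gamma> x. n x \<bullet> \<tau> = 0))"

text \<open>The sign is the one for which \<open>\<nabla> d\<close> extends the given orientation \<open>n\<close>.\<close>

definition signed_distance ::
  "(real^3) set \<Rightarrow> (real^3 \<Rightarrow> real^3) \<Rightarrow> (real^3 \<Rightarrow> real) \<Rightarrow> bool" where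
  "signed_distance \<Gamma> n d \<longleftrightarrow> continuous_on UNIV d \<and> (\<forall>x. \<bar>d x\<bar> = infdist x \<Gamma>) \<and>
     (\<forall>x\<in>\<Gamma>. GDERIV d x :> n x)"

definition tube :: "(real^3 \<Rightarrow> real) \<Rightarrow> real \<Rightarrow> (real^3) set" where
  "tube d \<delta> = {x. \<bar>d x\<bar> < \<delta>}"

definition closest_pt :: "(real^3 \<Rightarrow> real) \<Rightarrow> real^3 \<Rightarrow> real^3" where
  "closest_pt d x = x - d x *\<^sub>R grad d x"

definition weingarten :: "(real^3 \<Rightarrow> real) \<Rightarrow> real^3 \<Rightarrow> real^3^3" where
  "weingarten d x = matrix (frechet_derivative (grad d) (at x))"

definition tubular_width :: "(real^3) set \<Rightarrow> (real^3 \<Rightarrow> real) \<Rightarrow> real \<Rightarrow> bool" where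
  "tubular_width \<Gamma> d \<delta> \<longleftrightarrow> 0 < \<delta> \<and> Ck_on 2 d (tube d \<delta>) \<and>
     (\<forall>x\<in>tube d \<delta>. \<forall>y. (y \<in> \<Gamma> \<and> dist x y = infdist x \<Gamma>) \<longleftrightarrow> y = closest_pt d x)"

text \<open>
  A triangle is an ordered triple of vertices; the order fixes both the affine reference map and
  the orientation. Indices in the type \<open>3\<close> are taken modulo three, so the directed edges of \<open>T\<close>
  run from \<open>T i\<close> to \<open>T (i + 1)\<close>.
\<close>

type_synonym tri = "3 \<Rightarrow> real^3"

record mesh =
  tris :: "tri set"
  lift :: "real^3 \<Rightarrow> real^3"

definition ref_tri :: "(real^2) set" where
  "ref_tri = {x. 0 \<le> x $ 1 \<and> 0 \<le> x $ 2 \<and> x $ 1 + x $ 2 \<le> 1}"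

definition ref_vertex :: "3 \<Rightarrow> real^2" where
  "ref_vertex i = (if i = 1 then 0 else if i = 2 then axis 1 1 else axis 2 1)"

definition aff_map :: "tri \<Rightarrow> real^2 \<Rightarrow> real^3" where
  "aff_map T x = T 1 + x $ 1 *\<^sub>R (T 2 - T 1) + x $ 2 *\<^sub>R (T 3 - T 1)"

definition flat :: "tri \<Rightarrow> (real^3) set" where
  "flat T = convex hull (range T)"

definition poly_surface :: "mesh \<Rightarrow> (real^3) set" where
  "poly_surface M = (\<Union>T\<in>tris M. flat T)"

text \<open>Edges are given by the set of their two endpoints.\<close>

definition edges :: "mesh \<Rightarrow> (real^3) set set" where
  "edges M = {{T i, T j} |T i j. T \<in> tris M \<and> i \<noteq> j}"

definition edge_tris :: "mesh \<Rightarrow> (real^3) set \<Rightarrow> tri set" where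
  "edge_tris M e = {T \<in> tris M. e \<subseteq> range T}"

definition elem :: "mesh \<Rightarrow> tri \<Rightarrow> (real^3) set" where
  "elem M T = lift M ` flat T"

definition elem_map :: "mesh \<Rightarrow> tri \<Rightarrow> real^2 \<Rightarrow> real^3" where
  "elem_map M T = lift M \<circ> aff_map T"

definition discrete_surface :: "mesh \<Rightarrow> (real^3) set" where
  "discrete_surface M = lift M ` poly_surface M"

definition curved_edge :: "mesh \<Rightarrow> (real^3) set \<Rightarrow> (real^3) set" where
  "curved_edge M e = lift M ` (convex hull e)"

definition elem_diam :: "mesh \<Rightarrow> tri \<Rightarrow> real" where
  "elem_diam M T = diameter (elem M T)"

definition edge_diam :: "mesh \<Rightarrow> (real^3) set \<Rightarrow> real" where
  "edge_diam M e = diameter (curved_edge M e)"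

definition mesh_size :: "mesh \<Rightarrow> real" where
  "mesh_size M = Max (edge_diam M ` edges M)"

definition ref_poly :: "nat \<Rightarrow> (real^2 \<Rightarrow> real) \<Rightarrow> bool" where
  "ref_poly m f \<longleftrightarrow>
     (\<exists>a. \<forall>x\<in>ref_tri. f x = (\<Sum>i\<le>m. \<Sum>j\<le>m - i. a i j * (x $ 1) ^ i * (x $ 2) ^ j))"

definition conforming_closed_mesh ::
  "(real^3) set \<Rightarrow> (real^3 \<Rightarrow> real) \<Rightarrow> real \<Rightarrow> mesh \<Rightarrow> bool" where
  "conforming_closed_mesh \<Gamma> d \<delta> M \<longleftrightarrow>
     finite (tris M) \<and>
     (\<forall>T\<in>tris M. inj T \<and> \<not> affine_dependent (range T) \<and> range T \<subseteq> \<Gamma>) \<and>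
     (\<forall>T\<in>tris M. \<forall>T'\<in>tris M. flat T \<inter> flat T' = convex hull (range T \<inter> range T')) \<and>
     inj_on range (tris M) \<and>
     (\<forall>e\<in>edges M. card (edge_tris M e) = 2) \<and>
     connected (poly_surface M) \<and>
     poly_surface M \<subseteq> tube d \<delta> \<and>
     bij_betw (closest_pt d) (poly_surface M) \<Gamma>"

text \<open>Intersecting the ball with the affine hull gives the disc in the plane of the triangle.\<close>

definition shape_regular :: "real \<Rightarrow> mesh \<Rightarrow> bool" where
  "shape_regular \<sigma> M \<longleftrightarrow>
     (\<forall>T\<in>tris M. \<exists>z\<in>flat T. \<exists>\<rho>>0. cball z \<rho> \<inter> affine hull (range T) \<subseteq> flat T \<and>
        diameter (flat T) \<le> \<sigma> * \<rho>)"

definition polynomial_lift :: "nat \<Rightarrow> (real^3 \<Rightarrow> real) \<Rightarrow> real \<Rightarrow> mesh \<Rightarrow> bool" where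
  "polynomial_lift r d \<delta> M \<longleftrightarrow>
     continuous_on (poly_surface M) (lift M) \<and>
     lift M ` poly_surface M \<subseteq> tube d \<delta> \<and>
     (\<forall>T\<in>tris M. \<forall>i. ref_poly r (\<lambda>x. elem_map M T x $ i)) \<and>
     (r = 1 \<longrightarrow> (\<forall>x\<in>poly_surface M. lift M x = x))"

definition ref_D :: "(real^2 \<Rightarrow> real^3) \<Rightarrow> real^2 \<Rightarrow> real^2 \<Rightarrow> real^3" where
  "ref_D F x = frechet_derivative F (at x within ref_tri)"

text \<open>The last but one conjunct is the consistency of the orientations: no directed edge belongs
  to two elements.\<close>

definition standing_mesh ::
  "(real^3) set \<Rightarrow> (real^3 \<Rightarrow> real) \<Rightarrow> nat \<Rightarrow> real \<Rightarrow> real \<Rightarrow> mesh \<Rightarrow> bool" where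
  "standing_mesh \<Gamma> d r c C M \<longleftrightarrow>
     (\<forall>T\<in>tris M. let F = elem_map M T; hT = diameter (flat T) in
        inj_on F ref_tri \<and>
        (\<forall>x\<in>ref_tri. rank (matrix (ref_D F x)) = 2) \<and>
        (\<forall>x\<in>ref_tri. \<forall>\<xi>. c * hT\<^sup>2 * (norm \<xi>)\<^sup>2 \<le> (norm (ref_D F x \<xi>))\<^sup>2 \<and>
                         (norm (ref_D F x \<xi>))\<^sup>2 \<le> C * hT\<^sup>2 * (norm \<xi>)\<^sup>2) \<and>
        (\<forall>m\<in>{2..r}. deriv_bound ref_tri UNIV m F (C * hT ^ m)) \<and>
        (\<forall>x\<in>ref_tri. \<forall>y\<in>ref_tri. c * hT * norm (x - y) \<le> norm (F x - F y) \<and>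
                                 norm (F x - F y) \<le> C * hT * norm (x - y))) \<and>
     (\<forall>T\<in>tris M. \<forall>T'\<in>tris M. \<forall>i j. T i = T' j \<and> T (i + 1) = T' (j + 1) \<longrightarrow> T = T') \<and>
     bij_betw (closest_pt d) (discrete_surface M) \<Gamma>"

text \<open>
  Quantities on \<open>\<Gamma>\<^sub>h\<close> that may jump across edges are represented elementwise, by functions that
  take the triangle below the element as an additional argument.
\<close>

definition ref_pt :: "mesh \<Rightarrow> tri \<Rightarrow> real^3 \<Rightarrow> real^2" where
  "ref_pt M T = inv_into ref_tri (elem_map M T)"

definition area_normal :: "(real^2 \<Rightarrow> real^3) \<Rightarrow> real^2 \<Rightarrow> real^3" where
  "area_normal F x = cross3 (ref_D F x (axis 1 1)) (ref_D F x (axis 2 1))"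

definition area_elt :: "(real^2 \<Rightarrow> real^3) \<Rightarrow> real^2 \<Rightarrow> real" where
  "area_elt F x = norm (area_normal F x)"

definition nh :: "mesh \<Rightarrow> tri \<Rightarrow> real^3 \<Rightarrow> real^3" where
  "nh M T x = sgn (area_normal (elem_map M T) (ref_pt M T x))"

text \<open>
  Integrals over curved elements and edges are pulled back along their regular injective
  parametrisations, over the reference triangle and the unit interval.
\<close>

definition elem_integral :: "mesh \<Rightarrow> tri \<Rightarrow> (real^3 \<Rightarrow> real) \<Rightarrow> real" where
  "elem_integral M T f =
     (LINT x:ref_tri|lborel. f (elem_map M T x) * area_elt (elem_map M T) x)"

text \<open>The choice of the direction in which an edge is traversed does not affect integrals.\<close>

definition edge_curve :: "mesh \<Rightarrow> (real^3) set \<Rightarrow> real \<Rightarrow> real^3" where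
  "edge_curve M e = (let (a, b) = (SOME (a, b). e = {a, b}) in lift M \<circ> linepath a b)"

definition line_elt :: "(real \<Rightarrow> real^3) \<Rightarrow> real \<Rightarrow> real" where
  "line_elt \<gamma> t = norm (vector_derivative \<gamma> (at t within {0..1}))"

definition edge_integral :: "mesh \<Rightarrow> (real^3) set \<Rightarrow> (real^3 \<Rightarrow> real) \<Rightarrow> real" where
  "edge_integral M e f =
     (LINT t:{0..1}|lborel. f (edge_curve M e t) * line_elt (edge_curve M e) t)"

text \<open>
  \<open>p \<circ> F\<close> parametrises \<open>p(K)\<close> whenever \<open>F\<close> parametrises \<open>K\<close>, and likewise for edges; the measure
  quotients are the quotients of the surface and line elements.
\<close>

definition mu_h :: "(real^3 \<Rightarrow> real) \<Rightarrow> mesh \<Rightarrow> tri \<Rightarrow> real^3 \<Rightarrow> real" where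
  "mu_h d M T x = area_elt (closest_pt d \<circ> elem_map M T) (ref_pt M T x) /
     area_elt (elem_map M T) (ref_pt M T x)"

definition mu_hE :: "(real^3 \<Rightarrow> real) \<Rightarrow> mesh \<Rightarrow> (real^3) set \<Rightarrow> real \<Rightarrow> real" where
  "mu_hE d M e t = line_elt (closest_pt d \<circ> edge_curve M e) t / line_elt (edge_curve M e) t"

definition Bh :: "(real^3 \<Rightarrow> real) \<Rightarrow> mesh \<Rightarrow> tri \<Rightarrow> real^3 \<Rightarrow> real^3^3" where
  "Bh d M T x = proj (grad d (closest_pt d x)) ** (mat 1 - d x *\<^sub>R weingarten d x) **
     proj (nh M T x)"

text \<open>The bounds on one element, in terms of a length \<open>\<eta>\<close> which is either \<open>h\<close> or \<open>h\<^sub>K\<close>;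
  \<open>op_bound A b\<close> bounds the spectral norm.\<close>

definition op_bound :: "real^3^3 \<Rightarrow> real \<Rightarrow> bool" where
  "op_bound A b \<longleftrightarrow> onorm ((*v) A) \<le> b"

definition elem_geometry ::
  "(real^3 \<Rightarrow> real) \<Rightarrow> nat \<Rightarrow> real \<Rightarrow> mesh \<Rightarrow> tri \<Rightarrow> real \<Rightarrow> bool" where
  "elem_geometry d r C M T \<eta> \<longleftrightarrow>
     (\<forall>x\<in>elem M T.
        let ne = grad d (closest_pt d x); n = nh M T x; B = Bh d M T x;
            tangent_h = {\<xi>. n \<bullet> \<xi> = 0}; tangent = {\<xi>. ne \<bullet> \<xi> = 0} in
        \<bar>d x\<bar> \<le> C * \<eta> ^ (r + 1) \<and>
        norm (ne - n) \<le> C * \<eta> ^ r \<and>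
        \<bar>1 - mu_h d M T x\<bar> \<le> C * \<eta> ^ (r + 1) \<and>
        op_bound B C \<and>
        bij_betw ((*v) B) tangent_h tangent \<and>
        (\<forall>\<xi>\<in>tangent. norm (inv_into tangent_h ((*v) B) \<xi>) \<le> C * norm \<xi>) \<and>
        op_bound (proj ne - B ** transpose B) (C * \<eta> ^ (r + 1)) \<and>
        op_bound (proj n - transpose B ** B) (C * \<eta> ^ (r + 1)))"

definition lift_distance_bound :: "(real^3 \<Rightarrow> real) \<Rightarrow> nat \<Rightarrow> real \<Rightarrow> mesh \<Rightarrow> bool" where
  "lift_distance_bound d r C M \<longleftrightarrow>
     (\<forall>T\<in>tris M. \<forall>m\<le>2. \<forall>j\<le>m.
        deriv_bound (flat T) (span {T i - T 1 |i. True}) j (d \<circ> lift M)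
          (C * diameter (flat T) ^ (r + 1 - m)))"

definition standing_geometry :: "(real^3 \<Rightarrow> real) \<Rightarrow> nat \<Rightarrow> real \<Rightarrow> mesh \<Rightarrow> bool" where
  "standing_geometry d r C M \<longleftrightarrow>
     (\<forall>T\<in>tris M. \<forall>\<eta>\<in>{mesh_size M, elem_diam M T}. elem_geometry d r C M T \<eta>) \<and>
     (\<forall>e\<in>edges M. \<forall>\<eta>\<in>{mesh_size M, edge_diam M e}. \<forall>t\<in>{0..1}.
        \<bar>1 - mu_hE d M e t\<bar> \<le> C * \<eta> ^ (r + 1))"

definition admissible_family ::
  "(real^3) set \<Rightarrow> (real^3 \<Rightarrow> real) \<Rightarrow> real \<Rightarrow> nat \<Rightarrow> real \<Rightarrow> real \<Rightarrow> real \<Rightarrow> real \<Rightarrow> mesh set \<Rightarrow> bool"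
where
  "admissible_family \<Gamma> d \<delta> r \<sigma> c C h\<^sub>1 \<M> \<longleftrightarrow>
     (\<forall>M\<in>\<M>. conforming_closed_mesh \<Gamma> d \<delta> M \<and> shape_regular \<sigma> M \<and> polynomial_lift r d \<delta> M \<and>
        lift_distance_bound d r C M \<and>
        (mesh_size M < h\<^sub>1 \<longrightarrow> standing_mesh \<Gamma> d r c C M \<and> standing_geometry d r C M))"

text \<open>\<open>P \<nabla> ft\<close> for any extension \<open>ft\<close> of \<open>f\<close> off \<open>K\<close> that is differentiable at the point; \<open>N\<close> is
  the unit normal field of \<open>K\<close>.\<close>

definition tan_grad ::
  "(real^3) set \<Rightarrow> (real^3 \<Rightarrow> real^3) \<Rightarrow> (real^3 \<Rightarrow> real) \<Rightarrow> real^3 \<Rightarrow> real^3" where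
  "tan_grad K N f x =
     (THE g. \<exists>ft D. (\<forall>y\<in>K. ft y = f y) \<and> GDERIV ft x :> D \<and> g = proj (N x) *v D)"

definition tan_div ::
  "(real^3) set \<Rightarrow> (real^3 \<Rightarrow> real^3) \<Rightarrow> (real^3 \<Rightarrow> real^3) \<Rightarrow> real^3 \<Rightarrow> real" where
  "tan_div K N w x = (\<Sum>i\<in>UNIV. tan_grad K N (\<lambda>y. w y $ i) x $ i)"

definition grad_h :: "mesh \<Rightarrow> (real^3 \<Rightarrow> real) \<Rightarrow> tri \<Rightarrow> real^3 \<Rightarrow> real^3" where
  "grad_h M v T = tan_grad (elem M T) (nh M T) v"

definition lap_h :: "mesh \<Rightarrow> (real^3 \<Rightarrow> real) \<Rightarrow> tri \<Rightarrow> real^3 \<Rightarrow> real" where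
  "lap_h M v T = tan_div (elem M T) (nh M T) (grad_h M v T)"

text \<open>
  The unit vector tangent to the element and orthogonal to the edge that points out of the
  element, that is, away from the vertex opposite to the edge in reference coordinates.
\<close>

definition conormal :: "mesh \<Rightarrow> (real^3) set \<Rightarrow> tri \<Rightarrow> real^3 \<Rightarrow> real^3" where
  "conormal M e T x =
     (let xr = ref_pt M T x; A = ref_D (elem_map M T) xr in
      THE \<nu>. norm \<nu> = 1 \<and> \<nu> \<bullet> nh M T x = 0 \<and>
        (\<forall>i j. T i \<in> e \<and> T j \<in> e \<longrightarrow> \<nu> \<bullet> A (ref_vertex j - ref_vertex i) = 0) \<and>
        (\<forall>l. T l \<notin> e \<longrightarrow> \<nu> \<bullet> A (ref_vertex l - xr) < 0))"

text \<open>The sums run over the two elements \<open>K\<^sup>+\<close> and \<open>K\<^sup>-\<close> that share the edge.\<close>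

definition jump :: "mesh \<Rightarrow> (real^3 \<Rightarrow> real) \<Rightarrow> (real^3) set \<Rightarrow> real^3 \<Rightarrow> real" where
  "jump M v e x = (\<Sum>T\<in>edge_tris M e. conormal M e T x \<bullet> grad_h M v T x)"

definition avg :: "mesh \<Rightarrow> (tri \<Rightarrow> real^3 \<Rightarrow> real) \<Rightarrow> (real^3) set \<Rightarrow> real^3 \<Rightarrow> real" where
  "avg M q e x = (\<Sum>T\<in>edge_tris M e. q T x) / 2"

definition inner_h :: "mesh \<Rightarrow> (tri \<Rightarrow> real^3 \<Rightarrow> real) \<Rightarrow> (tri \<Rightarrow> real^3 \<Rightarrow> real) \<Rightarrow> real" where
  "inner_h M f g = (\<Sum>T\<in>tris M. elem_integral M T (\<lambda>x. f T x * g T x))"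

definition inner_E ::
  "mesh \<Rightarrow> (real^3) set \<Rightarrow> (real^3 \<Rightarrow> real) \<Rightarrow> (real^3 \<Rightarrow> real) \<Rightarrow> real" where
  "inner_E M e f g = edge_integral M e (\<lambda>x. f x * g x)"

definition Wh :: "nat \<Rightarrow> mesh \<Rightarrow> (real^3 \<Rightarrow> real) set" where
  "Wh k M = {v. continuous_on (discrete_surface M) v \<and>
     (\<forall>T\<in>tris M. ref_poly k (v \<circ> elem_map M T))}"

text \<open>Membership in \<open>L\<^sup>2\<close> is automatic for elementwise polynomial functions.\<close>

definition Qh :: "nat \<Rightarrow> mesh \<Rightarrow> (tri \<Rightarrow> real^3 \<Rightarrow> real) set" where
  "Qh k M = {q. \<forall>T\<in>tris M. ref_poly (k - 2) (q T \<circ> elem_map M T)}"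

text \<open>
  The defining identity determines \<open>R\<^sub>h \<phi>\<close> on every element; the choice operator only fixes the
  irrelevant values of the representing functions elsewhere.
\<close>

definition Rh ::
  "nat \<Rightarrow> mesh \<Rightarrow> ((real^3) set \<Rightarrow> real^3 \<Rightarrow> real) \<Rightarrow> tri \<Rightarrow> real^3 \<Rightarrow> real" where
  "Rh k M \<phi> = (SOME R. R \<in> Qh k M \<and>
     (\<forall>q\<in>Qh k M. inner_h M R q = (\<Sum>e\<in>edges M. inner_E M e (\<phi> e) (avg M q e))))"

definition lap_tilde :: "nat \<Rightarrow> mesh \<Rightarrow> (real^3 \<Rightarrow> real) \<Rightarrow> tri \<Rightarrow> real^3 \<Rightarrow> real" where
  "lap_tilde k M v T x = lap_h M v T x - Rh k M (jump M v) T x"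

definition triple_norm :: "mesh \<Rightarrow> (real^3 \<Rightarrow> real) \<Rightarrow> real" where
  "triple_norm M v = sqrt (inner_h M (lap_h M v) (lap_h M v) +
     (\<Sum>e\<in>edges M. inverse (edge_diam M e) * inner_E M e (jump M v e) (jump M v e)))"

definition a_h :: "nat \<Rightarrow> real \<Rightarrow> mesh \<Rightarrow> (real^3 \<Rightarrow> real) \<Rightarrow> (real^3 \<Rightarrow> real) \<Rightarrow> real" where
  "a_h k \<beta> M v w = inner_h M (lap_tilde k M v) (lap_tilde k M w) +
     \<beta> * (\<Sum>e\<in>edges M. inverse (edge_diam M e) * inner_E M e (jump M v e) (jump M w e))"

end

theory Submission
  imports Defs
begin

text \<open>
  Write \<open>|\<phi>|\<^sup>2\<close> for \<open>\<Sum>\<^sub>E h\<^sub>E\<^sup>-\<^sup>1 \<parallel>\<phi>\<parallel>\<^sup>2\<close> over the edges. Everything rests on the stability of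
  the lifting, \<open>\<parallel>R\<^sub>h \<phi>\<parallel>\<^sup>2 \<le> S |\<phi>|\<^sup>2\<close>, with \<open>S\<close> depending only on \<open>k\<close> and the mesh constants
  (\<open>Rh_stability\<close>). Given it, the discrete Laplacian \<open>\<Delta> v\<close> and \<open>\<Delta> v - R\<^sub>h J(v)\<close> differ by
  a term controlled by the jumps, so each of their squared norms is at most twice the other plus
  \<open>2 S |J(v)|\<^sup>2\<close>. Boundedness follows with Cauchy-Schwarz, and coercivity holds for
  every \<open>\<beta> > 0\<close>, since the penalty term in \<open>a\<^sub>h(v,v)\<close> controls the jumps up to the
  factor \<open>1/\<beta>\<close> (\<open>a_h_bounds\<close>).

  Stability is obtained by testing the definition of \<open>R = R\<^sub>h \<phi>\<close> with \<open>R\<close> itself: Cauchy-Schwarz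
  gives \<open>\<parallel>R\<parallel>\<^sup>4 \<le> |\<phi>|\<^sup>2 \<Sum>\<^sub>E h\<^sub>E \<parallel>{R}\<parallel>\<^sup>2\<close>, and the last sum is at most a constant times
  \<open>\<parallel>R\<parallel>\<^sup>2\<close> by the inverse trace inequality for polynomials. On the reference triangle the latter
  is the estimate of the maximum of a polynomial by its \<open>L\<^sup>2\<close> norm (\<open>ref_poly_sup_bound\<close>), proved
  directly: along a segment from \<open>P\<close> to \<open>Q\<close>, a vanishing finite difference expresses the value at
  \<open>P\<close> through the values at the points \<open>P + (j/N)(Q - P)\<close>, \<open>j = 1,\<dots>,N\<close>; integrating over \<open>Q\<close>
  and undoing each dilation about \<open>P\<close> gives the bound. In the transfer to a curved element, the
  edge diameter and the line element are of order \<open>h\<^sub>T\<close> and the area element is at least of order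
  \<open>h\<^sub>T\<^sup>2\<close>, so that all powers of the mesh size cancel.

  Since \<open>R\<^sub>h\<close> is given by a choice operator, a function with its defining property has to be
  produced. The identity decouples over the elements, and on each of them it asks for a Riesz
  representative in the span of finitely many monomials; \<open>finite_span_riesz\<close> constructs it by
  Gram-Schmidt orthogonalization.

  These computations need the integrands to be integrable, that is, that the quantities defined
  through derivatives on curved elements are continuous. In reference coordinates the
  components of the tangential gradient are rational functions without poles
  (\<open>tan_grad_parametrized\<close>, \<open>regular_tan_grad\<close>); this class is closed under differentiation, hence
  the Laplacian is again of this kind, up to the boundary of the element. On an edge the conormal is
  the normalized cross product of the tangent and the surface normal (\<open>conormal_eq\<close>), so the
  jumps are continuous along edges.
\<close>

section \<open>Semi-inner products and Riesz representation on a finite span\<close>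

text \<open>
  The discriminant criterion, including the degenerate case \<open>c = 0\<close>: semidefinite forms
  are all that is available, because a function on an element is determined by its integrals only
  up to its values elsewhere.
\<close>

lemma semidefinite_discriminant:
  fixes a b c :: real
  assumes "\<And>t. 0 \<le> a + 2 * t * b + t\<^sup>2 * c"
  shows "b\<^sup>2 \<le> a * c"
proof (cases "c = 0")
  case True
  have "b = 0"
  proof (rule ccontr)
    assume "b \<noteq> 0"
    then have "a + 2 * (- (a + 1) / (2 * b)) * b = -1" by (simp add: field_simps)
    then show False using assms[of "- (a + 1) / (2 * b)"] True by simp
  qed
  then show ?thesis using True by simp
next
  case False
  have c: "c > 0"
  proof (rule ccontr)
    assume "\<not> c > 0"
    then have c: "c < 0" using False by simp
    have a: "0 \<le> a" using assms[of 0] by simp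
    define t where "t = sqrt ((a + 1) / - c)"
    have t: "t\<^sup>2 * c = - (a + 1)" using c a unfolding t_def by (simp add: divide_nonneg_neg field_simps)
    show False using assms[of t] assms[of "- t"] t by simp
  qed
  have "0 \<le> a + 2 * (- b / c) * b + (- b / c)\<^sup>2 * c" by (rule assms)
  also have "\<dots> = a - b\<^sup>2 / c" using c by (simp add: field_simps power2_eq_square)
  finally show ?thesis using c by (simp add: field_simps)
qed

text \<open>
  The fields on elements and on edges are functions of two curried arguments, one of them being
  the triangle or the edge. The linear combination \<open>u + c w\<close> is therefore a parameter.
\<close>

locale semi_inner_product =
  fixes W :: "'v set" and comb :: "real \<Rightarrow> 'v \<Rightarrow> 'v \<Rightarrow> 'v" and B :: "'v \<Rightarrow> 'v \<Rightarrow> real"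
  assumes comb_in: "u \<in> W \<Longrightarrow> w \<in> W \<Longrightarrow> comb c u w \<in> W"
    and sym: "u \<in> W \<Longrightarrow> w \<in> W \<Longrightarrow> B u w = B w u"
    and comb_left: "u \<in> W \<Longrightarrow> w \<in> W \<Longrightarrow> z \<in> W \<Longrightarrow> B (comb c u w) z = B u z + c * B w z"
    and nonneg: "u \<in> W \<Longrightarrow> 0 \<le> B u u"
begin

lemma comb_right:
  assumes "z \<in> W" "u \<in> W" "w \<in> W"
  shows "B z (comb c u w) = B z u + c * B z w"
  unfolding sym[OF assms(1) comb_in[OF assms(2,3)]] sym[OF assms(1,2)] sym[OF assms(1,3)]
  by (rule comb_left[OF assms(2,3,1)])

lemma comb_self:
  assumes "u \<in> W" "w \<in> W"
  shows "B (comb c u w) (comb c u w) = B u u + 2 * c * B u w + c\<^sup>2 * B w w"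
  using assms by (simp add: comb_in comb_left comb_right sym[of w u] algebra_simps power2_eq_square)

lemma Cauchy_Schwarz:
  assumes "u \<in> W" "w \<in> W"
  shows "(B u w)\<^sup>2 \<le> B u u * B w w"
proof (rule semidefinite_discriminant)
  fix t
  show "0 \<le> B u u + 2 * t * B u w + t\<^sup>2 * B w w"
    using nonneg[OF comb_in[OF assms]] unfolding comb_self[OF assms] .
qed

end

text \<open>
  Induction on the spanning set. For a new vector \<open>s\<close>, the induction hypothesis, applied to the
  functional \<open>B s\<close>, yields the orthogonal projection \<open>p\<close> of \<open>s\<close> onto the old span; a multiple of
  \<open>s - p\<close> corrects the representative. If \<open>s - p\<close> is a null vector, the functional vanishes on it by
  assumption, and no correction is called for.
\<close>

lemma finite_span_riesz:
  fixes s :: "'i \<Rightarrow> 'a \<Rightarrow> real" and B :: "('a \<Rightarrow> real) \<Rightarrow> ('a \<Rightarrow> real) \<Rightarrow> real"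
  defines "V \<equiv> \<lambda>I. {\<lambda>x. \<Sum>i\<in>I. a i * s i x |a. True}"
  assumes "finite I"
    and B: "semi_inner_product W (\<lambda>c u w x. u x + c * w x) B"
    and W: "\<And>i. i \<in> I \<Longrightarrow> s i \<in> W" "(\<lambda>x. 0) \<in> W"
    and "\<And>u w c. u \<in> W \<Longrightarrow> w \<in> W \<Longrightarrow> l (\<lambda>x. u x + c * w x) = l u + c * l w"
    and "\<And>u. u \<in> V I \<Longrightarrow> B u u = 0 \<Longrightarrow> l u = 0"
  shows "\<exists>R\<in>V I. \<forall>u\<in>V I. B R u = l u"
proof -
  interpret semi_inner_product W "\<lambda>c u w x. u x + c * w x" B by (rule B)
  show ?thesis
    using assms(2) W(1) assms(6,7)
  proof (induction I arbitrary: l rule: finite_induct)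
    case empty
    have V: "V {} = {\<lambda>x. 0}" unfolding V_def by auto
    have "B (\<lambda>x. 0) (\<lambda>x. 0) = 0" using comb_left[OF W(2) W(2) W(2), of 1] by simp
    then show ?case using V empty(3) by auto
  next
    case (insert j I)
    have VI: "u \<in> V (insert j I) \<longleftrightarrow> (\<exists>w\<in>V I. \<exists>c. u = (\<lambda>x. w x + c * s j x))" for u
    proof
      assume "u \<in> V (insert j I)"
      then obtain a where "u = (\<lambda>x. \<Sum>i\<in>insert j I. a i * s i x)" unfolding V_def by auto
      then have "u = (\<lambda>x. (\<Sum>i\<in>I. a i * s i x) + a j * s j x)" using insert by (simp add: add.commute)
      moreover have "(\<lambda>x. \<Sum>i\<in>I. a i * s i x) \<in> V I" unfolding V_def by blast
      ultimately show "\<exists>w\<in>V I. \<exists>c. u = (\<lambda>x. w x + c * s j x)"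
        by (intro bexI[of _ "\<lambda>x. \<Sum>i\<in>I. a i * s i x"] exI[of _ "a j"])
    next
      assume "\<exists>w\<in>V I. \<exists>c. u = (\<lambda>x. w x + c * s j x)"
      then obtain a c where u: "u = (\<lambda>x. (\<Sum>i\<in>I. a i * s i x) + c * s j x)" unfolding V_def by auto
      have "(\<Sum>i\<in>I. (a(j := c)) i * s i x) = (\<Sum>i\<in>I. a i * s i x)" for x
        using insert by (intro sum.cong) auto
      then have "u = (\<lambda>x. \<Sum>i\<in>insert j I. (a(j := c)) i * s i x)"
        using insert unfolding u by (simp add: add.commute)
      then show "u \<in> V (insert j I)" unfolding V_def by blast
    qed
    have Vc: "(\<lambda>x. u x + c * w x) \<in> V I" if uw: "u \<in> V I" "w \<in> V I" for u w c
    proof -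
      obtain a where a: "u = (\<lambda>x. \<Sum>i\<in>I. a i * s i x)" using uw(1) unfolding V_def by auto
      obtain b where b: "w = (\<lambda>x. \<Sum>i\<in>I. b i * s i x)" using uw(2) unfolding V_def by auto
      have "(\<lambda>x. u x + c * w x) = (\<lambda>x. \<Sum>i\<in>I. (a i + c * b i) * s i x)"
        unfolding a b by (simp add: sum.distrib sum_distrib_left algebra_simps)
      then show ?thesis unfolding V_def by (intro CollectI exI[of _ "\<lambda>i. a i + c * b i"] conjI TrueI)
    qed
    have sW: "s i \<in> W" if "i \<in> insert j I" for i using insert.prems(1) that .
    have VI_I: "(\<lambda>x. w x + c * s j x) \<in> V (insert j I)" if "w \<in> V I" for w c
      by (rule VI[THEN iffD2], rule bexI[OF _ that], rule exI[of _ c], rule refl)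
    have sub: "V I \<subseteq> V (insert j I)"
    proof
      fix u assume "u \<in> V I"
      from VI_I[OF this, of 0] show "u \<in> V (insert j I)" by simp
    qed
    have VW: "u \<in> W" if u: "u \<in> V I" for u
    proof -
      obtain a where a: "u = (\<lambda>x. \<Sum>i\<in>I. a i * s i x)" using u unfolding V_def by auto
      have "(\<lambda>x. \<Sum>i\<in>J. a i * s i x) \<in> W" if "J \<subseteq> I" for J
        using finite_subset[OF that insert(1)] that
      proof (induction J rule: finite_induct)
        case empty then show ?case using W(2) by simp
      next
        case (insert i J)
        have si: "s i \<in> W" using insert.prems sW by blast
        have J: "(\<lambda>x. \<Sum>i\<in>J. a i * s i x) \<in> W" using insert.IH insert.prems by blast
        have "(\<lambda>x. (\<Sum>i\<in>J. a i * s i x) + a i * s i x) \<in> W"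
          by (rule comb_in[OF J si])
        then show ?case using insert.hyps by (simp add: add.commute)
      qed
      then show ?thesis using a by auto
    qed
    have sj: "s j \<in> W" using insert.prems(1) by simp
      have "\<exists>p\<in>V I. \<forall>u\<in>V I. B p u = B (s j) u"
    proof (rule insert.IH)
      show "\<And>i. i \<in> I \<Longrightarrow> s i \<in> W" using sW by blast
      show "B (s j) (\<lambda>x. u x + c * w x) = B (s j) u + c * B (s j) w" if "u \<in> W" "w \<in> W" for u w c
        by (rule comb_right[OF sj that])
      show "B (s j) u = 0" if "u \<in> V I" "B u u = 0" for u
        using Cauchy_Schwarz[OF sj VW[OF that(1)]] that(2) by simp
    qed
    then obtain p where p: "p \<in> V I" "\<And>u. u \<in> V I \<Longrightarrow> B p u = B (s j) u" by blast
    have "\<exists>R\<in>V I. \<forall>u\<in>V I. B R u = l u"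
    proof (rule insert.IH)
      show "\<And>i. i \<in> I \<Longrightarrow> s i \<in> W" using sW by blast
      show "l (\<lambda>x. u x + c * w x) = l u + c * l w" if "u \<in> W" "w \<in> W" for u w c
        by (rule insert.prems(2)[OF that])
      show "l u = 0" if "u \<in> V I" "B u u = 0" for u
        by (rule insert.prems(3)[OF subsetD[OF sub that(1)] that(2)])
    qed
    then obtain R where R: "R \<in> V I" "\<And>u. u \<in> V I \<Longrightarrow> B R u = l u" by blast
    \<comment> \<open>the component of the new vector orthogonal to the span of the old ones\<close>
    define e where "e = (\<lambda>x. s j x + (-1) * p x)"
    have eW: "e \<in> W" unfolding e_def by (rule comb_in[OF sj VW[OF p(1)]])
    have eV: "e \<in> V (insert j I)"
    proof -
      have "(\<lambda>x. p x + (-2) * p x) \<in> V I" by (rule Vc[OF p(1) p(1)])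
      moreover have "e = (\<lambda>x. (p x + (-2) * p x) + 1 * s j x)" unfolding e_def by auto
      ultimately show ?thesis by (simp only: VI_I)
    qed
    have eo: "B e u = 0" if "u \<in> V I" for u
      using comb_left[OF sj VW[OF p(1)] VW[OF that], of "-1"] p(2)[OF that] unfolding e_def by simp
    have le: "l e = l (s j) - l p" using insert.prems(2)[OF sj VW[OF p(1)], of "-1"] unfolding e_def by simp
    have sje: "B z (s j) = B z p + B z e" if "z \<in> W" for z
      using comb_right[OF that sj VW[OF p(1)], of "-1"] unfolding e_def by simp
    obtain k where k: "k * B e e = l e"
    proof (cases "B e e = 0")
      case True
      then show ?thesis using insert.prems(3)[OF eV] that[of 0] by simp
    next
      case False
      then show ?thesis using that[of "l e / B e e"] by simp
    qed
    define R' where "R' = (\<lambda>x. R x + k * e x)"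
    have R'W: "R' \<in> W" unfolding R'_def by (rule comb_in[OF VW[OF R(1)] eW])
    have R'V: "R' \<in> V (insert j I)"
    proof -
      have "(\<lambda>x. R x + (-k) * p x) \<in> V I" by (rule Vc[OF R(1) p(1)])
      moreover have "R' = (\<lambda>x. (R x + (-k) * p x) + k * s j x)" unfolding R'_def e_def by (auto simp: algebra_simps)
      ultimately show ?thesis by (simp only: VI_I)
    qed
    have R'I: "B R' u = l u" if "u \<in> V I" for u
      using comb_left[OF VW[OF R(1)] eW VW[OF that], of k] eo[OF that] R(2)[OF that] unfolding R'_def by simp
    have "B R' e = l e"
      using comb_left[OF VW[OF R(1)] eW eW, of k] eo[OF R(1)] sym[OF eW VW[OF R(1)]] k unfolding R'_def by simp
    then have R's: "B R' (s j) = l (s j)" using sje[OF R'W] R'I[OF p(1)] le by simp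
    have "B R' u = l u" if u: "u \<in> V (insert j I)" for u
    proof -
      obtain w c where w: "w \<in> V I" "u = (\<lambda>x. w x + c * s j x)" using VI[THEN iffD1, OF u] by auto
      show ?thesis
        using comb_right[OF R'W VW[OF w(1)] sj, of c] insert.prems(2)[OF VW[OF w(1)] sj, of c] R'I[OF w(1)] R's
        unfolding w(2) by simp
    qed
    then show ?case using R'V by (intro bexI[of _ R']) simp
  qed
qed

section \<open>Polynomials on the reference triangle\<close>

text \<open>
  The difference of order \<open>N\<close> annihilates polynomials of degree less than \<open>N\<close>. Absorbing a factor
  \<open>j\<close> into the binomial coefficient lowers both \<open>N\<close> and the exponent by one.
\<close>

lemma alternating_power_sum:
  "i < N \<Longrightarrow> (\<Sum>j\<le>N. (-1) ^ j * real (N choose j) * real j ^ i) = 0"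
proof (induction N arbitrary: i)
  case 0
  then show ?case by simp
next
  case (Suc N)
  show ?case
  proof (cases i)
    case 0
    then show ?thesis using choose_alternating_sum[of "Suc N", where ?'a = real] by simp
  next
    case (Suc l)
    have "(\<Sum>j\<le>Suc N. (-1) ^ j * real (Suc N choose j) * real j ^ i)
        = (\<Sum>j\<le>N. (-1) ^ Suc j * real (Suc N choose Suc j) * real (Suc j) ^ i)"
      by (subst sum.atMost_Suc_shift) (simp add: Suc)
    also have "\<dots> = (\<Sum>j\<le>N. - real (Suc N) * ((-1) ^ j * real (N choose j) * real (Suc j) ^ l))"
    proof (rule sum.cong[OF refl])
      fix j
      have rearrange: "c * x = n * b \<Longrightarrow> - 1 * e * c * (x * y) = - n * (e * b * y)" for c x n b e y :: real
        by algebra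
      have "real (Suc N choose Suc j) * real (Suc j) = real (Suc N) * real (N choose j)"
        using Suc_times_binomial_eq[of N j] by (metis of_nat_mult mult.commute)
      then show "(-1) ^ Suc j * real (Suc N choose Suc j) * real (Suc j) ^ i
          = - real (Suc N) * ((-1) ^ j * real (N choose j) * real (Suc j) ^ l)"
        unfolding Suc power_Suc by (intro rearrange)
    qed
    also have "\<dots> = - real (Suc N) * (\<Sum>j\<le>N. (-1) ^ j * real (N choose j) * real (Suc j) ^ l)"
      by (simp only: sum_distrib_left)
    also have "(\<Sum>j\<le>N. (-1) ^ j * real (N choose j) * real (Suc j) ^ l)
        = (\<Sum>j\<le>N. \<Sum>a\<le>l. real (l choose a) * ((-1) ^ j * real (N choose j) * real j ^ a))"
    proof (rule sum.cong[OF refl])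
      fix j
      have "real (Suc j) ^ l = (\<Sum>a\<le>l. real (l choose a) * real j ^ a)"
        using binomial_ring[of "real j" 1 l] by (simp add: add.commute)
      then show "(-1) ^ j * real (N choose j) * real (Suc j) ^ l
          = (\<Sum>a\<le>l. real (l choose a) * ((-1) ^ j * real (N choose j) * real j ^ a))"
        by (simp add: sum_distrib_left mult_ac)
    qed
    also have "\<dots> = (\<Sum>a\<le>l. real (l choose a) * (\<Sum>j\<le>N. (-1) ^ j * real (N choose j) * real j ^ a))"
      by (subst sum.swap) (simp only: sum_distrib_left)
    also have "\<dots> = 0"
      using Suc.IH Suc.prems Suc by (intro sum.neutral) auto
    finally show ?thesis by simp
  qed
qed

lemma poly_finite_difference:
  fixes p :: "real poly"
  assumes "degree p < N"
  shows "(\<Sum>j\<le>N. (-1) ^ j * real (N choose j) * poly p (real j * s)) = 0"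
proof -
  have "(\<Sum>j\<le>N. (-1) ^ j * real (N choose j) * poly p (real j * s))
      = (\<Sum>j\<le>N. \<Sum>i\<le>degree p. coeff p i * s ^ i * ((-1) ^ j * real (N choose j) * real j ^ i))"
    by (simp add: poly_altdef sum_distrib_left power_mult_distrib mult_ac)
  also have "\<dots> = (\<Sum>i\<le>degree p. coeff p i * s ^ i * (\<Sum>j\<le>N. (-1) ^ j * real (N choose j) * real j ^ i))"
    by (subst sum.swap) (simp only: sum_distrib_left)
  also have "\<dots> = 0"
    using assms by (intro sum.neutral) (auto simp: alternating_power_sum)
  finally show ?thesis .
qed

text \<open>
  The term \<open>j = 0\<close> of a vanishing difference of order \<open>m + 1\<close>, solved for and estimated by
  Cauchy-Schwarz.
\<close>

lemma poly_endpoint_bound: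
  fixes p :: "real poly"
  assumes "degree p \<le> m"
  shows "(poly p 0)\<^sup>2 \<le> (\<Sum>j=1..Suc m. (real (Suc m choose j))\<^sup>2) * 
           (\<Sum>j=1..Suc m. (poly p (real j / real (Suc m)))\<^sup>2)"
proof -
  let ?N = "Suc m"
  let ?u = "\<lambda>j. (-1) ^ j * real (?N choose j)" and ?w = "\<lambda>j. poly p (real j / real ?N)"
  have "0 = (\<Sum>j\<le>?N. ?u j * ?w j)"
    using poly_finite_difference[of p ?N "1 / real ?N"] assms by simp
  also have "\<dots> = (\<Sum>j\<in>insert 0 {1..?N}. ?u j * ?w j)"
    by (rule sum.cong) auto
  also have "\<dots> = poly p 0 + (\<Sum>j=1..?N. ?u j * ?w j)"
    by (subst sum.insert) auto
  finally have "poly p 0 = - (\<Sum>j=1..?N. ?u j * ?w j)" by linarith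
  then have "(poly p 0)\<^sup>2 = (\<Sum>j=1..?N. ?u j * ?w j)\<^sup>2" by (simp only: power2_minus)
  also have "\<dots> \<le> (\<Sum>j=1..?N. (?u j)\<^sup>2) * (\<Sum>j=1..?N. (?w j)\<^sup>2)"
    by (rule Cauchy_Schwarz_ineq_sum)
  also have "(\<Sum>j=1..?N. (?u j)\<^sup>2) = (\<Sum>j=1..?N. (real (?N choose j))\<^sup>2)"
    by (intro sum.cong refl) (simp add: power_mult_distrib power_mult[symmetric] power_even_eq)
  finally show ?thesis .
qed

lemma ref_poly_on_segment:
  assumes "ref_poly m q"
  obtains p :: "real poly" where "degree p \<le> m"
    "\<And>s. P + s *\<^sub>R (Q - P) \<in> ref_tri \<Longrightarrow> q (P + s *\<^sub>R (Q - P)) = poly p s"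
proof -
  obtain a where a: "\<And>x. x \<in> ref_tri \<Longrightarrow>
      q x = (\<Sum>i\<le>m. \<Sum>j\<le>m - i. a i j * (x $ 1) ^ i * (x $ 2) ^ j)"
    using assms unfolding ref_poly_def by blast
  define l where "l = (\<lambda>i::2. [:P $ i, Q $ i - P $ i:])"
  define p where "p = (\<Sum>i\<le>m. \<Sum>j\<le>m - i. smult (a i j) (l 1 ^ i * l 2 ^ j))"
  have dl: "degree (l i) \<le> 1" for i unfolding l_def by (simp add: degree_pCons_le)
  have "degree (l i ^ n) \<le> n" for i n
    using degree_power_le[of "l i" n] dl[of i] by (metis le_trans mult_1 mult_le_mono1)
  then have d: "degree (l 1 ^ i * l 2 ^ j) \<le> i + j" for i j
    by (intro order_trans[OF degree_mult_le] add_mono) auto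
  have "degree p \<le> m"
    unfolding p_def
  proof (intro degree_sum_le finite_atMost order_trans[OF degree_smult_le])
    fix i j assume "i \<in> {..m}" "j \<in> {..m - i}"
    then have "i + j \<le> m" by simp
    then show "degree (l 1 ^ i * l 2 ^ j) \<le> m" using d[of i j] by linarith
  qed
  moreover have "poly p s = q (P + s *\<^sub>R (Q - P))" if "P + s *\<^sub>R (Q - P) \<in> ref_tri" for s
    using a[OF that] unfolding p_def l_def by (simp add: poly_sum mult_ac)
  ultimately show ?thesis using that by metis
qed

lemma convex_ref_tri: "convex ref_tri"
proof (rule convexI)
  fix x y :: "real^2" and u v :: real
  assume *: "x \<in> ref_tri" "y \<in> ref_tri" "0 \<le> u" "0 \<le> v" "u + v = 1"
  have "u * x $ 1 + v * y $ 1 + (u * x $ 2 + v * y $ 2) = u * (x $ 1 + x $ 2) + v * (y $ 1 + y $ 2)"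
    by (simp add: algebra_simps)
  also have "\<dots> \<le> u * 1 + v * 1"
    using * by (intro add_mono mult_left_mono) (auto simp: ref_tri_def)
  finally show "u *\<^sub>R x + v *\<^sub>R y \<in> ref_tri"
    using * by (simp add: ref_tri_def)
qed

lemma compact_ref_tri: "compact ref_tri"
proof -
  have "ref_tri \<subseteq> cbox 0 1"
    by (auto simp: ref_tri_def mem_box_cart forall_2)
  then have "bounded ref_tri"
    using bounded_subset bounded_cbox by blast
  moreover have "closed ref_tri"
    unfolding ref_tri_def by (intro closed_Collect_conj closed_Collect_le continuous_intros)
  ultimately show ?thesis by (simp add: compact_eq_bounded_closed)
qed

lemma segment_in_ref_tri:
  "P \<in> ref_tri \<Longrightarrow> Q \<in> ref_tri \<Longrightarrow> 0 \<le> s \<Longrightarrow> s \<le> 1 \<Longrightarrow> P + s *\<^sub>R (Q - P) \<in> ref_tri"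
  using convexD_alt[OF convex_ref_tri, of P Q s] by (simp add: algebra_simps)

lemma ref_tri_measure: "0 < measure lborel ref_tri" "emeasure lborel ref_tri < \<infinity>" "ref_tri \<in> sets lborel"
proof -
  show fin: "emeasure lborel ref_tri < \<infinity>"
    using emeasure_compact_finite[OF compact_ref_tri] by simp
  show sets: "ref_tri \<in> sets lborel" using compact_ref_tri by (simp add: borel_compact)
  have "cbox 0 (\<chi> i::2. (1/2::real)) \<subseteq> ref_tri"
    by (auto simp: ref_tri_def mem_box_cart forall_2)
  then have "measure lborel (cbox 0 (\<chi> i::2. (1/2::real))) \<le> measure lborel ref_tri"
    using fin sets by (intro measure_mono_fmeasurable) (auto simp: fmeasurable_def)
  moreover have "measure lborel (cbox 0 (\<chi> i::2. (1/2::real))) > 0"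
    by (subst content_cbox_cart) (auto simp: interval_ne_empty_cart)
  ultimately show "0 < measure lborel ref_tri" by linarith
qed

lemma ref_poly_continuous:
  assumes "ref_poly m q" shows "continuous_on ref_tri q"
proof -
  obtain a where a: "\<And>x. x \<in> ref_tri \<Longrightarrow>
      q x = (\<Sum>i\<le>m. \<Sum>j\<le>m - i. a i j * (x $ 1) ^ i * (x $ 2) ^ j)"
    using assms unfolding ref_poly_def by blast
  show ?thesis
    by (subst continuous_on_cong[OF refl a], assumption) (intro continuous_intros)
qed

lemma set_integrable_ref_tri:
  fixes f :: "real^2 \<Rightarrow> real"
  assumes "continuous_on ref_tri f" shows "set_integrable lborel ref_tri f"
  using borel_integrable_compact[OF compact_ref_tri assms] by (simp add: set_integrable_def)

lemma lborel_integral_affine: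
  fixes f :: "'a::euclidean_space \<Rightarrow> real"
  assumes "integrable lborel f" "\<theta> \<noteq> 0"
  shows "integrable lborel (\<lambda>x. f (t + \<theta> *\<^sub>R x))"
    "(LINT x|lborel. f (t + \<theta> *\<^sub>R x)) = (LINT x|lborel. f x) / \<bar>\<theta>\<bar> ^ DIM('a)"
proof -
  have 1: "integrable (density (distr lborel borel (\<lambda>x. t + \<theta> *\<^sub>R x)) (\<lambda>_. ennreal (\<bar>\<theta>\<bar> ^ DIM('a)))) f"
    using assms lborel_affine[of \<theta> t] by simp
  have "integrable (distr lborel borel (\<lambda>x. t + \<theta> *\<^sub>R x)) (\<lambda>x. \<bar>\<theta>\<bar> ^ DIM('a) * f x)"
    using 1 assms by (subst (asm) integrable_density) auto
  then have "integrable (distr lborel borel (\<lambda>x. t + \<theta> *\<^sub>R x)) f"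
    using assms(2) by (simp add: integrable_mult_left_iff)
  then show "integrable lborel (\<lambda>x. f (t + \<theta> *\<^sub>R x))"
    using assms by (subst (asm) integrable_distr_eq) auto
  have "(LINT x|lborel. f x) = \<bar>\<theta>\<bar> ^ DIM('a) * (LINT x|lborel. f (t + \<theta> *\<^sub>R x))"
    using assms by (subst lborel_affine[of \<theta> t]) (auto simp: integral_density integral_distr)
  then show "(LINT x|lborel. f (t + \<theta> *\<^sub>R x)) = (LINT x|lborel. f x) / \<bar>\<theta>\<bar> ^ DIM('a)"
    using assms by simp
qed

text \<open>
  The points \<open>P + (j/N)(Q - P)\<close> stay in the triangle by convexity, and for fixed \<open>j\<close> the map that
  takes \<open>Q\<close> to such a point scales areas by \<open>(j/N)\<^sup>2\<close>. Hence the pointwise bound for all \<open>Q\<close>,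
  integrated over \<open>Q\<close>, is a bound by the integral of \<open>q\<^sup>2\<close> with a constant depending only on \<open>m\<close>.
\<close>

lemma ref_poly_sup_bound:
  "\<exists>K>0. \<forall>q. ref_poly m q \<longrightarrow>
     (\<forall>P\<in>ref_tri. (q P)\<^sup>2 \<le> K * (LINT x:ref_tri|lborel. (q x)\<^sup>2))"
proof -
  let ?N = "Suc m" and ?A = "measure lborel ref_tri"
  define B where "B = (\<Sum>j=1..Suc m. (real (Suc m choose j))\<^sup>2)"
  define S where "S = (\<Sum>j=1..Suc m. (1 / (real j / real ?N)\<^sup>2))"
  have B: "B > 0" unfolding B_def by (intro sum_pos) (auto intro!: zero_less_power simp: )
  have S: "S > 0" unfolding S_def by (intro sum_pos) auto
  show ?thesis
  proof (intro exI[of _ "B * S / ?A"] conjI allI impI ballI)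
    show "0 < B * S / ?A" using B S ref_tri_measure by simp
    fix q P assume q: "ref_poly m q" and P: "P \<in> ref_tri"
    define f where "f = (\<lambda>x. indicator ref_tri x * (q x)\<^sup>2)"
    have f: "integrable lborel f" 
      using set_integrable_ref_tri[of "\<lambda>x. (q x)\<^sup>2"] ref_poly_continuous[OF q]
      unfolding f_def set_integrable_def by (auto intro: continuous_intros)
    let ?th = "\<lambda>j. real j / real ?N"
    let ?g = "\<lambda>j x. f ((1 - ?th j) *\<^sub>R P + ?th j *\<^sub>R x)"
    have g: "integrable lborel (?g j)" "(LINT x|lborel. ?g j x) = (LINT x|lborel. f x) * (1 / (?th j)\<^sup>2)"
      if "j \<in> {1..?N}" for j
      using lborel_integral_affine[OF f, of "?th j" "(1 - ?th j) *\<^sub>R P"] that by auto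
    have pw: "indicator ref_tri Q * (q P)\<^sup>2 \<le> B * (\<Sum>j=1..?N. ?g j Q)" for Q
    proof (cases "Q \<in> ref_tri")
      case True
      obtain p where p: "degree p \<le> m"
        "\<And>s. P + s *\<^sub>R (Q - P) \<in> ref_tri \<Longrightarrow> q (P + s *\<^sub>R (Q - P)) = poly p s"
        using ref_poly_on_segment[OF q] by blast
      have "(q P)\<^sup>2 \<le> B * (\<Sum>j=1..?N. (poly p (?th j))\<^sup>2)"
        using poly_endpoint_bound[OF p(1)] p(2)[of 0] P unfolding B_def by simp
      also have "(\<Sum>j=1..?N. (poly p (?th j))\<^sup>2) = (\<Sum>j=1..?N. ?g j Q)"
      proof (rule sum.cong[OF refl])
        fix j assume "j \<in> {1..?N}"
        then have th: "0 \<le> ?th j" "?th j \<le> 1" by auto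
        have e: "P + ?th j *\<^sub>R (Q - P) = (1 - ?th j) *\<^sub>R P + ?th j *\<^sub>R Q" by (simp add: algebra_simps)
        show "(poly p (?th j))\<^sup>2 = ?g j Q"
          using p(2)[OF segment_in_ref_tri[OF P True th]] segment_in_ref_tri[OF P True th]
          unfolding e f_def by simp
      qed
      finally show ?thesis using True by simp
    next
      case False
      then show ?thesis using B by (auto intro!: mult_nonneg_nonneg sum_nonneg simp: f_def)
    qed
    have "?A * (q P)\<^sup>2 = (LINT Q|lborel. indicator ref_tri Q * (q P)\<^sup>2)"
      using ref_tri_measure by simp
    also have "\<dots> \<le> (LINT Q|lborel. B * (\<Sum>j=1..?N. ?g j Q))"
    proof (rule integral_mono)
      show "integrable lborel (\<lambda>Q. indicator ref_tri Q * (q P)\<^sup>2)"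
        using ref_tri_measure by simp
      show "integrable lborel (\<lambda>Q. B * (\<Sum>j=1..?N. ?g j Q))"
        by (intro integrable_mult_right Bochner_Integration.integrable_sum g)
    qed (rule pw)
    also have "\<dots> = B * (\<Sum>j=1..?N. LINT Q|lborel. ?g j Q)"
      by (subst integral_mult_right_zero, subst Bochner_Integration.integral_sum) (use g in auto)
    also have "(\<Sum>j=1..?N. LINT Q|lborel. ?g j Q) = S * (LINT x|lborel. f x)"
      unfolding S_def sum_distrib_right by (intro sum.cong refl) (use g in auto)
    also have "(LINT x|lborel. f x) = (LINT x:ref_tri|lborel. (q x)\<^sup>2)"
      by (simp add: f_def set_lebesgue_integral_def)
    finally show "(q P)\<^sup>2 \<le> B * S / ?A * (LINT x:ref_tri|lborel. (q x)\<^sup>2)"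
      using ref_tri_measure by (simp add: field_simps)
  qed
qed

text \<open>
  The restrictions of polynomials to the triangle in the form required by \<open>finite_span_riesz\<close>.
\<close>

lemma ref_poly_span:
  "ref_poly m f \<longleftrightarrow> (\<exists>u\<in>{\<lambda>x. \<Sum>i\<in>(SIGMA i:{..m}. {..m - i}). a i * (\<lambda>(i, j) x. (x $ 1) ^ i * (x $ 2) ^ j) i x |a. True}.
     \<forall>x\<in>ref_tri. f x = u x)" (is "_ \<longleftrightarrow> (\<exists>u\<in>?V. _)")
proof -
  have sig: "(\<Sum>p\<in>(SIGMA i:{..m}. {..m - i}). a p * (\<lambda>(i, j) x. (x $ 1) ^ i * (x $ 2) ^ j) p x)
      = (\<Sum>i\<le>m. \<Sum>j\<le>m - i. a (i, j) * (x $ 1) ^ i * (x $ 2) ^ j)"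
    for a :: "nat \<times> nat \<Rightarrow> real" and x :: "real^2"
    by (subst sum.Sigma) (auto intro!: sum.cong simp: mult.assoc)
  show ?thesis
  proof
    assume "ref_poly m f"
    then obtain a where a: "\<And>x. x \<in> ref_tri \<Longrightarrow>
        f x = (\<Sum>i\<le>m. \<Sum>j\<le>m - i. a i j * (x $ 1) ^ i * (x $ 2) ^ j)"
      unfolding ref_poly_def by blast
    let ?a = "\<lambda>(i, j). a i j"
    show "\<exists>u\<in>?V. \<forall>x\<in>ref_tri. f x = u x"
    proof (rule bexI)
      show "\<forall>x\<in>ref_tri. f x =
          (\<Sum>p\<in>(SIGMA i:{..m}. {..m - i}). ?a p * (\<lambda>(i, j) x. (x $ 1) ^ i * (x $ 2) ^ j) p x)"
        unfolding sig using a by simp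
    qed (rule CollectI, rule exI[of _ ?a], simp)
  next
    assume "\<exists>u\<in>?V. \<forall>x\<in>ref_tri. f x = u x"
    then obtain a where "\<forall>x\<in>ref_tri. f x =
        (\<Sum>p\<in>(SIGMA i:{..m}. {..m - i}). a p * (\<lambda>(i, j) x. (x $ 1) ^ i * (x $ 2) ^ j) p x)"
      by auto
    then show "ref_poly m f" unfolding sig ref_poly_def by (intro exI[of _ "\<lambda>i j. a (i, j)"])
  qed
qed

section \<open>Derivatives within the reference triangle\<close>

lemma ref_vertices_in_ref_tri: "0 \<in> ref_tri" "axis 1 1 \<in> ref_tri" "axis 2 1 \<in> ref_tri"
  by (simp_all add: ref_tri_def axis_def)

text \<open>
  At a vertex the triangle contains no segment in some coordinate directions, so the directions
  used are those from \<open>x\<close> to the three vertices; differences of these span the plane.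
\<close>

lemma ref_tri_derivative_unique:
  fixes f :: "real^2 \<Rightarrow> 'b::real_normed_vector"
  assumes x: "x \<in> ref_tri"
    and f': "(f has_derivative f') (at x within ref_tri)"
    and f'': "(f has_derivative f'') (at x within ref_tri)"
  shows "f' = f''"
proof -
  interpret f': linear f' using f' by (rule has_derivative_linear)
  interpret f'': linear f'' using f'' by (rule has_derivative_linear)
  have toward: "g' (Q - x) = vector_derivative (\<lambda>s. f (x + s *\<^sub>R (Q - x))) (at 0 within {0..1})"
    if g': "(f has_derivative g') (at x within ref_tri)" and Q: "Q \<in> ref_tri" for g' Q
  proof -
    have im: "(\<lambda>s. x + s *\<^sub>R (Q - x)) ` {0..1} \<subseteq> ref_tri"
      using segment_in_ref_tri[OF x Q] by auto
    have "((\<lambda>s. x + s *\<^sub>R (Q - x)) has_derivative (\<lambda>s. s *\<^sub>R (Q - x))) (at 0 within {0..1})"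
      by (auto intro!: derivative_eq_intros)
    then have "((\<lambda>s. f (x + s *\<^sub>R (Q - x))) has_derivative (\<lambda>s. g' (s *\<^sub>R (Q - x)))) (at 0 within {0..1})"
      by (rule has_derivative_in_compose[of _ _ "0::real", where g = f and g' = g'])
         (use has_derivative_subset[OF g' im] in simp)
    then have "((\<lambda>s. f (x + s *\<^sub>R (Q - x))) has_vector_derivative g' (Q - x)) (at 0 within {0..1})"
      unfolding has_vector_derivative_def
      by (simp add: linear_cmul[OF has_derivative_linear[OF g']])
    then show ?thesis
      using vector_derivative_within_cbox[of 0 1 0 "\<lambda>s. f (x + s *\<^sub>R (Q - x))"] by simp
  qed
  have eq: "f' (Q - x) = f'' (Q - x)" if "Q \<in> ref_tri" for Q
    using toward[OF f' that] toward[OF f'' that] by simp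
  have ax: "f' (axis i 1) = f'' (axis i 1)" for i :: 2
  proof -
    have "axis i 1 \<in> ref_tri" using ref_vertices_in_ref_tri exhaust_2[of i] by auto
    moreover have "axis i 1 = (axis i 1 - x) - (0 - x)" by simp
    ultimately show ?thesis
      using eq[of "axis i 1"] eq[of 0] ref_vertices_in_ref_tri(1) f'.diff f''.diff by metis
  qed
  show ?thesis
  proof
    fix v :: "real^2"
    have v: "v = v $ 1 *\<^sub>R axis 1 1 + v $ 2 *\<^sub>R axis 2 1"
      by (simp add: vec_eq_iff forall_2 axis_def)
    show "f' v = f'' v"
      by (subst (1 2) v) (simp only: f'.add f''.add f'.scale f''.scale ax)
  qed
qed

lemma ref_D_eq:
  assumes "x \<in> ref_tri" "(F has_derivative A) (at x within ref_tri)"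
  shows "ref_D F x = A"
proof
  have "(F has_derivative frechet_derivative F (at x within ref_tri)) (at x within ref_tri)"
    using assms(2) frechet_derivative_works differentiableI by blast
  then show "ref_D F x \<xi> = A \<xi>" for \<xi>
    using ref_tri_derivative_unique[OF assms(1) _ assms(2)] unfolding ref_D_def by metis
qed

text \<open>
  Rational functions without poles on the closed reference triangle. The inductive form makes
  closure under partial derivatives an induction over the rules of differentiation; the last rule
  lets the values off the triangle be arbitrary.
\<close>

inductive regular :: "(real^2 \<Rightarrow> real) \<Rightarrow> bool" where
  const: "regular (\<lambda>x. a)"
| coord: "regular (\<lambda>x. x $ i)"
| add: "regular f \<Longrightarrow> regular g \<Longrightarrow> regular (\<lambda>x. f x + g x)"
| mult: "regular f \<Longrightarrow> regular g \<Longrightarrow> regular (\<lambda>x. f x * g x)"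
| inverse: "regular f \<Longrightarrow> (\<And>x. x \<in> ref_tri \<Longrightarrow> f x \<noteq> 0) \<Longrightarrow> regular (\<lambda>x. inverse (f x))"
| cong: "regular f \<Longrightarrow> (\<And>x. x \<in> ref_tri \<Longrightarrow> g x = f x) \<Longrightarrow> regular g"

lemma regular_sum: "(\<And>i. i \<in> I \<Longrightarrow> regular (f i)) \<Longrightarrow> regular (\<lambda>x. \<Sum>i\<in>I. f i x)"
  by (induction I rule: infinite_finite_induct) (auto intro: regular.intros(1-4))

lemma regular_power: "regular f \<Longrightarrow> regular (\<lambda>x. f x ^ n)"
  by (induction n) (auto intro: regular.intros(1-4))

lemma regular_diff: "regular f \<Longrightarrow> regular g \<Longrightarrow> regular (\<lambda>x. f x - g x)"
  using regular.add[OF _ regular.mult[OF regular.const[of "-1"]], of f g] by simp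

lemma regular_ref_poly: 
  assumes "ref_poly m f" shows "regular f"
proof -
  obtain a where a: "\<And>x. x \<in> ref_tri \<Longrightarrow>
      f x = (\<Sum>i\<le>m. \<Sum>j\<le>m - i. a i j * (x $ 1) ^ i * (x $ 2) ^ j)"
    using assms unfolding ref_poly_def by blast
  have "regular (\<lambda>x. \<Sum>i\<le>m. \<Sum>j\<le>m - i. a i j * (x $ 1) ^ i * (x $ 2) ^ j)"
    by (intro regular_sum regular.mult regular_power regular.const regular.coord)
  then show ?thesis using a by (rule regular.cong)
qed

lemma regular_has_derivative:
  assumes "regular f"
  obtains f1 f2 where "regular f1" "regular f2"
    "\<And>x. x \<in> ref_tri \<Longrightarrow>
      (f has_derivative (\<lambda>\<xi>. \<xi> $ 1 * f1 x + \<xi> $ 2 * f2 x)) (at x within ref_tri)"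
proof -
  have "\<exists>f1 f2. regular f1 \<and> regular f2 \<and> (\<forall>x\<in>ref_tri.
      (f has_derivative (\<lambda>\<xi>. \<xi> $ 1 * f1 x + \<xi> $ 2 * f2 x)) (at x within ref_tri))"
    using assms
  proof induction
    case (const a)
    show ?case
      by (rule exI[of _ "\<lambda>x. 0"], rule exI[of _ "\<lambda>x. 0"]) (auto intro: regular.const)
  next
    case (coord i)
    have lin: "((\<lambda>x. x $ i) has_derivative (\<lambda>\<xi>. \<xi> $ i)) (at x within S)" for x S
      by (rule bounded_linear_imp_has_derivative[OF bounded_linear_vec_nth])
    have "i = 1 \<or> i = 2" by (rule exhaust_2)
    then show ?case
      by - (rule exI[of _ "\<lambda>x. if i = 1 then 1 else 0"], rule exI[of _ "\<lambda>x. if i = 2 then 1 else 0"],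
         use lin in \<open>auto intro: regular.const\<close>)
  next
    case (add f g)
    then obtain f1 f2 g1 g2 where reg: "regular f1" "regular f2" "regular g1" "regular g2"
      and f: "\<forall>x\<in>ref_tri. (f has_derivative (\<lambda>\<xi>. \<xi> $ 1 * f1 x + \<xi> $ 2 * f2 x)) (at x within ref_tri)"
      and g: "\<forall>x\<in>ref_tri. (g has_derivative (\<lambda>\<xi>. \<xi> $ 1 * g1 x + \<xi> $ 2 * g2 x)) (at x within ref_tri)"
      by blast
    show ?case
    proof (rule exI[of _ "\<lambda>x. f1 x + g1 x"], rule exI[of _ "\<lambda>x. f2 x + g2 x"], intro conjI ballI)
      fix x assume "x \<in> ref_tri"
      from has_derivative_add[OF bspec[OF f this] bspec[OF g this]]
      show "((\<lambda>x. f x + g x) has_derivative (\<lambda>\<xi>. \<xi> $ 1 * (f1 x + g1 x) + \<xi> $ 2 * (f2 x + g2 x))) (at x within ref_tri)"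
        by (simp add: algebra_simps)
    qed (intro reg regular.add)+
  next
    case (mult f g)
    then obtain f1 f2 g1 g2 where reg: "regular f1" "regular f2" "regular g1" "regular g2"
      and f: "\<forall>x\<in>ref_tri. (f has_derivative (\<lambda>\<xi>. \<xi> $ 1 * f1 x + \<xi> $ 2 * f2 x)) (at x within ref_tri)"
      and g: "\<forall>x\<in>ref_tri. (g has_derivative (\<lambda>\<xi>. \<xi> $ 1 * g1 x + \<xi> $ 2 * g2 x)) (at x within ref_tri)"
      by blast
    show ?case
    proof (rule exI[of _ "\<lambda>x. f x * g1 x + f1 x * g x"], rule exI[of _ "\<lambda>x. f x * g2 x + f2 x * g x"], intro conjI ballI)
      fix x assume "x \<in> ref_tri"
      from has_derivative_mult[OF bspec[OF f this] bspec[OF g this]]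
      show "((\<lambda>x. f x * g x) has_derivative (\<lambda>\<xi>. \<xi> $ 1 * (f x * g1 x + f1 x * g x) + \<xi> $ 2 * (f x * g2 x + f2 x * g x))) (at x within ref_tri)"
        by (simp add: algebra_simps)
    qed (intro reg mult.hyps regular.add regular.mult)+
  next
    case (inverse f)
    then obtain f1 f2 where reg: "regular f1" "regular f2"
      and f: "\<forall>x\<in>ref_tri. (f has_derivative (\<lambda>\<xi>. \<xi> $ 1 * f1 x + \<xi> $ 2 * f2 x)) (at x within ref_tri)"
      by blast
    let ?g = "\<lambda>x. (- 1) * (inverse (f x) * inverse (f x))"
    show ?case
    proof (rule exI[of _ "\<lambda>x. ?g x * f1 x"], rule exI[of _ "\<lambda>x. ?g x * f2 x"], intro conjI ballI)
      fix x assume x: "x \<in> ref_tri"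
      from Deriv.has_derivative_inverse[OF inverse.hyps(2)[OF x] bspec[OF f x]]
      show "((\<lambda>x. inverse (f x)) has_derivative (\<lambda>\<xi>. \<xi> $ 1 * (?g x * f1 x) + \<xi> $ 2 * (?g x * f2 x))) (at x within ref_tri)"
        by (simp add: algebra_simps)
    qed (intro reg inverse.hyps regular.inverse regular.const regular.mult; assumption)+
  next
    case (cong f g)
    then obtain f1 f2 where reg: "regular f1" "regular f2"
      and f: "\<forall>x\<in>ref_tri. (f has_derivative (\<lambda>\<xi>. \<xi> $ 1 * f1 x + \<xi> $ 2 * f2 x)) (at x within ref_tri)"
      by blast
    have "\<forall>x\<in>ref_tri. (g has_derivative (\<lambda>\<xi>. \<xi> $ 1 * f1 x + \<xi> $ 2 * f2 x)) (at x within ref_tri)"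
      using f cong.hyps(2) by (auto intro: has_derivative_transform)
    then show ?case using reg by blast
  qed
  then show ?thesis using that by blast
qed

lemma regular_continuous:
  assumes "regular f" shows "continuous_on ref_tri f"
proof -
  obtain f1 f2 where "\<And>x. x \<in> ref_tri \<Longrightarrow>
      (f has_derivative (\<lambda>\<xi>. \<xi> $ 1 * f1 x + \<xi> $ 2 * f2 x)) (at x within ref_tri)"
    using regular_has_derivative[OF assms] by blast
  then show ?thesis by (intro has_derivative_continuous_on) auto
qed

section \<open>Tangential gradients on a parametrized patch\<close>

lemma proj_mult: "proj \<nu> *v D = D - (\<nu> \<bullet> D) *\<^sub>R \<nu>"
proof -
  have "((\<chi> i j. \<nu> $ i * \<nu> $ j) *v D) = (\<nu> \<bullet> D) *\<^sub>R \<nu>"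
    by (simp add: vec_eq_iff matrix_vector_mult_def inner_vec_def sum_3 algebra_simps)
  then show ?thesis by (simp add: proj_def matrix_vector_mult_diff_rdistrib)
qed

text \<open>
  The vectors \<open>b \<times> \<nu>\<close>, \<open>\<nu> \<times> a\<close> and \<open>\<nu>\<close>, divided by \<open>|\<nu>|\<^sup>2\<close>, form the basis dual
  to \<open>a\<close>, \<open>b\<close>, \<open>\<nu>\<close>.
\<close>

lemma dual_basis_expansion:
  fixes a b w :: "real^3"
  defines "\<nu> \<equiv> cross3 a b"
  shows "(\<nu> \<bullet> \<nu>) *\<^sub>R w = (w \<bullet> \<nu>) *\<^sub>R \<nu> + (w \<bullet> a) *\<^sub>R cross3 b \<nu> + (w \<bullet> b) *\<^sub>R cross3 \<nu> a"
  unfolding \<nu>_def vec_eq_iff forall_3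
  by (intro conjI) (simp_all only: vector_add_component vector_scaleR_component cross_components
      inner_vec_def sum_3 inner_real_def real_scaleR_def, simp_all add: algebra_simps)

text \<open>
  The vector in the plane of \<open>a\<close> and \<open>b\<close> whose inner products with \<open>a\<close> and \<open>b\<close> are \<open>\<alpha>\<close> and \<open>\<beta>\<close>. A
  tangential gradient is of this form, \<open>\<alpha>\<close> and \<open>\<beta>\<close> being the partial derivatives in the
  parameters.
\<close>

definition dual_vec :: "real^3 \<Rightarrow> real^3 \<Rightarrow> real \<Rightarrow> real \<Rightarrow> real^3" where
  "dual_vec a b \<alpha> \<beta> = (let \<nu> = cross3 a b in
     inverse (\<nu> \<bullet> \<nu>) *\<^sub>R (\<alpha> *\<^sub>R cross3 b \<nu> + \<beta> *\<^sub>R cross3 \<nu> a))"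

lemma dual_vec_unique:
  assumes "cross3 a b \<noteq> 0"
  shows "proj (sgn (cross3 a b)) *v w = dual_vec a b (w \<bullet> a) (w \<bullet> b)"
proof -
  let ?\<nu> = "cross3 a b"
  have pos: "?\<nu> \<bullet> ?\<nu> \<noteq> 0" using assms by simp
  have sgn: "(sgn ?\<nu> \<bullet> w) *\<^sub>R sgn ?\<nu> = inverse (?\<nu> \<bullet> ?\<nu>) *\<^sub>R ((w \<bullet> ?\<nu>) *\<^sub>R ?\<nu>)"
    by (simp add: sgn_div_norm dot_square_norm power2_eq_square inner_commute mult_ac)
  have "w = inverse (?\<nu> \<bullet> ?\<nu>) *\<^sub>R ((?\<nu> \<bullet> ?\<nu>) *\<^sub>R w)" using pos by simp
  also have "\<dots> = inverse (?\<nu> \<bullet> ?\<nu>) *\<^sub>R ((w \<bullet> ?\<nu>) *\<^sub>R ?\<nu>) + dual_vec a b (w \<bullet> a) (w \<bullet> b)"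
    unfolding dual_basis_expansion[of a b w] dual_vec_def Let_def by (simp add: scaleR_add_right add.assoc)
  finally have "w = (sgn ?\<nu> \<bullet> w) *\<^sub>R sgn ?\<nu> + dual_vec a b (w \<bullet> a) (w \<bullet> b)" unfolding sgn .
  then have "w - (sgn ?\<nu> \<bullet> w) *\<^sub>R sgn ?\<nu> = dual_vec a b (w \<bullet> a) (w \<bullet> b)"
    by (simp only: diff_eq_eq add.commute)
  then show ?thesis unfolding proj_mult .
qed

lemma dual_vec_inner:
  assumes "cross3 a b \<noteq> 0"
  shows "dual_vec a b \<alpha> \<beta> \<bullet> a = \<alpha>" "dual_vec a b \<alpha> \<beta> \<bullet> b = \<beta>"
proof -
  let ?\<nu> = "cross3 a b"
  have pos: "?\<nu> \<bullet> ?\<nu> \<noteq> 0" using assms by simp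
  have "cross3 b ?\<nu> \<bullet> a = ?\<nu> \<bullet> ?\<nu>" "cross3 ?\<nu> a \<bullet> b = ?\<nu> \<bullet> ?\<nu>"
    "cross3 b ?\<nu> \<bullet> b = 0" "cross3 ?\<nu> a \<bullet> a = 0"
    by (simp_all add: inner_vec_def sum_3 cross_components algebra_simps)
  then show "dual_vec a b \<alpha> \<beta> \<bullet> a = \<alpha>" "dual_vec a b \<alpha> \<beta> \<bullet> b = \<beta>"
    using pos by (simp_all add: dual_vec_def Let_def inner_add_left)
qed

text \<open>
  Uniqueness: by the chain rule the gradient of any differentiable extension has prescribed inner
  products with the two tangent vectors, hence a determined tangential part. Existence: the
  function that equals \<open>f\<close> on the patch and is affine with gradient \<open>G\<close> off it is differentiable at
  the point, because \<open>F\<close> does not contract distances to the point by more than the factor \<open>m\<close>. This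
  extension is differentiable at the one point only, which makes the argument the same in the
  interior and on the boundary.
\<close>

lemma tan_grad_parametrized:
  fixes F :: "real^2 \<Rightarrow> real^3" and f :: "real^3 \<Rightarrow> real"
  assumes x: "x \<in> ref_tri"
    and F: "(F has_derivative A) (at x within ref_tri)"
    and m: "m > 0" and lower: "\<And>y. y \<in> ref_tri \<Longrightarrow> m * norm (y - x) \<le> norm (F y - F x)"
    and \<nu>: "cross3 (A (axis 1 1)) (A (axis 2 1)) \<noteq> 0"
    and N: "N (F x) = sgn (cross3 (A (axis 1 1)) (A (axis 2 1)))"
    and fF: "((f \<circ> F) has_derivative g) (at x within ref_tri)"
  shows "tan_grad (F ` ref_tri) N f (F x) =
    dual_vec (A (axis 1 1)) (A (axis 2 1)) (g (axis 1 1)) (g (axis 2 1))"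
proof -
  define G where "G = dual_vec (A (axis 1 1)) (A (axis 2 1)) (g (axis 1 1)) (g (axis 2 1))"
  interpret A: linear A using F by (rule has_derivative_linear)
  interpret g: linear g using fF by (rule has_derivative_linear)
  have Gg: "G \<bullet> A \<xi> = g \<xi>" for \<xi>
  proof -
    have v: "\<xi> = \<xi> $ 1 *\<^sub>R axis 1 1 + \<xi> $ 2 *\<^sub>R axis 2 1"
      by (simp add: vec_eq_iff forall_2 axis_def)
    show ?thesis unfolding G_def
      by (subst (1 2) v) (simp only: A.add A.scale g.add g.scale inner_add_right inner_scaleR_right
          dual_vec_inner[OF \<nu>] real_scaleR_def)
  qed
  have projG: "proj (N (F x)) *v G = G"
    unfolding N G_def dual_vec_unique[OF \<nu>] dual_vec_inner[OF \<nu>] ..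
  have unique: "proj (N (F x)) *v D = G"
    if "\<forall>y\<in>F ` ref_tri. ft y = f y" and D: "GDERIV ft (F x) :> D" for ft D
  proof -
    have "((\<lambda>y. ft (F y)) has_derivative (\<lambda>\<xi>. D \<bullet> A \<xi>)) (at x within ref_tri)"
      using has_derivative_compose[OF F D[unfolded gderiv_def]] by (simp add: inner_commute)
    then have "((f \<circ> F) has_derivative (\<lambda>\<xi>. D \<bullet> A \<xi>)) (at x within ref_tri)"
      by (rule has_derivative_transform[OF x, rotated]) (use that(1) in auto)
    then have "(\<lambda>\<xi>. D \<bullet> A \<xi>) = g"
      by (rule ref_tri_derivative_unique[OF x _ fF])
    then have "D \<bullet> A \<xi> = g \<xi>" for \<xi> by (rule fun_cong)
    then show ?thesis unfolding N G_def dual_vec_unique[OF \<nu>] by simp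
  qed
  define ft where "ft = (\<lambda>y. if y \<in> F ` ref_tri then f y else f (F x) + G \<bullet> (y - F x))"
  have GD: "GDERIV ft (F x) :> G"
    unfolding gderiv_def has_derivative_at_alt
  proof (intro conjI allI impI)
    show "bounded_linear (\<lambda>h. h \<bullet> G)" by (rule bounded_linear_inner_left)
    fix e :: real assume e: "e > 0"
    have "((\<lambda>y. (f \<circ> F) y - F y \<bullet> G) has_derivative (\<lambda>\<xi>. g \<xi> - A \<xi> \<bullet> G)) (at x within ref_tri)"
      by (intro has_derivative_diff fF has_derivative_inner_left F)
    then have "((\<lambda>y. (f \<circ> F) y - F y \<bullet> G) has_derivative (\<lambda>\<xi>. 0)) (at x within ref_tri)"
      by (simp add: Gg[symmetric] inner_commute)
    then have "\<forall>e>0. \<exists>\<delta>>0. \<forall>y\<in>ref_tri. norm (y - x) < \<delta> \<longrightarrow>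
        norm ((f \<circ> F) y - F y \<bullet> G - ((f \<circ> F) x - F x \<bullet> G) - 0) \<le> e * norm (y - x)"
      unfolding has_derivative_within_alt by (rule conjunct2)
    from this[rule_format, of "e * m"] obtain \<delta> where \<delta>: "\<delta> > 0"
      "\<And>y. y \<in> ref_tri \<Longrightarrow> norm (y - x) < \<delta> \<Longrightarrow>
        norm (f (F y) - F y \<bullet> G - (f (F x) - F x \<bullet> G)) \<le> e * m * norm (y - x)"
      using e m by auto
    show "\<exists>d>0. \<forall>z. norm (z - F x) < d \<longrightarrow>
        norm (ft z - ft (F x) - (z - F x) \<bullet> G) \<le> e * norm (z - F x)"
    proof (intro exI[of _ "m * \<delta>"] conjI allI impI)
      show "0 < m * \<delta>" using m \<delta> by simp
      fix z assume z: "norm (z - F x) < m * \<delta>"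
      show "norm (ft z - ft (F x) - (z - F x) \<bullet> G) \<le> e * norm (z - F x)"
      proof (cases "z \<in> F ` ref_tri")
        case True
        then obtain y where y: "y \<in> ref_tri" "z = F y" by blast
        have l: "m * norm (y - x) \<le> norm (z - F x)" using lower[OF y(1)] y(2) by simp
        then have "m * norm (y - x) < m * \<delta>" using z by linarith
        then have "norm (y - x) < \<delta>" using m by simp
        from \<delta>(2)[OF y(1) this] have "norm (ft z - ft (F x) - (z - F x) \<bullet> G) \<le> e * (m * norm (y - x))"
          using x y by (simp add: ft_def inner_diff_left algebra_simps)
        also have "\<dots> \<le> e * norm (z - F x)" using l e by simp
        finally show ?thesis .
      next
        case False
        then show ?thesis using x e by (simp add: ft_def inner_commute)
      qed
    qed
  qed
  show ?thesis
    unfolding tan_grad_def G_def[symmetric]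
  proof (rule the_equality)
    show "\<exists>ft D. (\<forall>y\<in>F ` ref_tri. ft y = f y) \<and> GDERIV ft (F x) :> D \<and> G = proj (N (F x)) *v D"
      using GD projG by (intro exI[of _ ft] exI[of _ G]) (auto simp: ft_def)
  next
    fix G'
    assume "\<exists>ft D. (\<forall>y\<in>F ` ref_tri. ft y = f y) \<and> GDERIV ft (F x) :> D \<and> G' = proj (N (F x)) *v D"
    then show "G' = G" by (elim exE conjE) (simp only: unique)
  qed
qed

text \<open>
  The quantitative part of the standing mesh assumption for one element. Polynomial
  parametrizations enter only through the class of rational functions above.
\<close>

locale bilipschitz_patch =
  fixes F :: "real^2 \<Rightarrow> real^3" and lo up :: real
  assumes F_regular: "\<And>i. regular (\<lambda>x. F x $ i)"
    and lo_pos: "0 < lo"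
    and D_lower: "\<And>x \<xi>. x \<in> ref_tri \<Longrightarrow> lo * norm \<xi> \<le> norm (ref_D F x \<xi>)"
    and D_upper: "\<And>x \<xi>. x \<in> ref_tri \<Longrightarrow> norm (ref_D F x \<xi>) \<le> up * norm \<xi>"
    and F_lower: "\<And>x y. x \<in> ref_tri \<Longrightarrow> y \<in> ref_tri \<Longrightarrow> lo * norm (x - y) \<le> norm (F x - F y)"
    and F_upper: "\<And>x y. x \<in> ref_tri \<Longrightarrow> y \<in> ref_tri \<Longrightarrow> norm (F x - F y) \<le> up * norm (x - y)"
begin

lemma has_derivative_patch:
  obtains D where "\<And>\<xi> i. regular (\<lambda>x. D x \<xi> $ i)"
    "\<And>x. x \<in> ref_tri \<Longrightarrow> (F has_derivative D x) (at x within ref_tri)"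
proof -
  have "\<forall>i. \<exists>f1 f2. regular f1 \<and> regular f2 \<and> (\<forall>x\<in>ref_tri.
      ((\<lambda>x. F x $ i) has_derivative (\<lambda>\<xi>. \<xi> $ 1 * f1 x + \<xi> $ 2 * f2 x)) (at x within ref_tri))"
  proof
    fix i
    show "\<exists>f1 f2. regular f1 \<and> regular f2 \<and> (\<forall>x\<in>ref_tri.
      ((\<lambda>x. F x $ i) has_derivative (\<lambda>\<xi>. \<xi> $ 1 * f1 x + \<xi> $ 2 * f2 x)) (at x within ref_tri))"
      by (rule regular_has_derivative[OF F_regular[of i]]) blast
  qed
  then obtain f1 f2 where f: "\<And>i. regular (f1 i)" "\<And>i. regular (f2 i)"
    "\<And>i x. x \<in> ref_tri \<Longrightarrow>
      ((\<lambda>x. F x $ i) has_derivative (\<lambda>\<xi>. \<xi> $ 1 * f1 i x + \<xi> $ 2 * f2 i x)) (at x within ref_tri)"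
    unfolding choice_iff by blast
  show ?thesis
  proof (rule that[of "\<lambda>x \<xi>. \<chi> i. \<xi> $ 1 * f1 i x + \<xi> $ 2 * f2 i x"])
    show "regular (\<lambda>x. (\<chi> i. \<xi> $ 1 * f1 i x + \<xi> $ 2 * f2 i x) $ j)" for \<xi> :: "real^2" and j
      using f by (auto intro!: regular.add regular.mult regular.const)
    show "(F has_derivative (\<lambda>\<xi>. \<chi> i. \<xi> $ 1 * f1 i x + \<xi> $ 2 * f2 i x)) (at x within ref_tri)"
      if "x \<in> ref_tri" for x
      using f(3)[OF that] unfolding has_derivative_componentwise_within[of F]
      by (auto simp: Basis_vec_def inner_axis)
  qed
qed

lemma has_derivative_ref_D:
  assumes x: "x \<in> ref_tri"
  shows "(F has_derivative ref_D F x) (at x within ref_tri)"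
proof (rule has_derivative_patch)
  fix D assume D: "\<And>x. x \<in> ref_tri \<Longrightarrow> (F has_derivative D x) (at x within ref_tri)"
  show ?thesis using D[OF x] unfolding ref_D_eq[OF x D[OF x]] .
qed

lemma linear_ref_D: "x \<in> ref_tri \<Longrightarrow> linear (ref_D F x)"
  using has_derivative_ref_D has_derivative_linear by blast

lemma regular_ref_D: "regular (\<lambda>x. ref_D F x \<xi> $ i)"
proof (rule has_derivative_patch)
  fix D assume D: "\<And>\<xi> i. regular (\<lambda>x. D x \<xi> $ i)"
    "\<And>x. x \<in> ref_tri \<Longrightarrow> (F has_derivative D x) (at x within ref_tri)"
  have "ref_D F x \<xi> $ i = D x \<xi> $ i" if "x \<in> ref_tri" for x
    unfolding ref_D_eq[OF that D(2)[OF that]] ..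
  then show ?thesis by (rule regular.cong[OF D(1)[of \<xi> i]])
qed

lemma inj_on_patch: "inj_on F ref_tri"
proof (rule inj_onI)
  fix x y assume "x \<in> ref_tri" "y \<in> ref_tri" "F x = F y"
  then show "x = y" using F_lower[of x y] lo_pos by (simp add: mult_le_0_iff)
qed

text \<open>
  Subtracting from the second tangent vector its projection onto the first one leaves the cross
  product unchanged and makes it the product of two lengths. The corrected vector is the image of
  a vector of length at least one.
\<close>

lemma area_elt_lower:
  assumes x: "x \<in> ref_tri"
  shows "lo\<^sup>2 \<le> area_elt F x"
proof -
  interpret D: linear "ref_D F x" using linear_ref_D[OF x] .
  define a b where "a = ref_D F x (axis 1 1)" and "b = ref_D F x (axis 2 1)"
  define \<kappa> where "\<kappa> = (a \<bullet> b) / (a \<bullet> a)"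
  have na: "lo \<le> norm a"
    using D_lower[OF x, of "axis 1 1"] by (simp add: a_def)
  then have a: "a \<bullet> a \<noteq> 0" using lo_pos by auto
  have "1 = norm ((axis 2 1 - \<kappa> *\<^sub>R axis 1 1 :: real^2) $ 2)" by (simp add: axis_def)
  also have "\<dots> \<le> norm (axis 2 1 - \<kappa> *\<^sub>R axis 1 1 :: real^2)" by (rule Finite_Cartesian_Product.norm_nth_le)
  finally have "lo \<le> lo * norm (axis 2 1 - \<kappa> *\<^sub>R axis 1 1 :: real^2)" using lo_pos by simp
  also have "\<dots> \<le> norm (b - \<kappa> *\<^sub>R a)"
    using D_lower[OF x, of "axis 2 1 - \<kappa> *\<^sub>R axis 1 1"] unfolding a_def b_def D.diff D.scale .
  finally have nb: "lo \<le> norm (b - \<kappa> *\<^sub>R a)" .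
  have orth: "a \<bullet> (b - \<kappa> *\<^sub>R a) = 0" using a by (simp add: \<kappa>_def inner_diff_right)
  have "cross3 a (b - \<kappa> *\<^sub>R a) = cross3 a b"
    by (simp add: Cross3.right_diff_distrib cross_mult_right)
  then have "(norm (cross3 a b))\<^sup>2 = (norm a * norm (b - \<kappa> *\<^sub>R a))\<^sup>2"
    using norm_cross_dot[of a "b - \<kappa> *\<^sub>R a"] orth by simp
  then have "norm (cross3 a b) = norm a * norm (b - \<kappa> *\<^sub>R a)"
    by (rule power2_eq_imp_eq) auto
  moreover have "lo * lo \<le> norm a * norm (b - \<kappa> *\<^sub>R a)"
    using na nb lo_pos by (intro mult_mono) auto
  ultimately show ?thesis by (simp add: area_elt_def area_normal_def a_def b_def power2_eq_square)
qed

lemma area_normal_nonzero: "x \<in> ref_tri \<Longrightarrow> area_normal F x \<noteq> 0"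
  using area_elt_lower[of x] lo_pos by (auto simp: area_elt_def power2_eq_square mult_le_0_iff)

lemma regular_area_normal: "regular (\<lambda>x. area_normal F x $ i)"
  unfolding area_normal_def
  using exhaust_3[of i]
  by (auto simp: cross_components intro!: regular_diff regular.mult regular_ref_D)

lemma continuous_area_normal: "continuous_on ref_tri (area_normal F)"
  by (subst continuous_on_componentwise)
     (auto simp: Basis_vec_def inner_axis intro!: regular_continuous regular_area_normal)

lemma continuous_area_elt: "continuous_on ref_tri (area_elt F)"
  unfolding area_elt_def by (rule continuous_on_norm[OF continuous_area_normal])

lemma continuous_ref_D: "continuous_on ref_tri (\<lambda>x. ref_D F x \<xi>)"
  by (subst continuous_on_componentwise)
     (auto simp: Basis_vec_def inner_axis intro!: regular_continuous regular_ref_D)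

lemma regular_tan_grad:
  assumes f: "regular (f \<circ> F)" and N: "\<And>x. x \<in> ref_tri \<Longrightarrow> N (F x) = sgn (area_normal F x)"
  shows "regular (\<lambda>x. tan_grad (F ` ref_tri) N f (F x) $ i)"
proof -
  obtain f1 f2 where reg: "regular f1" "regular f2" and fd: "\<And>x. x \<in> ref_tri \<Longrightarrow>
      ((f \<circ> F) has_derivative (\<lambda>\<xi>. \<xi> $ 1 * f1 x + \<xi> $ 2 * f2 x)) (at x within ref_tri)"
    using regular_has_derivative[OF f] by blast
  define a b \<nu> where "a = (\<lambda>x. ref_D F x (axis 1 1))" and "b = (\<lambda>x. ref_D F x (axis 2 1))"
    and "\<nu> = area_normal F"
  have eq: "tan_grad (F ` ref_tri) N f (F x) = inverse (\<nu> x \<bullet> \<nu> x) *\<^sub>R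
      (f1 x *\<^sub>R cross3 (b x) (\<nu> x) + f2 x *\<^sub>R cross3 (\<nu> x) (a x))" if x: "x \<in> ref_tri" for x
    using tan_grad_parametrized[OF x has_derivative_ref_D[OF x] lo_pos _ _ _ fd[OF x], of N]
      F_lower[OF _ x] area_normal_nonzero[OF x] N[OF x]
    by (simp add: area_normal_def dual_vec_def Let_def a_def b_def \<nu>_def axis_def)
  have reg_comp: "regular (\<lambda>x. a x $ j)" "regular (\<lambda>x. b x $ j)" "regular (\<lambda>x. \<nu> x $ j)" for j
    unfolding a_def b_def \<nu>_def by (rule regular_ref_D regular_area_normal)+
  have cr: "regular (\<lambda>x. cross3 (u x) (w x) $ j)"
    if "\<And>j. regular (\<lambda>x. u x $ j)" "\<And>j. regular (\<lambda>x. w x $ j)" for u w j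
    using exhaust_3[of j] that by (auto simp: cross_components intro!: regular_diff regular.mult)
  have \<nu>\<nu>: "regular (\<lambda>x. inverse (\<nu> x \<bullet> \<nu> x))"
  proof (rule regular.inverse)
    show "regular (\<lambda>x. \<nu> x \<bullet> \<nu> x)"
      unfolding inner_vec_def by (auto intro!: regular_sum regular.mult reg_comp)
    show "\<nu> x \<bullet> \<nu> x \<noteq> 0" if "x \<in> ref_tri" for x
      using area_normal_nonzero[OF that] by (simp add: \<nu>_def)
  qed
  have "regular (\<lambda>x. inverse (\<nu> x \<bullet> \<nu> x) *
      (f1 x * cross3 (b x) (\<nu> x) $ i + f2 x * cross3 (\<nu> x) (a x) $ i))"
    by (intro regular.mult \<nu>\<nu> regular.add reg cr reg_comp)
  then show ?thesis by (rule regular.cong) (simp add: eq)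
qed

lemma regular_tan_div_tan_grad:
  assumes f: "regular (f \<circ> F)" and N: "\<And>x. x \<in> ref_tri \<Longrightarrow> N (F x) = sgn (area_normal F x)"
  shows "regular (\<lambda>x. tan_div (F ` ref_tri) N (tan_grad (F ` ref_tri) N f) (F x))"
  unfolding tan_div_def
proof (rule regular_sum)
  fix i :: 3
  have "regular ((\<lambda>y. tan_grad (F ` ref_tri) N f y $ i) \<circ> F)"
    unfolding o_def by (rule regular_tan_grad[OF f N])
  from regular_tan_grad[where f = "\<lambda>y. tan_grad (F ` ref_tri) N f y $ i", OF this N]
  show "regular (\<lambda>x. tan_grad (F ` ref_tri) N (\<lambda>y. tan_grad (F ` ref_tri) N f y $ i) (F x) $ i)" .
qed

end

section \<open>Elements and edges of a regular mesh\<close>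

lemma ref_vertex_simps: "ref_vertex 1 = 0" "ref_vertex 2 = axis 1 1" "ref_vertex 3 = axis 2 1"
  by (simp_all add: ref_vertex_def)

lemma ref_vertex_in_ref_tri: "ref_vertex i \<in> ref_tri"
  using ref_vertices_in_ref_tri exhaust_3[of i] by (auto simp: ref_vertex_simps)

lemma aff_map_ref_vertex: "aff_map T (ref_vertex i) = T i"
  using exhaust_3[of i] by (auto simp: aff_map_def ref_vertex_simps axis_def)

lemma norm_ref_tri_le: "x \<in> ref_tri \<Longrightarrow> norm x \<le> 1"
  using norm_le_l1_cart[of x] by (simp add: ref_tri_def sum_2)

lemma norm_diff_ref_tri_le: "x \<in> ref_tri \<Longrightarrow> y \<in> ref_tri \<Longrightarrow> norm (x - y) \<le> 2"
  using norm_triangle_ineq4[of x y] norm_ref_tri_le[of x] norm_ref_tri_le[of y] by linarith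

lemma aff_map_linepath:
  "aff_map T (linepath (ref_vertex i) (ref_vertex j) t) = linepath (T i) (T j) t"
proof -
  have "aff_map T (linepath x y t) = linepath (aff_map T x) (aff_map T y) t" for x y
    by (simp add: aff_map_def linepath_def algebra_simps)
  then show ?thesis by (simp add: aff_map_ref_vertex)
qed

lemma linepath_in_ref_tri: "0 \<le> t \<Longrightarrow> t \<le> 1 \<Longrightarrow> linepath (ref_vertex i) (ref_vertex j) t \<in> ref_tri"
  using convexD_alt[OF convex_ref_tri ref_vertex_in_ref_tri ref_vertex_in_ref_tri, of t i j]
  by (simp add: linepath_def)

lemma range_tri: "range T = {T 1, T 2, T (3::3)}"
  unfolding UNIV_3 by simp

lemma flat_eq_image: "flat T = aff_map T ` ref_tri"
proof
  show "flat T \<subseteq> aff_map T ` ref_tri"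
  proof
    fix y assume "y \<in> flat T"
    then obtain u v where uv: "y = T 1 + u *\<^sub>R (T 2 - T 1) + v *\<^sub>R (T 3 - T 1)" "0 \<le> u" "0 \<le> v" "u + v \<le> 1"
      unfolding flat_def range_tri convex_hull_3_alt by auto
    then have "y = aff_map T (vector [u, v])" "vector [u, v] \<in> ref_tri"
      by (simp_all add: aff_map_def ref_tri_def vector_2)
    then show "y \<in> aff_map T ` ref_tri" by blast
  qed
  show "aff_map T ` ref_tri \<subseteq> flat T"
    unfolding flat_def range_tri convex_hull_3_alt by (auto simp: aff_map_def ref_tri_def)
qed

lemma elem_eq_image: "elem M T = elem_map M T ` ref_tri"
  unfolding elem_def elem_map_def flat_eq_image image_comp ..

lemma diameter_flat_pos:
  assumes "inj T" shows "0 < diameter (flat T)"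
proof -
  have "T 1 \<in> flat T" "T 2 \<in> flat T" unfolding flat_def by (auto intro: hull_inc)
  moreover have "bounded (flat T)"
    unfolding flat_def range_tri by (intro compact_imp_bounded compact_convex_hull finite_imp_compact) simp
  ultimately have "dist (T 1) (T 2) \<le> diameter (flat T)" by (rule diameter_bounded_bound[rotated])
  moreover have "T 1 \<noteq> T 2" using assms by (simp add: inj_eq)
  then have "0 < dist (T 1) (T 2)" by simp
  ultimately show ?thesis by linarith
qed

text \<open>
  One mesh of the family, of size below the threshold for the standing assumption.
\<close>

locale regular_mesh =
  fixes M :: mesh and r :: nat and d :: "real^3 \<Rightarrow> real" and \<delta> c C :: real and \<Gamma> :: "(real^3) set"
  assumes conforming: "conforming_closed_mesh \<Gamma> d \<delta> M"
    and poly_lift: "polynomial_lift r d \<delta> M"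
    and standing: "standing_mesh \<Gamma> d r c C M"
    and c_pos: "0 < c" and C_pos: "0 < C"
begin

abbreviation F :: "tri \<Rightarrow> real^2 \<Rightarrow> real^3" where "F \<equiv> elem_map M"

text \<open>
  The standing assumption bounds \<open>|DF \<xi>|\<^sup>2\<close> but \<open>|F x - F y|\<close> without the square, with the same
  constants; hence the minimum of \<open>c\<close> and its root, and below the maximum of \<open>C\<close> and its root.
\<close>

definition lo :: "tri \<Rightarrow> real" where "lo T = min (sqrt c) c * diameter (flat T)"

text \<open>
  The distortion of the elements, the one way in which the mesh enters the final constants.
\<close>

definition ratio :: real where "ratio = max (sqrt C) C / min (sqrt c) c"

lemma ratio_pos: "0 < ratio" unfolding ratio_def using c_pos C_pos by simp

lemma tri_inj: "T \<in> tris M \<Longrightarrow> inj T"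
  using conforming unfolding conforming_closed_mesh_def by blast

lemma finite_tris: "finite (tris M)"
  using conforming unfolding conforming_closed_mesh_def by blast

lemma patch:
  assumes T: "T \<in> tris M"
  shows "bilipschitz_patch (F T) (lo T) (ratio * lo T)"
proof
  let ?h = "diameter (flat T)"
  have h: "0 < ?h" using diameter_flat_pos[OF tri_inj[OF T]] .
  have up: "ratio * lo T = max (sqrt C) C * ?h"
    using c_pos by (simp add: ratio_def lo_def min_def)
  note st = standing[unfolded standing_mesh_def Let_def, THEN conjunct1, rule_format, OF T]
  show "regular (\<lambda>x. F T x $ i)" for i
    using poly_lift T unfolding polynomial_lift_def by (blast intro: regular_ref_poly)
  show "0 < lo T" using h c_pos by (simp add: lo_def)
  show "lo T * norm \<xi> \<le> norm (ref_D (F T) x \<xi>)" if x: "x \<in> ref_tri" for x \<xi>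
  proof (rule power2_le_imp_le)
    have "(lo T * norm \<xi>)\<^sup>2 \<le> (sqrt c * ?h * norm \<xi>)\<^sup>2"
      using h c_pos unfolding lo_def by (intro power_mono mult_right_mono) auto
    also have "\<dots> = c * ?h\<^sup>2 * (norm \<xi>)\<^sup>2" using c_pos by (simp add: power_mult_distrib)
    also have "\<dots> \<le> (norm (ref_D (F T) x \<xi>))\<^sup>2" using st x by blast
    finally show "(lo T * norm \<xi>)\<^sup>2 \<le> (norm (ref_D (F T) x \<xi>))\<^sup>2" .
  qed simp
  show "norm (ref_D (F T) x \<xi>) \<le> ratio * lo T * norm \<xi>" if x: "x \<in> ref_tri" for x \<xi>
  proof (rule power2_le_imp_le)
    have "(norm (ref_D (F T) x \<xi>))\<^sup>2 \<le> C * ?h\<^sup>2 * (norm \<xi>)\<^sup>2" using st x by blast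
    also have "\<dots> = (sqrt C * ?h * norm \<xi>)\<^sup>2" using C_pos by (simp add: power_mult_distrib)
    also have "\<dots> \<le> (ratio * lo T * norm \<xi>)\<^sup>2"
      using h C_pos unfolding up by (intro power_mono mult_right_mono) auto
    finally show "(norm (ref_D (F T) x \<xi>))\<^sup>2 \<le> (ratio * lo T * norm \<xi>)\<^sup>2" .
    show "0 \<le> ratio * lo T * norm \<xi>" unfolding up using h C_pos by simp
  qed
  show "lo T * norm (x - y) \<le> norm (F T x - F T y)" if "x \<in> ref_tri" "y \<in> ref_tri" for x y
  proof -
    have "lo T * norm (x - y) \<le> c * ?h * norm (x - y)"
      using h c_pos unfolding lo_def by (intro mult_right_mono) auto
    also have "\<dots> \<le> norm (F T x - F T y)" using st that by blast
    finally show ?thesis .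
  qed
  show "norm (F T x - F T y) \<le> ratio * lo T * norm (x - y)" if "x \<in> ref_tri" "y \<in> ref_tri" for x y
  proof -
    have "norm (F T x - F T y) \<le> C * ?h * norm (x - y)" using st that by blast
    also have "\<dots> \<le> ratio * lo T * norm (x - y)"
      using h unfolding up by (intro mult_right_mono) auto
    finally show ?thesis .
  qed
qed

lemma lo_pos: "T \<in> tris M \<Longrightarrow> 0 < lo T"
  using patch bilipschitz_patch.lo_pos by blast

lemma ref_pt_F: "T \<in> tris M \<Longrightarrow> x \<in> ref_tri \<Longrightarrow> ref_pt M T (F T x) = x"
  unfolding ref_pt_def by (rule inv_into_f_f[OF bilipschitz_patch.inj_on_patch[OF patch]])

lemma nh_F: "T \<in> tris M \<Longrightarrow> x \<in> ref_tri \<Longrightarrow> nh M T (F T x) = sgn (area_normal (F T) x)"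
  by (simp add: nh_def ref_pt_F)

lemma regular_Wh: "v \<in> Wh k M \<Longrightarrow> T \<in> tris M \<Longrightarrow> regular (v \<circ> F T)"
  unfolding Wh_def by (blast intro: regular_ref_poly)

lemma regular_grad_h:
  assumes v: "v \<in> Wh k M" and T: "T \<in> tris M"
  shows "regular (\<lambda>x. grad_h M v T (F T x) $ i)"
  unfolding grad_h_def elem_eq_image
  by (rule bilipschitz_patch.regular_tan_grad[OF patch[OF T] regular_Wh[OF v T] nh_F[OF T]])

lemma continuous_lap_h:
  assumes v: "v \<in> Wh k M" and T: "T \<in> tris M"
  shows "continuous_on ref_tri (\<lambda>x. lap_h M v T (F T x))"
  unfolding lap_h_def grad_h_def elem_eq_image
  by (rule regular_continuous[OF bilipschitz_patch.regular_tan_div_tan_grad[OF patch[OF T] regular_Wh[OF v T] nh_F[OF T]]])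

text \<open>
  The area vector may be computed from the two edge vectors that emanate from any of the three
  vertices in cyclic order. This makes one formula for the conormal serve all three edges.
\<close>

lemma area_normal_at_vertex:
  assumes T: "T \<in> tris M" and x: "x \<in> ref_tri"
  shows "cross3 (ref_D (F T) x (ref_vertex (i + 1) - ref_vertex i))
           (ref_D (F T) x (ref_vertex (i + 2) - ref_vertex i)) = area_normal (F T) x"
proof -
  interpret D: linear "ref_D (F T) x" by (rule bilipschitz_patch.linear_ref_D[OF patch[OF T] x])
  have n: "(1::3) + 1 = 2" "(1::3) + 2 = 3" "(2::3) + 1 = 3" "(2::3) + 2 = 1" "(3::3) + 1 = 1" "(3::3) + 2 = 2"
    by auto
  consider "i = 1" | "i = 2" | "i = 3" using exhaust_3[of i] by blast
  then show ?thesis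
    by cases (simp_all only: n ref_vertex_simps D.diff D.zero diff_zero area_normal_def diff_0 D.neg
       Cross3.left_diff_distrib Cross3.right_diff_distrib cross_minus_left cross_minus_right cross_refl
       cross_skew[of "ref_D (F T) x (axis 2 1)" "ref_D (F T) x (axis 1 1)"], simp_all)
qed

text \<open>
  With \<open>p\<close> the tangent of the edge, \<open>q\<close> a tangent vector towards the opposite vertex and \<open>\<nu> = p \<times> q\<close>,
  the vectors orthogonal to \<open>p\<close> and \<open>\<nu>\<close> are the multiples of \<open>p \<times> \<nu>\<close>. The sign is right
  because \<open>(p \<times> \<nu>) \<bullet> q = - |\<nu>|\<^sup>2\<close>.
\<close>

lemma conormal_eq:
  assumes T: "T \<in> tris M" and x: "x \<in> closed_segment (ref_vertex i) (ref_vertex (i + 1))"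
  shows "conormal M {T i, T (i + 1)} T (F T x) =
    sgn (cross3 (ref_D (F T) x (ref_vertex (i + 1) - ref_vertex i)) (area_normal (F T) x))"
proof -
  obtain s where s: "0 \<le> s" "s \<le> 1" "x = linepath (ref_vertex i) (ref_vertex (i + 1)) s"
    using x unfolding closed_segment_def linepath_def by auto
  have xr: "x \<in> ref_tri" using linepath_in_ref_tri s by simp
  interpret D: linear "ref_D (F T) x" by (rule bilipschitz_patch.linear_ref_D[OF patch[OF T] xr])
  define p where "p = ref_D (F T) x (ref_vertex (i + 1) - ref_vertex i)"
  define q where "q = ref_D (F T) x (ref_vertex (i + 2) - ref_vertex i)"
  define \<nu> where "\<nu> = cross3 p q"
  have \<nu>: "area_normal (F T) x = \<nu>" unfolding \<nu>_def p_def q_def by (rule area_normal_at_vertex[OF T xr, symmetric])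
  have \<nu>0: "\<nu> \<noteq> 0" using bilipschitz_patch.area_normal_nonzero[OF patch[OF T] xr] \<nu> by simp
  have opp: "ref_D (F T) x (ref_vertex (i + 2) - x) = q - s *\<^sub>R p"
  proof -
    have "ref_vertex (i + 2) - x = (ref_vertex (i + 2) - ref_vertex i) - s *\<^sub>R (ref_vertex (i + 1) - ref_vertex i)"
      unfolding s(3) linepath_def by (simp add: algebra_simps)
    then show ?thesis unfolding p_def q_def by (simp only: D.diff[of _ "s *\<^sub>R _"] D.scale)
  qed
  have idx: "l = i \<or> l = i + 1 \<or> l = i + 2" for l
  proof -
    have n: "(1::3) + 1 = 2" "(1::3) + 2 = 3" "(2::3) + 1 = 3" "(2::3) + 2 = 1" "(3::3) + 1 = 1" "(3::3) + 2 = 2"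
      by auto
    show ?thesis using exhaust_3[of i] exhaust_3[of l] by (elim disjE) (simp_all only: n, simp_all)
  qed
  have ne: "i + 1 \<noteq> i" "i + 2 \<noteq> i" "i + 2 \<noteq> i + 1" by auto
  have inj: "T a = T b \<longleftrightarrow> a = b" for a b using tri_inj[OF T] by (simp add: inj_eq)
  have mem: "T l \<in> {T i, T (i + 1)} \<longleftrightarrow> l = i \<or> l = i + 1" for l using inj by auto
  have conds: "(norm \<mu> = 1 \<and> \<mu> \<bullet> nh M T (F T x) = 0 \<and>
      (\<forall>i' j'. T i' \<in> {T i, T (i + 1)} \<and> T j' \<in> {T i, T (i + 1)} \<longrightarrow>
         \<mu> \<bullet> ref_D (F T) x (ref_vertex j' - ref_vertex i') = 0) \<and>
      (\<forall>l. T l \<notin> {T i, T (i + 1)} \<longrightarrow> \<mu> \<bullet> ref_D (F T) x (ref_vertex l - x) < 0)) \<longleftrightarrow>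
      norm \<mu> = 1 \<and> \<mu> \<bullet> \<nu> = 0 \<and> \<mu> \<bullet> p = 0 \<and> \<mu> \<bullet> q < 0" for \<mu>
  proof -
    have 1: "\<mu> \<bullet> nh M T (F T x) = 0 \<longleftrightarrow> \<mu> \<bullet> \<nu> = 0"
      using \<nu>0 by (simp add: nh_F[OF T xr] \<nu> sgn_div_norm)
    have sw: "ref_D (F T) x (ref_vertex i - ref_vertex (i + 1)) = - p"
      unfolding p_def D.diff by simp
    have 2: "(\<forall>i' j'. T i' \<in> {T i, T (i + 1)} \<and> T j' \<in> {T i, T (i + 1)} \<longrightarrow>
         \<mu> \<bullet> ref_D (F T) x (ref_vertex j' - ref_vertex i') = 0) \<longleftrightarrow> \<mu> \<bullet> p = 0"
    proof
      assume "\<mu> \<bullet> p = 0"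
      then show "\<forall>i' j'. T i' \<in> {T i, T (i + 1)} \<and> T j' \<in> {T i, T (i + 1)} \<longrightarrow>
         \<mu> \<bullet> ref_D (F T) x (ref_vertex j' - ref_vertex i') = 0"
        unfolding mem using sw p_def by (auto simp: D.zero)
    next
      assume "\<forall>i' j'. T i' \<in> {T i, T (i + 1)} \<and> T j' \<in> {T i, T (i + 1)} \<longrightarrow>
         \<mu> \<bullet> ref_D (F T) x (ref_vertex j' - ref_vertex i') = 0"
      from this[rule_format, of i "i + 1"] show "\<mu> \<bullet> p = 0" unfolding p_def by simp
    qed
    have "(\<forall>l. T l \<notin> {T i, T (i + 1)} \<longrightarrow> \<mu> \<bullet> ref_D (F T) x (ref_vertex l - x) < 0)
        \<longleftrightarrow> \<mu> \<bullet> ref_D (F T) x (ref_vertex (i + 2) - x) < 0"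
      unfolding mem using idx ne by metis
    then show ?thesis unfolding 1 2 opp by (auto simp: inner_diff_right)
  qed
  have pvq: "cross3 p \<nu> \<bullet> q = - (\<nu> \<bullet> \<nu>)"
    unfolding \<nu>_def by (simp add: inner_vec_def sum_3 cross_components algebra_simps)
  have \<nu>\<nu>: "\<nu> \<bullet> \<nu> > 0" using \<nu>0 by simp
  have pv0: "cross3 p \<nu> \<noteq> 0" using pvq \<nu>\<nu> by auto
  have the: "(THE \<mu>. norm \<mu> = 1 \<and> \<mu> \<bullet> \<nu> = 0 \<and> \<mu> \<bullet> p = 0 \<and> \<mu> \<bullet> q < 0) = sgn (cross3 p \<nu>)"
  proof (rule the_equality)
    have "sgn (cross3 p \<nu>) \<bullet> q = - (\<nu> \<bullet> \<nu>) / norm (cross3 p \<nu>)"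
      unfolding sgn_div_norm inner_scaleR_left pvq by (simp add: divide_inverse)
    also have "\<dots> < 0" using pv0 \<nu>\<nu> by (simp add: divide_neg_pos)
    finally show "norm (sgn (cross3 p \<nu>)) = 1 \<and> sgn (cross3 p \<nu>) \<bullet> \<nu> = 0 \<and> sgn (cross3 p \<nu>) \<bullet> p = 0 \<and> sgn (cross3 p \<nu>) \<bullet> q < 0"
      using pv0 by (simp add: norm_sgn sgn_div_norm dot_cross_self)
  next
    fix \<mu> assume \<mu>: "norm \<mu> = 1 \<and> \<mu> \<bullet> \<nu> = 0 \<and> \<mu> \<bullet> p = 0 \<and> \<mu> \<bullet> q < 0"
    have "(\<nu> \<bullet> \<nu>) *\<^sub>R \<mu> = (\<mu> \<bullet> q) *\<^sub>R cross3 \<nu> p"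
      using dual_basis_expansion[of p q \<mu>] \<mu> unfolding \<nu>_def[symmetric] by simp
    also have "\<dots> = (- (\<mu> \<bullet> q)) *\<^sub>R cross3 p \<nu>" unfolding cross_skew[of \<nu> p] by simp
    finally have "sgn ((\<nu> \<bullet> \<nu>) *\<^sub>R \<mu>) = sgn ((- (\<mu> \<bullet> q)) *\<^sub>R cross3 p \<nu>)" by (rule arg_cong)
    moreover have "sgn (\<nu> \<bullet> \<nu>) = 1" "sgn (- (\<mu> \<bullet> q)) = 1" using \<nu>\<nu> \<mu> by auto
    ultimately have "sgn \<mu> = sgn (cross3 p \<nu>)" unfolding sgn_scaleR by simp
    moreover have "sgn \<mu> = \<mu>" using \<mu> by (simp add: sgn_div_norm)
    ultimately show "\<mu> = sgn (cross3 p \<nu>)" by simp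
  qed
  show ?thesis
    unfolding conormal_def Let_def ref_pt_F[OF T xr] conds \<nu> p_def[symmetric] by (rule the)
qed

lemma continuous_conormal:
  assumes T: "T \<in> tris M"
  shows "continuous_on (closed_segment (ref_vertex i) (ref_vertex (i + 1)))
    (\<lambda>x. conormal M {T i, T (i + 1)} T (F T x))"
proof -
  let ?S = "closed_segment (ref_vertex i) (ref_vertex (i + 1))"
  let ?g = "\<lambda>x. cross3 (ref_D (F T) x (ref_vertex (i + 1) - ref_vertex i)) (area_normal (F T) x)"
  interpret bilipschitz_patch "F T" "lo T" "ratio * lo T" by (rule patch[OF T])
  have sub: "?S \<subseteq> ref_tri"
    by (rule closed_segment_subset[OF ref_vertex_in_ref_tri ref_vertex_in_ref_tri convex_ref_tri])
  have "continuous_on ref_tri ?g"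
    by (intro continuous_on_cross continuous_ref_D continuous_area_normal)
  moreover have "?g x \<noteq> 0" if "x \<in> ref_tri" for x
  proof
    assume g0: "?g x = 0"
    let ?p = "ref_D (F T) x (ref_vertex (i + 1) - ref_vertex i)"
    have "?p \<bullet> area_normal (F T) x = 0"
      unfolding area_normal_at_vertex[OF T that, of i, symmetric] by (simp add: dot_cross_self)
    with g0 have "?p = 0 \<or> area_normal (F T) x = 0" using norm_and_cross_eq_0 by blast
    moreover have "area_normal (F T) x = 0" if "?p = 0"
      using area_normal_at_vertex[OF T \<open>x \<in> ref_tri\<close>, of i] that by simp
    ultimately show False using area_normal_nonzero[OF that] by blast
  qed
  ultimately have "continuous_on ?S (\<lambda>x. sgn (?g x))"
    using sub by (intro continuous_on_sgn) (auto intro: continuous_on_subset)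
  then show ?thesis
    by (rule continuous_on_eq) (rule conormal_eq[OF T, symmetric])
qed

lemma finite_edges: "finite (edges M)"
proof -
  have "edges M \<subseteq> (\<lambda>(T, i, j). {T i, T j}) ` (tris M \<times> UNIV \<times> UNIV)"
    unfolding edges_def by force
  then show ?thesis using finite_tris by (auto intro: finite_subset)
qed

lemma edge_trisD: "T \<in> edge_tris M e \<Longrightarrow> T \<in> tris M"
  unfolding edge_tris_def by simp

lemma finite_edge_tris: "finite (edge_tris M e)"
  using finite_tris unfolding edge_tris_def by simp

text \<open>
  The parametrization of an edge starts from a chosen ordering of its endpoints; whichever it is,
  in each adjacent element it is the image of a segment joining two reference vertices.
\<close>

lemma edge_curve_eq:
  assumes e: "e \<in> edges M" and T: "T \<in> edge_tris M e"
  obtains i j where "i \<noteq> j" "e = {T i, T j}"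
    "\<And>t. edge_curve M e t = F T (linepath (ref_vertex i) (ref_vertex j) t)"
proof -
  obtain T' i' j' where T': "T' \<in> tris M" "i' \<noteq> j'" "e = {T' i', T' j'}"
    using e unfolding edges_def by blast
  define p where "p = (SOME (a, b). e = {a, b})"
  have "case p of (a, b) \<Rightarrow> e = {a, b}"
    unfolding p_def by (rule someI_ex) (use T'(3) in auto)
  then obtain a b where ab: "p = (a, b)" "e = {a, b}" by (cases p) auto
  have "card e = 2" using T' tri_inj[OF T'(1)] by (simp add: inj_eq)
  then have "a \<noteq> b" using ab by auto
  have "e \<subseteq> range T" using T unfolding edge_tris_def by simp
  then obtain i j where ij: "a = T i" "b = T j" using ab by auto
  have "edge_curve M e = lift M \<circ> linepath a b"
    using ab unfolding edge_curve_def p_def by simp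
  then have "edge_curve M e t = F T (linepath (ref_vertex i) (ref_vertex j) t)" for t
    by (simp add: ij elem_map_def aff_map_linepath)
  then show ?thesis using that[of i j] ab ij \<open>a \<noteq> b\<close> by auto
qed

lemma edge_in_reference:
  assumes e: "e \<in> edges M" and T: "T \<in> edge_tris M e"
  shows "continuous_on {0..1} (\<lambda>t. ref_pt M T (edge_curve M e t))"
    and "0 \<le> t \<Longrightarrow> t \<le> 1 \<Longrightarrow> ref_pt M T (edge_curve M e t) \<in> ref_tri"
    and "0 \<le> t \<Longrightarrow> t \<le> 1 \<Longrightarrow> F T (ref_pt M T (edge_curve M e t)) = edge_curve M e t"
proof -
  obtain i j where "i \<noteq> j" "e = {T i, T j}"
    and ij: "\<And>t. edge_curve M e t = F T (linepath (ref_vertex i) (ref_vertex j) t)"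
    by (rule edge_curve_eq[OF e T], rule that)
  have pt: "ref_pt M T (edge_curve M e t) = linepath (ref_vertex i) (ref_vertex j) t" if "0 \<le> t" "t \<le> 1" for t
    unfolding ij by (rule ref_pt_F[OF edge_trisD[OF T] linepath_in_ref_tri[OF that]])
  show "continuous_on {0..1} (\<lambda>t. ref_pt M T (edge_curve M e t))"
    by (rule continuous_on_eq[OF continuous_on_linepath]) (simp add: pt)
  show "ref_pt M T (edge_curve M e t) \<in> ref_tri" if "0 \<le> t" "t \<le> 1"
    unfolding pt[OF that] by (rule linepath_in_ref_tri[OF that])
  show "F T (ref_pt M T (edge_curve M e t)) = edge_curve M e t" if "0 \<le> t" "t \<le> 1"
    using pt[OF that] ij[of t] by simp
qed

lemma continuous_on_edge_ref:
  assumes e: "e \<in> edges M" and T: "T \<in> edge_tris M e" and g: "continuous_on ref_tri g"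
  shows "continuous_on {0..1} (\<lambda>t. g (ref_pt M T (edge_curve M e t)))"
  by (rule continuous_on_compose2[OF g edge_in_reference(1)[OF e T]])
     (auto intro: edge_in_reference(2)[OF e T])

lemma continuous_on_edge:
  assumes e: "e \<in> edges M" and T: "T \<in> edge_tris M e"
    and g: "continuous_on ref_tri (\<lambda>x. g (F T x))"
  shows "continuous_on {0..1} (\<lambda>t. g (edge_curve M e t))"
  by (rule continuous_on_eq[OF continuous_on_edge_ref[OF e T g]]) (simp add: edge_in_reference(3)[OF e T])

text \<open>
  The ordering chosen for \<open>edge_curve\<close> may run against the orientation of the element, but the segment
  is the same.
\<close>

lemma edge_index:
  assumes e: "e \<in> edges M" and T: "T \<in> edge_tris M e"
  obtains i where "e = {T i, T (i + 1)}"
    "\<And>t. 0 \<le> t \<Longrightarrow> t \<le> 1 \<Longrightarrow>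
       ref_pt M T (edge_curve M e t) \<in> closed_segment (ref_vertex i) (ref_vertex (i + 1))"
proof -
  obtain i j where ij: "i \<noteq> j" "e = {T i, T j}"
    "\<And>t. edge_curve M e t = F T (linepath (ref_vertex i) (ref_vertex j) t)"
    by (rule edge_curve_eq[OF e T], rule that)
  have pt: "ref_pt M T (edge_curve M e t) \<in> closed_segment (ref_vertex i) (ref_vertex j)"
    if "0 \<le> t" "t \<le> 1" for t
    unfolding ij(3) ref_pt_F[OF edge_trisD[OF T] linepath_in_ref_tri[OF that]]
    using that by (simp add: linepath_in_path)
  have n: "(1::3) + 1 = 2" "(2::3) + 1 = 3" "(3::3) + 1 = 1" by auto
  have "j = i + 1 \<or> i = j + 1"
    using ij(1) exhaust_3[of i] exhaust_3[of j] by (elim disjE) (simp_all only: n, simp_all)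
  then show ?thesis
  proof
    assume "j = i + 1"
    then show ?thesis using that[of i] ij(2) pt by blast
  next
    assume "i = j + 1"
    then show ?thesis using that[of j] ij(2) pt by (metis closed_segment_commute insert_commute)
  qed
qed

lemma continuous_jump:
  assumes v: "v \<in> Wh k M" and e: "e \<in> edges M"
  shows "continuous_on {0..1} (\<lambda>t. jump M v e (edge_curve M e t))"
  unfolding jump_def
proof (intro continuous_on_sum continuous_on_inner)
  fix T assume T: "T \<in> edge_tris M e"
  note T' = edge_trisD[OF T]
  show "continuous_on {0..1} (\<lambda>t. grad_h M v T (edge_curve M e t))"
  proof (rule continuous_on_edge[OF e T])
    show "continuous_on ref_tri (\<lambda>x. grad_h M v T (F T x))"
      by (subst continuous_on_componentwise)
         (auto simp: Basis_vec_def inner_axis intro!: regular_continuous regular_grad_h[OF v T'])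
  qed
  obtain i where i: "e = {T i, T (i + 1)}"
    "\<And>t. 0 \<le> t \<Longrightarrow> t \<le> 1 \<Longrightarrow>
       ref_pt M T (edge_curve M e t) \<in> closed_segment (ref_vertex i) (ref_vertex (i + 1))"
    by (rule edge_index[OF e T], rule that)
  have "continuous_on {0..1} (\<lambda>t. conormal M {T i, T (i + 1)} T (F T (ref_pt M T (edge_curve M e t))))"
    by (rule continuous_on_compose2[OF continuous_conormal[OF T'] edge_in_reference(1)[OF e T]])
       (auto intro: i(2))
  then show "continuous_on {0..1} (\<lambda>t. conormal M e T (edge_curve M e t))"
    by (rule continuous_on_eq) (simp add: edge_in_reference(3)[OF e T] i(1)[symmetric])
qed

lemma edge_line_elt:
  assumes e: "e \<in> edges M" and T: "T \<in> edge_tris M e"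
  shows "continuous_on {0..1} (line_elt (edge_curve M e))"
    and "0 \<le> t \<Longrightarrow> t \<le> 1 \<Longrightarrow> line_elt (edge_curve M e) t \<le> 2 * (ratio * lo T)"
proof -
  interpret bilipschitz_patch "F T" "lo T" "ratio * lo T" by (rule patch[OF edge_trisD[OF T]])
  obtain i j where "i \<noteq> j" "e = {T i, T j}"
    and ij: "\<And>t. edge_curve M e t = F T (linepath (ref_vertex i) (ref_vertex j) t)"
    by (rule edge_curve_eq[OF e T], rule that)
  let ?l = "linepath (ref_vertex i) (ref_vertex j)" and ?w = "ref_vertex j - ref_vertex i"
  have eq: "line_elt (edge_curve M e) t = norm (ref_D (F T) (?l t) ?w)" if t: "0 \<le> t" "t \<le> 1" for t
  proof -
    have lt: "?l t \<in> ref_tri" by (rule linepath_in_ref_tri[OF t])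
    have im: "?l ` {0..1} \<subseteq> ref_tri" using linepath_in_ref_tri by auto
    have "(?l has_derivative (\<lambda>s. s *\<^sub>R ?w)) (at t within {0..1})"
      using has_vector_derivative_linepath_within[of "ref_vertex i" "ref_vertex j" t "{0..1}"]
      unfolding has_vector_derivative_def .
    then have "((\<lambda>t. F T (?l t)) has_derivative (\<lambda>s. ref_D (F T) (?l t) (s *\<^sub>R ?w))) (at t within {0..1})"
      by (rule has_derivative_in_compose) (rule has_derivative_subset[OF has_derivative_ref_D[OF lt] im])
    then have "((\<lambda>t. F T (?l t)) has_vector_derivative ref_D (F T) (?l t) ?w) (at t within {0..1})"
      unfolding has_vector_derivative_def by (simp add: linear_cmul[OF linear_ref_D[OF lt]])
    then have "((\<lambda>t. edge_curve M e t) has_vector_derivative ref_D (F T) (?l t) ?w) (at t within {0..1})"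
      unfolding ij .
    then have "vector_derivative (edge_curve M e) (at t within {0..1}) = ref_D (F T) (?l t) ?w"
      by (intro vector_derivative_within_closed_interval) (use t in auto)
    then show ?thesis by (simp add: line_elt_def)
  qed
  have "continuous_on {0..1} (\<lambda>t. norm (ref_D (F T) (?l t) ?w))"
    by (intro continuous_on_norm continuous_on_compose2[OF continuous_ref_D continuous_on_linepath])
       (use linepath_in_ref_tri in auto)
  then show "continuous_on {0..1} (line_elt (edge_curve M e))"
    by (rule continuous_on_eq) (simp add: eq)
  show "line_elt (edge_curve M e) t \<le> 2 * (ratio * lo T)" if t: "0 \<le> t" "t \<le> 1"
  proof -
    have "norm (ref_D (F T) (?l t) ?w) \<le> ratio * lo T * norm ?w"
      by (rule D_upper[OF linepath_in_ref_tri[OF t]])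
    also have "\<dots> \<le> ratio * lo T * 2"
      using lo_pos ratio_pos
      by (intro mult_left_mono norm_diff_ref_tri_le ref_vertex_in_ref_tri) auto
    finally show ?thesis unfolding eq[OF t] by simp
  qed
qed

lemma edge_diam_bounds:
  assumes e: "e \<in> edges M" and T: "T \<in> edge_tris M e"
  shows "0 < edge_diam M e" "edge_diam M e \<le> 2 * (ratio * lo T)"
proof -
  interpret bilipschitz_patch "F T" "lo T" "ratio * lo T" by (rule patch[OF edge_trisD[OF T]])
  obtain i j where ij: "i \<noteq> j" "e = {T i, T j}"
    "\<And>t. edge_curve M e t = F T (linepath (ref_vertex i) (ref_vertex j) t)"
    by (rule edge_curve_eq[OF e T], rule that)
  have "convex hull e = aff_map T ` linepath (ref_vertex i) (ref_vertex j) ` {0..1}"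
    unfolding ij(2) segment_convex_hull[symmetric] linepath_image_01[symmetric] image_image aff_map_linepath ..
  then have ce: "curved_edge M e = F T ` linepath (ref_vertex i) (ref_vertex j) ` {0..1}"
    unfolding curved_edge_def elem_map_def by (simp only: image_comp o_assoc)
  have sub: "linepath (ref_vertex i) (ref_vertex j) ` {0..1} \<subseteq> ref_tri"
    using linepath_in_ref_tri by auto
  have dist: "norm (x - y) \<le> 2 * (ratio * lo T)" if "x \<in> curved_edge M e" "y \<in> curved_edge M e" for x y
  proof -
    obtain x' y' where xy: "x' \<in> ref_tri" "y' \<in> ref_tri" "x = F T x'" "y = F T y'"
      using \<open>x \<in> _\<close> \<open>y \<in> _\<close> sub unfolding ce by blast
    have "norm (x - y) \<le> ratio * lo T * norm (x' - y')" unfolding xy by (rule F_upper[OF xy(1,2)])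
    also have "\<dots> \<le> ratio * lo T * 2"
      using lo_pos ratio_pos by (intro mult_left_mono norm_diff_ref_tri_le xy) auto
    finally show ?thesis by simp
  qed
  show "edge_diam M e \<le> 2 * (ratio * lo T)"
    unfolding edge_diam_def using lo_pos ratio_pos dist by (intro diameter_le) auto
  have ends: "F T (ref_vertex i) \<in> curved_edge M e" "F T (ref_vertex j) \<in> curved_edge M e"
    unfolding ce by (rule imageI, rule image_eqI[of _ _ 0], simp_all add: linepath_def)
      (rule imageI, rule image_eqI[of _ _ 1], simp_all)
  have "bounded (curved_edge M e)"
    unfolding bounded_def using dist ends(1) by (metis dist_norm)
  then have "dist (F T (ref_vertex i)) (F T (ref_vertex j)) \<le> edge_diam M e"
    unfolding edge_diam_def using ends by (intro diameter_bounded_bound)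
  moreover have "T i \<noteq> T j" using ij tri_inj[OF edge_trisD[OF T]] by (simp add: inj_eq)
  then have "ref_vertex i \<noteq> ref_vertex j" by (metis aff_map_ref_vertex)
  then have "F T (ref_vertex i) \<noteq> F T (ref_vertex j)"
    using inj_onD[OF inj_on_patch _ ref_vertex_in_ref_tri ref_vertex_in_ref_tri] by blast
  then have "0 < dist (F T (ref_vertex i)) (F T (ref_vertex j))" by simp
  ultimately show "0 < edge_diam M e" by linarith
qed

lemma edge_has_tri:
  assumes "e \<in> edges M" obtains T where "T \<in> edge_tris M e"
proof -
  have "card (edge_tris M e) = 2" using conforming assms unfolding conforming_closed_mesh_def by blast
  then show ?thesis using that by fastforce
qed

lemma elem_set_integrable:
  assumes T: "T \<in> tris M" and g: "continuous_on ref_tri (\<lambda>x. g (F T x))"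
  shows "set_integrable lborel ref_tri (\<lambda>x. g (F T x) * area_elt (F T) x)"
  by (intro set_integrable_ref_tri continuous_on_mult g bilipschitz_patch.continuous_area_elt[OF patch[OF T]])

lemma edge_set_integrable:
  assumes e: "e \<in> edges M" and g: "continuous_on {0..1} (\<lambda>t. g (edge_curve M e t))"
  shows "set_integrable lborel {0..1} (\<lambda>t. g (edge_curve M e t) * line_elt (edge_curve M e) t)"
proof -
  obtain T where T: "T \<in> edge_tris M e" using edge_has_tri[OF e] .
  have "continuous_on {0..1} (\<lambda>t. g (edge_curve M e t) * line_elt (edge_curve M e) t)"
    by (intro continuous_on_mult g edge_line_elt(1)[OF e T])
  then show ?thesis
    unfolding set_integrable_def by (intro borel_integrable_compact) auto
qed

lemma elem_integral_comb:
  assumes T: "T \<in> tris M" and f: "continuous_on ref_tri (\<lambda>x. f (F T x))"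
    and g: "continuous_on ref_tri (\<lambda>x. g (F T x))"
  shows "elem_integral M T (\<lambda>x. f x + a * g x) = elem_integral M T f + a * elem_integral M T g"
proof -
  have "elem_integral M T (\<lambda>x. f x + a * g x) =
      (LINT x:ref_tri|lborel. f (F T x) * area_elt (F T) x + a * (g (F T x) * area_elt (F T) x))"
    unfolding elem_integral_def by (simp add: algebra_simps)
  also have "\<dots> = elem_integral M T f + a * elem_integral M T g"
    unfolding elem_integral_def
    by (subst set_integral_add(2)) (use elem_set_integrable[OF T f] elem_set_integrable[OF T g] in \<open>auto intro: set_integrable_mult_right\<close>)
  finally show ?thesis .
qed

lemma edge_integral_comb:
  assumes e: "e \<in> edges M" and f: "continuous_on {0..1} (\<lambda>t. f (edge_curve M e t))"
    and g: "continuous_on {0..1} (\<lambda>t. g (edge_curve M e t))"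
  shows "edge_integral M e (\<lambda>x. f x + a * g x) = edge_integral M e f + a * edge_integral M e g"
proof -
  have "edge_integral M e (\<lambda>x. f x + a * g x) =
      (LINT t:{0..1}|lborel. f (edge_curve M e t) * line_elt (edge_curve M e) t
         + a * (g (edge_curve M e t) * line_elt (edge_curve M e) t))"
    unfolding edge_integral_def by (simp add: algebra_simps)
  also have "\<dots> = edge_integral M e f + a * edge_integral M e g"
    unfolding edge_integral_def
    by (subst set_integral_add(2)) (use edge_set_integrable[OF e f] edge_set_integrable[OF e g] in \<open>auto intro: set_integrable_mult_right\<close>)
  finally show ?thesis .
qed

lemma edge_integral_sum:
  assumes e: "e \<in> edges M" and "finite S"
    and "\<And>i. i \<in> S \<Longrightarrow> continuous_on {0..1} (\<lambda>t. f i (edge_curve M e t))"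
  shows "edge_integral M e (\<lambda>x. \<Sum>i\<in>S. a * f i x) = (\<Sum>i\<in>S. a * edge_integral M e (f i))"
  using assms(2,3)
proof (induction S rule: finite_induct)
  case empty
  show ?case by (simp add: edge_integral_def)
next
  case (insert j S)
  have "edge_integral M e (\<lambda>x. (\<Sum>i\<in>S. a * f i x) + a * f j x)
      = edge_integral M e (\<lambda>x. \<Sum>i\<in>S. a * f i x) + a * edge_integral M e (f j)"
    using insert.prems
    by (intro edge_integral_comb[OF e] continuous_on_sum continuous_on_mult continuous_on_const) auto
  then show ?case using insert by (simp add: add.commute)
qed

lemma elem_integral_nonneg: "(\<And>x. 0 \<le> f x) \<Longrightarrow> 0 \<le> elem_integral M T f"
  unfolding elem_integral_def set_lebesgue_integral_def
  by (intro Bochner_Integration.integral_nonneg) (auto simp: area_elt_def)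

lemma edge_integral_nonneg: "(\<And>x. 0 \<le> f x) \<Longrightarrow> 0 \<le> edge_integral M e f"
  unfolding edge_integral_def set_lebesgue_integral_def
  by (intro Bochner_Integration.integral_nonneg) (auto simp: line_elt_def)

lemma edge_integral_mono:
  assumes e: "e \<in> edges M" and f: "continuous_on {0..1} (\<lambda>t. f (edge_curve M e t))"
    and g: "continuous_on {0..1} (\<lambda>t. g (edge_curve M e t))"
    and le: "\<And>t. 0 \<le> t \<Longrightarrow> t \<le> 1 \<Longrightarrow> f (edge_curve M e t) \<le> g (edge_curve M e t)"
  shows "edge_integral M e f \<le> edge_integral M e g"
  unfolding edge_integral_def
  by (rule set_integral_mono[OF edge_set_integrable[OF e f] edge_set_integrable[OF e g]])
     (use le in \<open>auto intro!: mult_right_mono simp: line_elt_def\<close>)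

lemma edge_integral_cong:
  assumes "\<And>t. 0 \<le> t \<Longrightarrow> t \<le> 1 \<Longrightarrow> f (edge_curve M e t) = g (edge_curve M e t)"
  shows "edge_integral M e f = edge_integral M e g"
  unfolding edge_integral_def by (rule set_lebesgue_integral_cong) (use assms in auto)

section \<open>The inverse trace inequality\<close>

text \<open>
  Fields that are continuous in reference coordinates up to the boundary of each element; on these
  the integrals are bilinear. The edge fields play the same role on edges.
\<close>

definition elem_fields :: "(tri \<Rightarrow> real^3 \<Rightarrow> real) set" where
  "elem_fields = {f. \<forall>T\<in>tris M. continuous_on ref_tri (\<lambda>x. f T (F T x))}"

definition edge_fields :: "((real^3) set \<Rightarrow> real^3 \<Rightarrow> real) set" where
  "edge_fields = {\<phi>. \<forall>e\<in>edges M. continuous_on {0..1} (\<lambda>t. \<phi> e (edge_curve M e t))}"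

definition edge_form ::
  "((real^3) set \<Rightarrow> real^3 \<Rightarrow> real) \<Rightarrow> ((real^3) set \<Rightarrow> real^3 \<Rightarrow> real) \<Rightarrow> real" where
  "edge_form \<phi> \<psi> = (\<Sum>e\<in>edges M. inverse (edge_diam M e) * inner_E M e (\<phi> e) (\<psi> e))"

lemma edge_diam_pos: "e \<in> edges M \<Longrightarrow> 0 < edge_diam M e"
  using edge_has_tri edge_diam_bounds(1) by metis

lemma edge_form_nonneg: "0 \<le> edge_form \<phi> \<phi>"
  unfolding edge_form_def inner_E_def
  by (intro sum_nonneg mult_nonneg_nonneg[OF _ edge_integral_nonneg]) (auto intro: less_imp_le edge_diam_pos)

lemma semi_inner_product_inner_h:
  "semi_inner_product elem_fields (\<lambda>a f g T x. f T x + a * g T x) (inner_h M)"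
proof
  fix f g z a assume f: "f \<in> elem_fields" and g: "g \<in> elem_fields"
  show "(\<lambda>T x. f T x + a * g T x) \<in> elem_fields"
    using f g unfolding elem_fields_def by (auto intro!: continuous_intros)
  show "inner_h M f g = inner_h M g f" unfolding inner_h_def by (simp add: mult.commute)
  assume z: "z \<in> elem_fields"
  have "elem_integral M T (\<lambda>x. (f T x + a * g T x) * z T x)
      = elem_integral M T (\<lambda>x. f T x * z T x) + a * elem_integral M T (\<lambda>x. g T x * z T x)"
    if T: "T \<in> tris M" for T
  proof -
    have "elem_integral M T (\<lambda>x. (f T x + a * g T x) * z T x)
        = elem_integral M T (\<lambda>x. f T x * z T x + a * (g T x * z T x))"
      by (simp add: algebra_simps)
    also have "\<dots> = elem_integral M T (\<lambda>x. f T x * z T x) + a * elem_integral M T (\<lambda>x. g T x * z T x)"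
      using f g z T unfolding elem_fields_def by (intro elem_integral_comb continuous_on_mult) auto
    finally show ?thesis .
  qed
  then show "inner_h M (\<lambda>T x. f T x + a * g T x) z = inner_h M f z + a * inner_h M g z"
    unfolding inner_h_def by (simp add: sum.distrib sum_distrib_left)
next
  show "0 \<le> inner_h M f f" for f
    unfolding inner_h_def by (intro sum_nonneg elem_integral_nonneg) simp
qed

lemma semi_inner_product_edge_form:
  "semi_inner_product edge_fields (\<lambda>a \<phi> \<psi> e x. \<phi> e x + a * \<psi> e x) edge_form"
proof
  fix f g z a assume f: "f \<in> edge_fields" and g: "g \<in> edge_fields"
  show "(\<lambda>e x. f e x + a * g e x) \<in> edge_fields"
    using f g unfolding edge_fields_def by (auto intro!: continuous_intros)
  show "edge_form f g = edge_form g f" unfolding edge_form_def inner_E_def by (simp add: mult.commute)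
  assume z: "z \<in> edge_fields"
  have "inner_E M e (\<lambda>x. f e x + a * g e x) (z e) = inner_E M e (f e) (z e) + a * inner_E M e (g e) (z e)"
    if e: "e \<in> edges M" for e
  proof -
    have "inner_E M e (\<lambda>x. f e x + a * g e x) (z e)
        = edge_integral M e (\<lambda>x. f e x * z e x + a * (g e x * z e x))"
      unfolding inner_E_def by (simp add: algebra_simps)
    also have "\<dots> = inner_E M e (f e) (z e) + a * inner_E M e (g e) (z e)"
      using f g z e unfolding edge_fields_def inner_E_def
      by (intro edge_integral_comb continuous_on_mult) auto
    finally show ?thesis .
  qed
  then show "edge_form (\<lambda>e x. f e x + a * g e x) z = edge_form f z + a * edge_form g z"
    unfolding edge_form_def by (simp add: sum.distrib sum_distrib_left algebra_simps)
qed (rule edge_form_nonneg)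

lemma Qh_elem_fields: "q \<in> Qh k M \<Longrightarrow> q \<in> elem_fields"
  unfolding Qh_def elem_fields_def using ref_poly_continuous by (fastforce simp: o_def)

lemma lap_h_elem_fields: "v \<in> Wh k M \<Longrightarrow> lap_h M v \<in> elem_fields"
  unfolding elem_fields_def using continuous_lap_h by blast

lemma jump_edge_fields: "v \<in> Wh k M \<Longrightarrow> jump M v \<in> edge_fields"
  unfolding edge_fields_def using continuous_jump by blast

lemma continuous_Qh_edge:
  assumes q: "q \<in> Qh k M" and e: "e \<in> edges M" and T: "T \<in> edge_tris M e"
  shows "continuous_on {0..1} (\<lambda>t. q T (edge_curve M e t))"
  using Qh_elem_fields[OF q] edge_trisD[OF T] unfolding elem_fields_def
  by (intro continuous_on_edge[OF e T]) blast

lemma elem_integral_lower: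
  assumes T: "T \<in> tris M" and u: "continuous_on ref_tri u"
  shows "(lo T)\<^sup>2 * (LINT x:ref_tri|lborel. (u x)\<^sup>2) \<le> (LINT x:ref_tri|lborel. u x * u x * area_elt (F T) x)"
proof -
  interpret bilipschitz_patch "F T" "lo T" "ratio * lo T" by (rule patch[OF T])
  have "(lo T)\<^sup>2 * (LINT x:ref_tri|lborel. (u x)\<^sup>2) = (LINT x:ref_tri|lborel. (lo T)\<^sup>2 * (u x)\<^sup>2)"
    by simp
  also have "\<dots> \<le> (LINT x:ref_tri|lborel. u x * u x * area_elt (F T) x)"
  proof (rule set_integral_mono)
    show "(lo T)\<^sup>2 * (u x)\<^sup>2 \<le> u x * u x * area_elt (F T) x" if "x \<in> ref_tri" for x
      using mult_right_mono[OF area_elt_lower[OF that], of "(u x)\<^sup>2"] by (simp add: power2_eq_square mult_ac)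
  qed (intro set_integrable_ref_tri continuous_intros u continuous_area_elt)+
  finally show ?thesis .
qed

text \<open>
  The edge diameter and the line element contribute a factor of at most \<open>2 ratio lo\<close> each, and the area
  element is at least \<open>lo\<^sup>2\<close>.
\<close>

lemma inverse_trace_inequality:
  assumes K: "0 < K" "\<And>u P. ref_poly (k - 2) u \<Longrightarrow> P \<in> ref_tri \<Longrightarrow>
      (u P)\<^sup>2 \<le> K * (LINT x:ref_tri|lborel. (u x)\<^sup>2)"
    and q: "q \<in> Qh k M" and e: "e \<in> edges M" and T: "T \<in> edge_tris M e"
  shows "edge_diam M e * inner_E M e (q T) (q T) \<le> 4 * ratio\<^sup>2 * K * elem_integral M T (\<lambda>x. q T x * q T x)"
proof -
  have T': "T \<in> tris M" by (rule edge_trisD[OF T])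
  note lo = lo_pos[OF T'] and rp = ratio_pos
  define u where "u = (\<lambda>x. q T (F T x))"
  define I where "I = (LINT x:ref_tri|lborel. (u x)\<^sup>2)"
  have u: "ref_poly (k - 2) u" using q T' unfolding Qh_def u_def by (auto simp: o_def)
  have I0: "0 \<le> I" unfolding I_def set_lebesgue_integral_def
    by (intro Bochner_Integration.integral_nonneg) auto
  have "inner_E M e (q T) (q T) =
      (LINT t:{0..1}|lborel. (q T (edge_curve M e t) * q T (edge_curve M e t)) * line_elt (edge_curve M e) t)"
    unfolding inner_E_def edge_integral_def ..
  also have "\<dots> \<le> (LINT t:{0..1::real}|lborel. K * I * (2 * (ratio * lo T)))"
  proof (rule set_integral_mono)
    show "set_integrable lborel {0..1} (\<lambda>t. (q T (edge_curve M e t) * q T (edge_curve M e t)) * line_elt (edge_curve M e) t)"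
      by (rule edge_set_integrable[OF e]) (intro continuous_on_mult continuous_Qh_edge[OF q e T])
    show "set_integrable lborel {0..1::real} (\<lambda>t. K * I * (2 * (ratio * lo T)))"
      unfolding set_integrable_def by (intro borel_integrable_compact) auto
    fix t :: real assume t: "t \<in> {0..1}"
    have "q T (edge_curve M e t) * q T (edge_curve M e t) \<le> K * I"
      using K(2)[OF u edge_in_reference(2)[OF e T, of t]] edge_in_reference(3)[OF e T, of t] t
      unfolding I_def[symmetric] by (simp add: u_def power2_eq_square)
    then show "(q T (edge_curve M e t) * q T (edge_curve M e t)) * line_elt (edge_curve M e) t
        \<le> K * I * (2 * (ratio * lo T))"
      using edge_line_elt(2)[OF e T, of t] t K(1) I0 by - (rule mult_mono, auto simp: line_elt_def)
  qed
  also have "\<dots> = K * I * (2 * (ratio * lo T))"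
    by (simp add: set_lebesgue_integral_def)
  finally have E: "inner_E M e (q T) (q T) \<le> K * I * (2 * (ratio * lo T))" .
  have E0: "0 \<le> inner_E M e (q T) (q T)" unfolding inner_E_def by (rule edge_integral_nonneg) simp
  have "edge_diam M e * inner_E M e (q T) (q T) \<le> (2 * (ratio * lo T)) * (K * I * (2 * (ratio * lo T)))"
    by (rule mult_mono[OF edge_diam_bounds(2)[OF e T] E]) (use lo rp E0 in auto)
  also have "\<dots> = 4 * ratio\<^sup>2 * K * ((lo T)\<^sup>2 * I)" by (simp add: power2_eq_square algebra_simps)
  also have "\<dots> \<le> 4 * ratio\<^sup>2 * K * elem_integral M T (\<lambda>x. q T x * q T x)"
    using elem_integral_lower[OF T' ref_poly_continuous[OF u]] K(1)
    unfolding I_def elem_integral_def u_def by (intro mult_left_mono) auto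
  finally show ?thesis .
qed

lemma avg_edge_fields:
  assumes q: "q \<in> Qh k M" shows "avg M q \<in> edge_fields"
  unfolding edge_fields_def avg_def
  by (auto intro!: continuous_intros continuous_Qh_edge[OF q])

text \<open>
  Each edge sees two elements, which the square of the average splits with factor \<open>1/2\<close>. For the
  number of edges of one element, the number of subsets of its vertices is a sufficient bound.
\<close>

lemma avg_trace_inequality:
  assumes K: "0 < K" "\<And>u P. ref_poly (k - 2) u \<Longrightarrow> P \<in> ref_tri \<Longrightarrow>
      (u P)\<^sup>2 \<le> K * (LINT x:ref_tri|lborel. (u x)\<^sup>2)"
    and q: "q \<in> Qh k M"
  shows "(\<Sum>e\<in>edges M. edge_diam M e * inner_E M e (avg M q e) (avg M q e)) \<le> 16 * ratio\<^sup>2 * K * inner_h M q q"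
proof -
  let ?I = "\<lambda>T. elem_integral M T (\<lambda>x. q T x * q T x)"
  have I0: "0 \<le> ?I T" for T by (rule elem_integral_nonneg) simp
  have "edge_diam M e * inner_E M e (avg M q e) (avg M q e) \<le> (\<Sum>T\<in>edge_tris M e. 2 * ratio\<^sup>2 * K * ?I T)"
    if e: "e \<in> edges M" for e
  proof -
    have card: "card (edge_tris M e) = 2"
      using conforming e unfolding conforming_closed_mesh_def by blast
    have "inner_E M e (avg M q e) (avg M q e) \<le> edge_integral M e (\<lambda>x. \<Sum>T\<in>edge_tris M e. 1/2 * (q T x * q T x))"
      unfolding inner_E_def
    proof (rule edge_integral_mono[OF e])
      show "continuous_on {0..1} (\<lambda>t. avg M q e (edge_curve M e t) * avg M q e (edge_curve M e t))"
        using avg_edge_fields[OF q] e unfolding edge_fields_def by (auto intro: continuous_on_mult)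
      show "continuous_on {0..1} (\<lambda>t. \<Sum>T\<in>edge_tris M e. 1/2 * (q T (edge_curve M e t) * q T (edge_curve M e t)))"
        by (intro continuous_on_sum continuous_on_mult continuous_on_const continuous_Qh_edge[OF q e])
      fix t :: real
      let ?y = "edge_curve M e t"
      have "(\<Sum>T\<in>edge_tris M e. q T ?y)\<^sup>2 \<le> 2 * (\<Sum>T\<in>edge_tris M e. (q T ?y)\<^sup>2)"
        using sum_squared_le_sum_of_squares[where I = "edge_tris M e" and f = "\<lambda>T. q T ?y"] finite_edge_tris card by simp
      then show "avg M q e ?y * avg M q e ?y \<le> (\<Sum>T\<in>edge_tris M e. 1/2 * (q T ?y * q T ?y))"
        unfolding avg_def sum_distrib_left[symmetric] by (simp add: power2_eq_square)
    qed
    also have "\<dots> = (\<Sum>T\<in>edge_tris M e. 1/2 * inner_E M e (q T) (q T))"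
      unfolding inner_E_def
      by (rule edge_integral_sum[OF e finite_edge_tris]) (intro continuous_on_mult continuous_Qh_edge[OF q e])
    finally have "edge_diam M e * inner_E M e (avg M q e) (avg M q e)
        \<le> edge_diam M e * (\<Sum>T\<in>edge_tris M e. 1/2 * inner_E M e (q T) (q T))"
      using edge_diam_pos[OF e] by simp
    also have "\<dots> = (\<Sum>T\<in>edge_tris M e. 1/2 * (edge_diam M e * inner_E M e (q T) (q T)))"
      by (simp add: sum_distrib_left mult_ac)
    also have "\<dots> \<le> (\<Sum>T\<in>edge_tris M e. 2 * ratio\<^sup>2 * K * ?I T)"
    proof (rule sum_mono)
      fix T assume "T \<in> edge_tris M e"
      from inverse_trace_inequality[OF K q e this]
      show "1/2 * (edge_diam M e * inner_E M e (q T) (q T)) \<le> 2 * ratio\<^sup>2 * K * ?I T" by simp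
    qed
    finally show ?thesis .
  qed
  then have "(\<Sum>e\<in>edges M. edge_diam M e * inner_E M e (avg M q e) (avg M q e))
      \<le> (\<Sum>e\<in>edges M. \<Sum>T\<in>edge_tris M e. 2 * ratio\<^sup>2 * K * ?I T)" by (rule sum_mono)
  also have "\<dots> = (\<Sum>T\<in>tris M. \<Sum>e\<in>{e\<in>edges M. T \<in> edge_tris M e}. 2 * ratio\<^sup>2 * K * ?I T)"
  proof -
    have "{T \<in> tris M. T \<in> edge_tris M e} = edge_tris M e" for e using edge_trisD by blast
    then show ?thesis
      using sum.swap_restrict[OF finite_edges finite_tris, of "\<lambda>e T. 2 * ratio\<^sup>2 * K * ?I T" "\<lambda>e T. T \<in> edge_tris M e"]
      by simp
  qed
  also have "\<dots> \<le> (\<Sum>T\<in>tris M. 16 * ratio\<^sup>2 * K * ?I T)"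
  proof (rule sum_mono)
    fix T assume "T \<in> tris M"
    have "{e\<in>edges M. T \<in> edge_tris M e} \<subseteq> Pow (range T)" unfolding edge_tris_def by blast
    then have "card {e\<in>edges M. T \<in> edge_tris M e} \<le> card (Pow (range T))"
      by (intro card_mono) auto
    also have "\<dots> = 2 ^ card (range T)" by (simp add: card_Pow)
    also have "\<dots> \<le> 2 ^ 3"
      using card_image_le[of "UNIV :: 3 set" T] by (intro power_increasing) auto
    finally have "real (card {e\<in>edges M. T \<in> edge_tris M e}) \<le> 8" by simp
    then have "real (card {e\<in>edges M. T \<in> edge_tris M e}) * (2 * ratio\<^sup>2 * K * ?I T) \<le> 8 * (2 * ratio\<^sup>2 * K * ?I T)"
      using I0[of T] K(1) by (intro mult_right_mono) auto
    then show "(\<Sum>e\<in>{e\<in>edges M. T \<in> edge_tris M e}. 2 * ratio\<^sup>2 * K * ?I T) \<le> 16 * ratio\<^sup>2 * K * ?I T"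
      by simp
  qed
  also have "\<dots> = 16 * ratio\<^sup>2 * K * inner_h M q q" unfolding inner_h_def by (simp add: sum_distrib_left)
  finally show ?thesis .
qed

section \<open>The lifting operator\<close>

text \<open>
  The contribution of the element over \<open>T\<close> to the right-hand side that defines the lifting, as a
  functional of the test function in reference coordinates; \<open>1/2\<close> is the weight in the average.
\<close>

definition edge_load :: "((real^3) set \<Rightarrow> real^3 \<Rightarrow> real) \<Rightarrow> tri \<Rightarrow> (real^2 \<Rightarrow> real) \<Rightarrow> real" where
  "edge_load \<phi> T w =
     (\<Sum>e\<in>{e\<in>edges M. T \<in> edge_tris M e}. 1/2 * edge_integral M e (\<lambda>x. \<phi> e x * w (ref_pt M T x)))"

text \<open>
  Riesz representation needs the load to vanish on null vectors of the form. A polynomial that is a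
  null vector vanishes on the whole closed triangle by the maximum bound, so in particular on its
  edges.
\<close>

lemma local_lifting_exists:
  assumes \<phi>: "\<phi> \<in> edge_fields" and T: "T \<in> tris M"
  obtains u where "ref_poly m u"
    "\<And>w. ref_poly m w \<Longrightarrow> (LINT x:ref_tri|lborel. u x * w x * area_elt (F T) x) = edge_load \<phi> T w"
proof -
  interpret bilipschitz_patch "F T" "lo T" "ratio * lo T" by (rule patch[OF T])
  define W :: "(real^2 \<Rightarrow> real) set" where "W = {u. continuous_on ref_tri u}"
  define B where "B = (\<lambda>u w. LINT x:ref_tri|lborel. u x * w x * area_elt (F T) x)"
  define mono where "mono = (\<lambda>(i, j) (x::real^2). (x $ 1) ^ i * (x $ 2) ^ j)"
  define I where "I = (SIGMA i:{..m}. {..m - i})"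
  define V where "V = {\<lambda>x. \<Sum>i\<in>I. a i * mono i x |a. True}"
  have poly: "ref_poly m f \<longleftrightarrow> (\<exists>u\<in>V. \<forall>x\<in>ref_tri. f x = u x)" for f
    unfolding V_def I_def mono_def by (rule ref_poly_span)
  have V_poly: "ref_poly m u" if "u \<in> V" for u using poly that by blast
  have int: "set_integrable lborel ref_tri (\<lambda>x. u x * w x * area_elt (F T) x)" if "u \<in> W" "w \<in> W" for u w
    using that unfolding W_def by (intro set_integrable_ref_tri continuous_on_mult continuous_area_elt) auto
  have semi: "semi_inner_product W (\<lambda>c u w x. u x + c * w x) B"
  proof
    fix u w z a assume u: "u \<in> W" and w: "w \<in> W"
    show "(\<lambda>x. u x + a * w x) \<in> W" using u w unfolding W_def by (auto intro!: continuous_intros)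
    show "B u w = B w u" unfolding B_def by (simp add: mult.commute)
    assume z: "z \<in> W"
    have "B (\<lambda>x. u x + a * w x) z = (LINT x:ref_tri|lborel. u x * z x * area_elt (F T) x + a * (w x * z x * area_elt (F T) x))"
      unfolding B_def by (simp add: algebra_simps)
    also have "\<dots> = B u z + a * B w z"
      unfolding B_def
      by (subst set_integral_add(2)) (use int[OF u z] int[OF w z] in \<open>auto intro: set_integrable_mult_right\<close>)
    finally show "B (\<lambda>x. u x + a * w x) z = B u z + a * B w z" .
  next
    show "0 \<le> B u u" for u
      unfolding B_def set_lebesgue_integral_def
      by (intro Bochner_Integration.integral_nonneg) (auto simp: area_elt_def)
  qed
  obtain K where K: "0 < K" "\<And>q P. ref_poly m q \<Longrightarrow> P \<in> ref_tri \<Longrightarrow> (q P)\<^sup>2 \<le> K * (LINT x:ref_tri|lborel. (q x)\<^sup>2)"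
    using ref_poly_sup_bound[of m] by blast
  have load_cong: "edge_load \<phi> T u = edge_load \<phi> T w" if "\<And>x. x \<in> ref_tri \<Longrightarrow> u x = w x" for u w
    unfolding edge_load_def
    by (intro sum.cong refl arg_cong[where f = "\<lambda>y. 1/2 * y"] edge_integral_cong)
       (simp add: that edge_in_reference(2))
  have "\<exists>R\<in>V. \<forall>u\<in>V. B R u = edge_load \<phi> T u"
    unfolding V_def
  proof (rule finite_span_riesz[where W = W and B = B])
    show "finite I" unfolding I_def by auto
    show "semi_inner_product W (\<lambda>c u w x. u x + c * w x) B" by (rule semi)
    show "mono i \<in> W" for i
      unfolding W_def mono_def by (cases i) (auto intro!: continuous_intros)
    show "(\<lambda>x. 0) \<in> W" unfolding W_def by auto
    fix u assume "u \<in> {\<lambda>x. \<Sum>i\<in>I. a i * mono i x |a. True}"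
    then have u: "ref_poly m u" using V_poly unfolding V_def by blast
    assume B0: "B u u = 0"
    have "(LINT x:ref_tri|lborel. (u x)\<^sup>2) \<le> 0"
    proof -
      have "(lo T)\<^sup>2 * (LINT x:ref_tri|lborel. (u x)\<^sup>2) \<le> 0"
        using elem_integral_lower[OF T ref_poly_continuous[OF u]] B0 unfolding B_def by simp
      then show ?thesis using lo_pos by (simp add: mult_le_0_iff)
    qed
    then have "K * (LINT x:ref_tri|lborel. (u x)\<^sup>2) \<le> 0" using K(1) by (simp add: mult_le_0_iff)
    then have "(u x)\<^sup>2 \<le> 0" if "x \<in> ref_tri" for x using K(2)[OF u that] by linarith
    then have "edge_load \<phi> T u = edge_load \<phi> T (\<lambda>x. 0)" by (intro load_cong) simp
    also have "\<dots> = 0" unfolding edge_load_def by (simp add: edge_integral_def)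
    finally show "edge_load \<phi> T u = 0" .
  next
    fix u w a assume u: "u \<in> W" and w: "w \<in> W"
    have "edge_integral M e (\<lambda>x. \<phi> e x * (u (ref_pt M T x) + a * w (ref_pt M T x)))
        = edge_integral M e (\<lambda>x. \<phi> e x * u (ref_pt M T x)) + a * edge_integral M e (\<lambda>x. \<phi> e x * w (ref_pt M T x))"
      if e: "e \<in> edges M" "T \<in> edge_tris M e" for e
    proof -
      have "edge_integral M e (\<lambda>x. \<phi> e x * (u (ref_pt M T x) + a * w (ref_pt M T x)))
          = edge_integral M e (\<lambda>x. \<phi> e x * u (ref_pt M T x) + a * (\<phi> e x * w (ref_pt M T x)))"
        by (simp add: algebra_simps)
      also have "\<dots> = edge_integral M e (\<lambda>x. \<phi> e x * u (ref_pt M T x)) + a * edge_integral M e (\<lambda>x. \<phi> e x * w (ref_pt M T x))"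
        using \<phi> u w e unfolding edge_fields_def W_def
        by (intro edge_integral_comb continuous_on_mult continuous_on_edge_ref[OF e]) auto
      finally show ?thesis .
    qed
    then show "edge_load \<phi> T (\<lambda>x. u x + a * w x) = edge_load \<phi> T u + a * edge_load \<phi> T w"
      unfolding edge_load_def by (simp add: sum.distrib sum_distrib_left algebra_simps)
  qed
  then obtain R where R: "R \<in> V" "\<And>u. u \<in> V \<Longrightarrow> B R u = edge_load \<phi> T u" by blast
  have "B R w = edge_load \<phi> T w" if w: "ref_poly m w" for w
  proof -
    obtain u where u: "u \<in> V" "\<And>x. x \<in> ref_tri \<Longrightarrow> w x = u x" using w poly by blast
    have "B R w = B R u" unfolding B_def by (intro set_lebesgue_integral_cong) (use u ref_tri_measure in auto)
    then show ?thesis using R(2)[OF u(1)] load_cong[OF u(2)] by simp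
  qed
  then show ?thesis using that V_poly[OF R(1)] unfolding B_def by blast
qed

text \<open>
  The elementwise representatives fit together: exchanging the sums over elements and edges turns
  the local loads into averages. So the choice operator picks a function with the required property.
\<close>

lemma Rh_defining_identity:
  assumes \<phi>: "\<phi> \<in> edge_fields"
  shows "Rh k M \<phi> \<in> Qh k M"
    and "q \<in> Qh k M \<Longrightarrow> inner_h M (Rh k M \<phi>) q = (\<Sum>e\<in>edges M. inner_E M e (\<phi> e) (avg M q e))"
proof -
  have "\<forall>T\<in>tris M. \<exists>u. ref_poly (k - 2) u \<and> (\<forall>w. ref_poly (k - 2) w \<longrightarrow>
      (LINT x:ref_tri|lborel. u x * w x * area_elt (F T) x) = edge_load \<phi> T w)"
  proof
    fix T assume T: "T \<in> tris M"
    show "\<exists>u. ref_poly (k - 2) u \<and> (\<forall>w. ref_poly (k - 2) w \<longrightarrow>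
      (LINT x:ref_tri|lborel. u x * w x * area_elt (F T) x) = edge_load \<phi> T w)"
      by (rule local_lifting_exists[OF \<phi> T, of "k - 2"]) blast
  qed
  then obtain U where U: "\<And>T. T \<in> tris M \<Longrightarrow> ref_poly (k - 2) (U T)"
    "\<And>T w. T \<in> tris M \<Longrightarrow> ref_poly (k - 2) w \<Longrightarrow>
      (LINT x:ref_tri|lborel. U T x * w x * area_elt (F T) x) = edge_load \<phi> T w"
    unfolding bchoice_iff by blast
  define R where "R = (\<lambda>T x. U T (ref_pt M T x))"
  have R_Qh: "R \<in> Qh k M"
    unfolding Qh_def
  proof (intro CollectI ballI)
    fix T assume T: "T \<in> tris M"
    obtain a where a: "\<forall>x\<in>ref_tri. U T x = (\<Sum>i\<le>k - 2. \<Sum>j\<le>k - 2 - i. a i j * (x $ 1) ^ i * (x $ 2) ^ j)"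
      using U(1)[OF T] unfolding ref_poly_def by blast
    then have "\<forall>x\<in>ref_tri. (R T \<circ> F T) x = (\<Sum>i\<le>k - 2. \<Sum>j\<le>k - 2 - i. a i j * (x $ 1) ^ i * (x $ 2) ^ j)"
      using ref_pt_F[OF T] by (simp add: R_def)
    then show "ref_poly (k - 2) (R T \<circ> F T)" unfolding ref_poly_def by blast
  qed
  have R_id: "inner_h M R q = (\<Sum>e\<in>edges M. inner_E M e (\<phi> e) (avg M q e))" if q: "q \<in> Qh k M" for q
  proof -
    have elem: "elem_integral M T (\<lambda>x. R T x * q T x) =
        (\<Sum>e\<in>{e\<in>edges M. T \<in> edge_tris M e}. 1/2 * edge_integral M e (\<lambda>x. \<phi> e x * q T x))"
      if T: "T \<in> tris M" for T
    proof -
      have "elem_integral M T (\<lambda>x. R T x * q T x) = (LINT x:ref_tri|lborel. U T x * (q T \<circ> F T) x * area_elt (F T) x)"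
        unfolding elem_integral_def
        by (intro set_lebesgue_integral_cong) (use ref_tri_measure ref_pt_F[OF T] in \<open>auto simp: R_def\<close>)
      also have "\<dots> = edge_load \<phi> T (q T \<circ> F T)"
        using q T unfolding Qh_def by (intro U(2)[OF T]) blast
      also have "\<dots> = (\<Sum>e\<in>{e\<in>edges M. T \<in> edge_tris M e}. 1/2 * edge_integral M e (\<lambda>x. \<phi> e x * q T x))"
        unfolding edge_load_def
        by (intro sum.cong refl arg_cong[where f = "\<lambda>y. 1/2 * y"] edge_integral_cong)
           (simp add: edge_in_reference(3))
      finally show ?thesis .
    qed
    have edge: "inner_E M e (\<phi> e) (avg M q e) = (\<Sum>T\<in>edge_tris M e. 1/2 * edge_integral M e (\<lambda>x. \<phi> e x * q T x))"
      if e: "e \<in> edges M" for e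
    proof -
      have "inner_E M e (\<phi> e) (avg M q e) = edge_integral M e (\<lambda>x. \<Sum>T\<in>edge_tris M e. 1/2 * (\<phi> e x * q T x))"
        unfolding inner_E_def avg_def by (simp add: sum_distrib_left sum_divide_distrib)
      also have "\<dots> = (\<Sum>T\<in>edge_tris M e. 1/2 * edge_integral M e (\<lambda>x. \<phi> e x * q T x))"
        using \<phi> e unfolding edge_fields_def
        by (intro edge_integral_sum[OF e finite_edge_tris] continuous_on_mult continuous_Qh_edge[OF q e]) auto
      finally show ?thesis .
    qed
    have sub: "{T \<in> tris M. T \<in> edge_tris M e} = edge_tris M e" for e using edge_trisD by blast
    have "inner_h M R q = (\<Sum>T\<in>tris M. \<Sum>e\<in>{e\<in>edges M. T \<in> edge_tris M e}. 1/2 * edge_integral M e (\<lambda>x. \<phi> e x * q T x))"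
      unfolding inner_h_def by (rule sum.cong[OF refl elem])
    also have "\<dots> = (\<Sum>e\<in>edges M. \<Sum>T\<in>edge_tris M e. 1/2 * edge_integral M e (\<lambda>x. \<phi> e x * q T x))"
      using sum.swap_restrict[OF finite_tris finite_edges,
          of "\<lambda>T e. 1/2 * edge_integral M e (\<lambda>x. \<phi> e x * q T x)" "\<lambda>T e. T \<in> edge_tris M e"]
      unfolding sub .
    also have "\<dots> = (\<Sum>e\<in>edges M. inner_E M e (\<phi> e) (avg M q e))"
      by (rule sum.cong[OF refl edge[symmetric]])
    finally show ?thesis .
  qed
  have ex: "\<exists>R. R \<in> Qh k M \<and>
     (\<forall>q\<in>Qh k M. inner_h M R q = (\<Sum>e\<in>edges M. inner_E M e (\<phi> e) (avg M q e)))"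
    using R_Qh R_id by blast
  show "Rh k M \<phi> \<in> Qh k M"
    unfolding Rh_def by (rule someI2_ex[OF ex]) blast
  show "inner_h M (Rh k M \<phi>) q = (\<Sum>e\<in>edges M. inner_E M e (\<phi> e) (avg M q e))" if "q \<in> Qh k M"
    unfolding Rh_def by (rule someI2_ex[OF ex]) (use that in blast)
qed

text \<open>
  Testing with the lifting \<open>R\<close> itself gives an estimate of \<open>\<parallel>R\<parallel>\<^sup>4\<close>, from which one factor
  \<open>\<parallel>R\<parallel>\<^sup>2\<close> is cancelled.
\<close>

lemma Rh_stability:
  assumes \<phi>: "\<phi> \<in> edge_fields"
    and K: "0 < K" "\<And>u P. ref_poly (k - 2) u \<Longrightarrow> P \<in> ref_tri \<Longrightarrow>
      (u P)\<^sup>2 \<le> K * (LINT x:ref_tri|lborel. (u x)\<^sup>2)"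
  shows "inner_h M (Rh k M \<phi>) (Rh k M \<phi>) \<le> 16 * ratio\<^sup>2 * K * edge_form \<phi> \<phi>"
proof -
  interpret E: semi_inner_product edge_fields "\<lambda>a \<phi> \<psi> e x. \<phi> e x + a * \<psi> e x" edge_form
    by (rule semi_inner_product_edge_form)
  define R where "R = Rh k M \<phi>"
  define X where "X = inner_h M R R"
  have R: "R \<in> Qh k M" unfolding R_def by (rule Rh_defining_identity(1)[OF \<phi>])
  \<comment> \<open>the weight turns the unweighted edge pairing into the weighted one\<close>
  define \<psi> where "\<psi> = (\<lambda>e x. edge_diam M e * avg M R e x)"
  have \<psi>: "\<psi> \<in> edge_fields"
    using avg_edge_fields[OF R] unfolding edge_fields_def \<psi>_def by (auto intro!: continuous_intros)
  have scale: "edge_integral M e (\<lambda>x. a * f x) = a * edge_integral M e f" for e a f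
    unfolding edge_integral_def by (simp add: mult.assoc)
  have "X = (\<Sum>e\<in>edges M. inner_E M e (\<phi> e) (avg M R e))"
    unfolding X_def using Rh_defining_identity(2)[OF \<phi> R] R_def by simp
  also have "\<dots> = edge_form \<phi> \<psi>"
    unfolding edge_form_def
  proof (rule sum.cong[OF refl])
    fix e assume e: "e \<in> edges M"
    have "inner_E M e (\<phi> e) (\<psi> e) = edge_integral M e (\<lambda>x. edge_diam M e * (\<phi> e x * avg M R e x))"
      unfolding inner_E_def \<psi>_def by (simp add: mult_ac)
    then show "inner_E M e (\<phi> e) (avg M R e) = inverse (edge_diam M e) * inner_E M e (\<phi> e) (\<psi> e)"
      using edge_diam_pos[OF e] unfolding scale by (simp add: inner_E_def)
  qed
  finally have X: "X = edge_form \<phi> \<psi>" .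
  have "edge_form \<psi> \<psi> = (\<Sum>e\<in>edges M. edge_diam M e * inner_E M e (avg M R e) (avg M R e))"
    unfolding edge_form_def
  proof (rule sum.cong[OF refl])
    fix e assume e: "e \<in> edges M"
    have "inner_E M e (\<psi> e) (\<psi> e) = edge_integral M e (\<lambda>x. (edge_diam M e * edge_diam M e) * (avg M R e x * avg M R e x))"
      unfolding inner_E_def \<psi>_def by (simp add: mult_ac)
    then show "inverse (edge_diam M e) * inner_E M e (\<psi> e) (\<psi> e) = edge_diam M e * inner_E M e (avg M R e) (avg M R e)"
      using edge_diam_pos[OF e] unfolding scale by (simp add: inner_E_def)
  qed
  also have "\<dots> \<le> 16 * ratio\<^sup>2 * K * X"
    unfolding X_def by (rule avg_trace_inequality[OF K R])
  finally have H: "edge_form \<psi> \<psi> \<le> 16 * ratio\<^sup>2 * K * X" .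
  have J: "0 \<le> edge_form \<phi> \<phi>" by (rule edge_form_nonneg)
  have "X * X \<le> edge_form \<phi> \<phi> * edge_form \<psi> \<psi>"
    using E.Cauchy_Schwarz[OF \<phi> \<psi>] unfolding X power2_eq_square .
  also have "\<dots> \<le> edge_form \<phi> \<phi> * (16 * ratio\<^sup>2 * K * X)" by (rule mult_left_mono[OF H J])
  also have "\<dots> = (16 * ratio\<^sup>2 * K * edge_form \<phi> \<phi>) * X" by (simp add: mult_ac)
  finally have le: "X * X \<le> (16 * ratio\<^sup>2 * K * edge_form \<phi> \<phi>) * X" .
  have X0: "0 \<le> X"
    unfolding X_def inner_h_def by (intro sum_nonneg elem_integral_nonneg) simp
  have "X \<le> 16 * ratio\<^sup>2 * K * edge_form \<phi> \<phi>"
  proof (cases "X = 0")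
    case True
    then show ?thesis using J K(1) by simp
  next
    case False
    then show ?thesis using le X0 by simp
  qed
  then show ?thesis unfolding X_def R_def .
qed

section \<open>Boundedness and coercivity\<close>

text \<open>
  Adding or subtracting \<open>R\<^sub>h J(v)\<close> costs at most \<open>2 S |J(v)|\<^sup>2\<close>. In the second estimate the
  penalty term is the only control of the jumps, whence the factor \<open>1/\<beta>\<close>.
\<close>

lemma a_h_bounds:
  assumes K: "0 < K" "\<And>u P. ref_poly (k - 2) u \<Longrightarrow> P \<in> ref_tri \<Longrightarrow>
      (u P)\<^sup>2 \<le> K * (LINT x:ref_tri|lborel. (u x)\<^sup>2)"
    and v: "v \<in> Wh k M" and w: "w \<in> Wh k M" and \<beta>: "0 < \<beta>"
  defines "S \<equiv> 16 * ratio\<^sup>2 * K"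
  shows "\<bar>a_h k \<beta> M v w\<bar> \<le> (2 + 2 * S + \<beta>) * triple_norm M v * triple_norm M w"
    and "(triple_norm M v)\<^sup>2 \<le> (2 + (2 * S + 1) / \<beta>) * a_h k \<beta> M v v"
proof -
  interpret H: semi_inner_product elem_fields "\<lambda>a f g T x. f T x + a * g T x" "inner_h M"
    by (rule semi_inner_product_inner_h)
  interpret E: semi_inner_product edge_fields "\<lambda>a \<phi> \<psi> e x. \<phi> e x + a * \<psi> e x" edge_form
    by (rule semi_inner_product_edge_form)
  define L where "L = lap_h M"
  define R where "R = (\<lambda>v. Rh k M (jump M v))"
  define Lt where "Lt = lap_tilde k M"
  define J where "J = jump M"
  have S0: "0 \<le> S" using K(1) unfolding S_def by simp
  have L: "L u \<in> elem_fields" and Jf: "J u \<in> edge_fields" and R: "R u \<in> elem_fields"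
    and RJ: "inner_h M (R u) (R u) \<le> S * edge_form (J u) (J u)" if u: "u \<in> Wh k M" for u
    using lap_h_elem_fields[OF u] jump_edge_fields[OF u] Qh_elem_fields[OF Rh_defining_identity(1)[OF jump_edge_fields[OF u]]]
      Rh_stability[OF jump_edge_fields[OF u] K] unfolding L_def J_def R_def S_def by auto
  \<comment> \<open>the factors \<open>-1\<close> and \<open>1\<close> give both the form of the combination in the semi-inner product\<close>
  have Lt_eq: "Lt u = (\<lambda>T x. L u T x + (-1) * R u T x)" and L_eq: "L u = (\<lambda>T x. Lt u T x + 1 * R u T x)" for u
    unfolding Lt_def L_def R_def by (auto simp: lap_tilde_def fun_eq_iff)
  have Lt: "Lt u \<in> elem_fields" if u: "u \<in> Wh k M" for u
    unfolding Lt_eq by (rule H.comb_in[OF L[OF u] R[OF u]])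
  \<comment> \<open>parallelogram law, with one of the two squares dropped\<close>
  have two: "inner_h M (\<lambda>T x. f T x + a * g T x) (\<lambda>T x. f T x + a * g T x) \<le> 2 * inner_h M f f + 2 * inner_h M g g"
    if f: "f \<in> elem_fields" and g: "g \<in> elem_fields" and a: "a = 1 \<or> a = -1" for f g a
  proof -
    have "0 \<le> inner_h M f f + 2 * (- a) * inner_h M f g + (- a)\<^sup>2 * inner_h M g g"
      using H.nonneg[OF H.comb_in[OF f g, of "- a"]] unfolding H.comb_self[OF f g] .
    then show ?thesis unfolding H.comb_self[OF f g] using a by auto
  qed
  have tn: "(triple_norm M u)\<^sup>2 = inner_h M (L u) (L u) + edge_form (J u) (J u)"
    and tn0: "0 \<le> triple_norm M u" if u: "u \<in> Wh k M" for u
    using H.nonneg[OF L[OF u]] edge_form_nonneg[of "J u"]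
    unfolding triple_norm_def L_def[symmetric] J_def[symmetric] edge_form_def[symmetric] by auto
  have a_eq: "a_h k \<beta> M u u' = inner_h M (Lt u) (Lt u') + \<beta> * edge_form (J u) (J u')" for u u'
    unfolding a_h_def edge_form_def Lt_def J_def ..
  have Lt_tn: "inner_h M (Lt u) (Lt u) \<le> (2 + 2 * S) * (triple_norm M u)\<^sup>2" if u: "u \<in> Wh k M" for u
  proof -
    have "inner_h M (Lt u) (Lt u) \<le> 2 * inner_h M (L u) (L u) + 2 * inner_h M (R u) (R u)"
      unfolding Lt_eq by (rule two[OF L[OF u] R[OF u]]) simp
    also have "\<dots> \<le> 2 * inner_h M (L u) (L u) + 2 * (S * edge_form (J u) (J u))"
      using RJ[OF u] by simp
    also have "\<dots> \<le> (2 + 2 * S) * (inner_h M (L u) (L u) + edge_form (J u) (J u))"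
      using S0 H.nonneg[OF L[OF u]] edge_form_nonneg[of "J u"] by (simp add: algebra_simps)
    finally show ?thesis unfolding tn[OF u] .
  qed
  have "\<bar>inner_h M (Lt v) (Lt w)\<bar> \<le> (2 + 2 * S) * (triple_norm M v * triple_norm M w)"
  proof (rule power2_le_imp_le)
    have "\<bar>inner_h M (Lt v) (Lt w)\<bar>\<^sup>2 \<le> inner_h M (Lt v) (Lt v) * inner_h M (Lt w) (Lt w)"
      using H.Cauchy_Schwarz[OF Lt[OF v] Lt[OF w]] by simp
    also have "\<dots> \<le> ((2 + 2 * S) * (triple_norm M v)\<^sup>2) * ((2 + 2 * S) * (triple_norm M w)\<^sup>2)"
      using Lt_tn[OF v] Lt_tn[OF w] H.nonneg[OF Lt[OF w]] S0 by (intro mult_mono) auto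
    also have "\<dots> = ((2 + 2 * S) * (triple_norm M v * triple_norm M w))\<^sup>2"
      by (simp add: power2_eq_square mult_ac)
    finally show "\<bar>inner_h M (Lt v) (Lt w)\<bar>\<^sup>2 \<le> ((2 + 2 * S) * (triple_norm M v * triple_norm M w))\<^sup>2" .
  qed (use S0 tn0[OF v] tn0[OF w] in simp)
  moreover have "\<bar>edge_form (J v) (J w)\<bar> \<le> triple_norm M v * triple_norm M w"
  proof (rule power2_le_imp_le)
    have "\<bar>edge_form (J v) (J w)\<bar>\<^sup>2 \<le> edge_form (J v) (J v) * edge_form (J w) (J w)"
      using E.Cauchy_Schwarz[OF Jf[OF v] Jf[OF w]] by simp
    also have "\<dots> \<le> (triple_norm M v)\<^sup>2 * (triple_norm M w)\<^sup>2"
      unfolding tn[OF v] tn[OF w]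
      using H.nonneg[OF L[OF v]] H.nonneg[OF L[OF w]] edge_form_nonneg[of "J v"] edge_form_nonneg[of "J w"]
      by (intro mult_mono) auto
    finally show "\<bar>edge_form (J v) (J w)\<bar>\<^sup>2 \<le> (triple_norm M v * triple_norm M w)\<^sup>2"
      by (simp add: power_mult_distrib)
  qed (use tn0[OF v] tn0[OF w] in simp)
  ultimately show "\<bar>a_h k \<beta> M v w\<bar> \<le> (2 + 2 * S + \<beta>) * triple_norm M v * triple_norm M w"
  proof -
    assume 1: "\<bar>inner_h M (Lt v) (Lt w)\<bar> \<le> (2 + 2 * S) * (triple_norm M v * triple_norm M w)"
      and 2: "\<bar>edge_form (J v) (J w)\<bar> \<le> triple_norm M v * triple_norm M w"
    have "\<bar>a_h k \<beta> M v w\<bar> \<le> \<bar>inner_h M (Lt v) (Lt w)\<bar> + \<bar>\<beta> * edge_form (J v) (J w)\<bar>"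
      unfolding a_eq by (rule abs_triangle_ineq)
    also have "\<bar>\<beta> * edge_form (J v) (J w)\<bar> = \<beta> * \<bar>edge_form (J v) (J w)\<bar>"
      using \<beta> by (simp add: abs_mult)
    also have "\<dots> \<le> \<beta> * (triple_norm M v * triple_norm M w)"
      using 2 \<beta> by simp
    finally show ?thesis using 1 by (simp add: algebra_simps)
  qed
  show "(triple_norm M v)\<^sup>2 \<le> (2 + (2 * S + 1) / \<beta>) * a_h k \<beta> M v v"
  proof -
    let ?X = "inner_h M (Lt v) (Lt v)" and ?J = "edge_form (J v) (J v)"
    have X: "0 \<le> ?X" by (rule H.nonneg[OF Lt[OF v]])
    have J0: "0 \<le> ?J" by (rule edge_form_nonneg)
    have "inner_h M (L v) (L v) \<le> 2 * ?X + 2 * inner_h M (R v) (R v)"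
      unfolding L_eq by (rule two[OF Lt[OF v] R[OF v]]) simp
    then have "(triple_norm M v)\<^sup>2 \<le> 2 * ?X + (2 * S + 1) * ?J"
      using RJ[OF v] unfolding tn[OF v] by (simp add: algebra_simps)
    \<comment> \<open>the nonnegative terms added here complete the product\<close>
    also have "\<dots> \<le> 2 * ?X + (2 * S + 1) * ?J + ((2 * S + 1) / \<beta> * ?X + 2 * \<beta> * ?J)"
      using X J0 S0 \<beta> by simp
    also have "\<dots> = (2 + (2 * S + 1) / \<beta>) * (?X + \<beta> * ?J)"
      using \<beta> by (simp add: field_simps)
    finally show ?thesis unfolding a_eq .
  qed
qed

end

theorem lemma3p5:
  fixes \<Gamma> :: "(real^3) set" and n :: "real^3 \<Rightarrow> real^3" and d :: "real^3 \<Rightarrow> real"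
    and k r :: nat and \<delta>\<^sub>0 \<sigma> c C h\<^sub>1 :: real
  assumes "k \<ge> 2" and "r \<ge> 1"
    and "\<Gamma> \<noteq> {}" and "connected \<Gamma>" and "compact \<Gamma>"
    and "hypersurface_of_class (Ck_on (r + 2)) \<Gamma>"
    and "hypersurface_of_class (Ck1_on (max (k + 1) 4)) \<Gamma>"
    and "oriented_by \<Gamma> n"
    and "signed_distance \<Gamma> n d"
    and "tubular_width \<Gamma> d \<delta>\<^sub>0"
    and "\<sigma> > 0" and "c > 0" and "C > 0" and "h\<^sub>1 > 0"
  shows "\<exists>h\<^sub>0>0. \<forall>\<beta>>0. \<exists>C\<^sub>\<beta>>0. \<exists>c\<^sub>\<beta>>0.
    \<forall>\<M>. admissible_family \<Gamma> d \<delta>\<^sub>0 r \<sigma> c C h\<^sub>1 \<M> \<longrightarrow>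
      (\<forall>M\<in>\<M>. mesh_size M < h\<^sub>0 \<longrightarrow>
        (\<forall>v\<in>Wh k M. \<forall>w\<in>Wh k M.
           \<bar>a_h k \<beta> M v w\<bar> \<le> C\<^sub>\<beta> * triple_norm M v * triple_norm M w \<and>
           a_h k \<beta> M v v \<ge> c\<^sub>\<beta> * (triple_norm M v)\<^sup>2))"
proof -
  obtain K where K: "0 < K" "\<And>q P. ref_poly (k - 2) q \<Longrightarrow> P \<in> ref_tri \<Longrightarrow>
      (q P)\<^sup>2 \<le> K * (LINT x:ref_tri|lborel. (q x)\<^sup>2)"
    using ref_poly_sup_bound[of "k - 2"] by blast
  define S where "S = 16 * (regular_mesh.ratio c C)\<^sup>2 * K"
  have S: "0 \<le> S" using K(1) unfolding S_def by simp
  \<comment> \<open>below \<open>h\<^sub>1\<close> the standing mesh assumption supplies all constants\<close>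
  show ?thesis
  proof (rule exI[of _ h\<^sub>1], intro conjI allI impI)
    show "0 < h\<^sub>1" by (rule assms)
    fix \<beta> :: real assume \<beta>: "0 < \<beta>"
    define A where "A = 2 + (2 * S + 1) / \<beta>"
    have A: "0 < A" using S \<beta> unfolding A_def by (intro add_pos_nonneg) auto
    have main: "\<bar>a_h k \<beta> M v w\<bar> \<le> (2 + 2 * S + \<beta>) * triple_norm M v * triple_norm M w \<and>
           a_h k \<beta> M v v \<ge> inverse A * (triple_norm M v)\<^sup>2"
      if "admissible_family \<Gamma> d \<delta>\<^sub>0 r \<sigma> c C h\<^sub>1 \<M>" "M \<in> \<M>" "mesh_size M < h\<^sub>1" and v: "v \<in> Wh k M" and w: "w \<in> Wh k M"
      for \<M> M v w
    proof -
      interpret regular_mesh M r d \<delta>\<^sub>0 c C \<Gamma>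
        using that assms unfolding admissible_family_def by unfold_locales auto
      have "(triple_norm M v)\<^sup>2 \<le> A * a_h k \<beta> M v v"
        using a_h_bounds(2)[OF K v w \<beta>] unfolding A_def S_def .
      then have "inverse A * (triple_norm M v)\<^sup>2 \<le> a_h k \<beta> M v v"
        using A by (simp add: field_simps)
      then show ?thesis
        using a_h_bounds(1)[OF K v w \<beta>] unfolding S_def by simp
    qed
    show "\<exists>C\<^sub>\<beta>>0. \<exists>c\<^sub>\<beta>>0.
      \<forall>\<M>. admissible_family \<Gamma> d \<delta>\<^sub>0 r \<sigma> c C h\<^sub>1 \<M> \<longrightarrow>
        (\<forall>M\<in>\<M>. mesh_size M < h\<^sub>1 \<longrightarrow>
          (\<forall>v\<in>Wh k M. \<forall>w\<in>Wh k M.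
             \<bar>a_h k \<beta> M v w\<bar> \<le> C\<^sub>\<beta> * triple_norm M v * triple_norm M w \<and>
             a_h k \<beta> M v v \<ge> c\<^sub>\<beta> * (triple_norm M v)\<^sup>2))"
      by (rule exI[of _ "2 + 2 * S + \<beta>"], rule conjI, use S \<beta> in simp, rule exI[of _ "inverse A"], rule conjI, use A in simp)
         (use main in blast)
  qed
qed

end
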